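(* Let $N=2$. (i) There is an absolute constant $C$ such that for all integers $L\ge 2$ and all real $\beta\ge1$, $$T^{\mathrm{per}}_{\rm rel}(L,\beta)\le C\,\beta^{3/2}\,e^{2\beta}\,L^2.$$ (ii) There is an absolute constant $C_0$ such that for every integer $L\ge 2$ there exists a constant $c(L)>0$, depending only on $L$, such that for all $\beta\ge1$, $$T^{\mathrm{per}}_{\rm rel}(L,\beta)\ge c(L)\,\beta\,e^{(2-C_0L^{-1})\beta}.$$
   Context: Let $N=2$, $L\ge2$ an integer, $\mathbb S^{1}\subset\mathbb R^2$ the unit circle with its standard Riemannian metric, and $\Omega_L=(\mathbb S^{1})^L$, with configurations $S=(S_1,\dots,S_L)$. The periodic Hamiltonian is $H^{\mathrm{per}}_L(S)=-\sum_{i=1}^{L}S_i\cdot S_{i+1}$ with $S_{L+1}:=S_1$. Let $\nu$ be the Lebesgue measure on $\mathbb S^{1}$ and $\nu_L$ its $L$-fold product on $\Omega_L$. For $\beta>0$ the Gibbs measure is the probability measure $\mu^{\mathrm{per}}_{L,\beta}(dS)=\frac{1}{Z^{\mathrm{per}}_{L,\beta}}e^{-\beta H^{\mathrm{per}}_L(S)}\nu_L(dS)$, with $Z^{\mathrm{per}}_{L,\beta}$ the normalizing constant. For smooth $f:\Omega_L\to\mathbb R$, let $D_if$ be the gradient on $\mathbb S^{1}$ of $f$ with respect to the $i$-th spin. The Dirichlet form is $\mathcal D^{\mathrm{per}}_{L,\beta}(f,f)=\frac1\beta\sum_{i=1}^L\int_{\Omega_L}\|D_if(S)\|^2\,\mu^{\mathrm{per}}_{L,\beta}(dS)$.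 The spectral gap is $\mathrm{gap}^{\mathrm{per}}_{L,\beta}=\inf_f \mathcal D^{\mathrm{per}}_{L,\beta}(f,f)/\mathrm{Var}_{\mu^{\mathrm{per}}_{L,\beta}}(f)$, the infimum being over non-constant smooth $f:\Omega_L\to\mathbb R$, and the relaxation time is $T^{\mathrm{per}}_{\rm rel}(L,\beta)=1/\mathrm{gap}^{\mathrm{per}}_{L,\beta}$. *)

theory Defs
  imports "HOL-Probability.Probability"
begin

text \<open>
  The plane is identified with \<^typ>\<open>complex\<close>, whose library inner product is the Euclidean one on
  pairs (Re, Im). Sites are numbered from 0 to \<open>L - 1\<close>.
\<close>

definition configs :: "nat \<Rightarrow> (nat \<Rightarrow> complex) set" where
  "configs L = {..<L} \<rightarrow>\<^sub>E sphere 0 1"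

definition hamiltonian :: "nat \<Rightarrow> (nat \<Rightarrow> complex) \<Rightarrow> real" where
  "hamiltonian L S = - (\<Sum>i<L. S i \<bullet> S (Suc i mod L))"

text \<open>
  Arc length on the circle, of total mass \<open>2 * pi\<close>. Its underlying space is the circle and not the
  plane, so that the space of the product measure below is exactly \<open>configs L\<close> and values of
  functions outside \<open>configs L\<close> never matter.
\<close>

definition circle_measure :: "complex measure" where
  "circle_measure =
     distr (restrict_space lborel {0..<2 * pi}) (restrict_space borel (sphere 0 1)) cis"

definition config_measure :: "nat \<Rightarrow> (nat \<Rightarrow> complex) measure" where
  "config_measure L = PiM {..<L} (\<lambda>_. circle_measure)"

definition partition_function :: "nat \<Rightarrow> real \<Rightarrow> real" where
  "partition_function L \<beta> = (\<integral>S. exp (- \<beta> * hamiltonian L S) \<partial>config_measure L)"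

definition gibbs :: "nat \<Rightarrow> real \<Rightarrow> (nat \<Rightarrow> complex) measure" where
  "gibbs L \<beta> = density (config_measure L)
     (\<lambda>S. ennreal (exp (- \<beta> * hamiltonian L S) / partition_function L \<beta>))"

text \<open>
  Smoothness on the torus, read off in the angular charts \<open>\<theta> \<mapsto> (cis \<theta>\<^sub>0, \<dots>, cis \<theta>\<^sub>L\<^sub>-\<^sub>1)\<close>: a function is
  smooth iff its pullback to \<open>L\<close>-dimensional Euclidean space is infinitely often continuously
  differentiable, i.e. all its iterated partial derivatives (indexed by the list \<open>ks\<close>) exist and
  are continuous. Euclidean space is the set of extensional functions on \<open>{..<L}\<close>, with the
  product topology.
\<close>

definition angle_config :: "nat \<Rightarrow> (nat \<Rightarrow> real) \<Rightarrow> nat \<Rightarrow> complex" where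
  "angle_config L \<theta> = (\<lambda>i\<in>{..<L}. cis (\<theta> i))"

definition partial_deriv :: "nat \<Rightarrow> ((nat \<Rightarrow> real) \<Rightarrow> real) \<Rightarrow> (nat \<Rightarrow> real) \<Rightarrow> real" where
  "partial_deriv i F \<theta> = deriv (\<lambda>t. F (\<theta>(i := t))) (\<theta> i)"

definition C_infinity :: "nat \<Rightarrow> ((nat \<Rightarrow> real) \<Rightarrow> real) \<Rightarrow> bool" where
  "C_infinity L F \<longleftrightarrow>
     (\<forall>ks. set ks \<subseteq> {..<L} \<longrightarrow>
        continuous_on ({..<L} \<rightarrow>\<^sub>E UNIV) (foldr partial_deriv ks F) \<and>
        (\<forall>i<L. \<forall>\<theta>\<in>{..<L} \<rightarrow>\<^sub>E UNIV.
           (\<lambda>t. foldr partial_deriv ks F (\<theta>(i := t))) differentiable at (\<theta> i)))"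

definition smooth_on_configs :: "nat \<Rightarrow> ((nat \<Rightarrow> complex) \<Rightarrow> real) \<Rightarrow> bool" where
  "smooth_on_configs L f \<longleftrightarrow> C_infinity L (\<lambda>\<theta>. f (angle_config L \<theta>))"

text \<open>
  Riemannian gradient on the circle in the \<open>i\<close>-th spin: \<open>\<i> * S i\<close> is the unit tangent vector at \<open>S i\<close>
  and \<open>t \<mapsto> cis t * S i\<close> is the unit-speed geodesic with that initial velocity.
\<close>

definition spin_gradient ::
    "nat \<Rightarrow> ((nat \<Rightarrow> complex) \<Rightarrow> real) \<Rightarrow> (nat \<Rightarrow> complex) \<Rightarrow> complex" where
  "spin_gradient i f S = deriv (\<lambda>t. f (S(i := cis t * S i))) 0 *\<^sub>R (\<i> * S i)"

definition dirichlet_form :: "nat \<Rightarrow> real \<Rightarrow> ((nat \<Rightarrow> complex) \<Rightarrow> real) \<Rightarrow> real" where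
  "dirichlet_form L \<beta> f =
     1 / \<beta> * (\<Sum>i<L. \<integral>S. (norm (spin_gradient i f S))\<^sup>2 \<partial>gibbs L \<beta>)"

text \<open>
  Extended reals are used so that a vanishing gap would give relaxation time \<open>\<infinity>\<close>, not
  \<open>1 / 0 = 0\<close>.
\<close>

definition spectral_gap :: "nat \<Rightarrow> real \<Rightarrow> ereal" where
  "spectral_gap L \<beta> =
     (INF f \<in> {f. smooth_on_configs L f \<and> \<not> f constant_on configs L}.
        ereal (dirichlet_form L \<beta> f / prob_space.variance (gibbs L \<beta>) f))"

definition relaxation_time :: "nat \<Rightarrow> real \<Rightarrow> ereal" where
  "relaxation_time L \<beta> = 1 / spectral_gap L \<beta>"

end

theory Submission
  imports Defs "HOL-Complex_Analysis.Cauchy_Integral_Formula"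
begin

text \<open>
  Upper bound: dropping the bond that closes the ring changes the Gibbs density by a factor between
  \<open>exp (- \<beta>)\<close> and \<open>exp \<beta>\<close>, which costs \<open>exp (2 * \<beta>)\<close> in the Poincare constant (Holley--Stroock).
  For the open chain the increments \<open>S i / S (i - 1)\<close> are independent von Mises variables, each with
  Poincare constant at most \<open>pi\<^sup>2\<close>, so tensorization of the variance applies. The derivative in the
  \<open>k\<close>-th increment is the sum of the spin derivatives from \<open>k\<close> on; this is the origin of \<open>L\<^sup>2\<close>.

  Lower bound: the test function is a smoothed winding number
  \<open>\<Sum>i<L. \<psi> (\<theta> (i + 1) - \<theta> i)\<close> with \<open>\<psi>' x = 1 - c * exp (- \<kappa> * cos x)\<close> and \<open>\<kappa> = 8 * \<beta>\<close>, which varies only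
  when some bond is close to its maximal energy. Its variance is bounded below on two boxes, around
  the aligned configurations and around those of winding number \<open>1\<close>; the latter cost an energy of
  order \<open>1 / L\<close>. For small \<open>L\<close> the exponent \<open>2 - C\<^sub>0 / L\<close> is negative and global rotation, tested
  with \<open>Re (S 0)\<close>, suffices.
\<close>

section \<open>Tensorization of the variance\<close>

text \<open>Around the ring the increments multiply to 1 and are therefore dependent; opening it
  restores independence. All comparisons are made on unnormalised weights, so no ratio of partition
  functions has to be estimated in either direction.

  The true winding number is locally constant but jumps when a bond passes through pi, hence the
  smoothing. On lifted angles the linear part of \<open>\<psi>\<close> telescopes around the ring,
  so only the weight concentrated at pi enters the gradient. The energy integral then sees at most
  \<open>exp (\<beta> * (L - 2))\<close>, one bond at -1 and the others at 1, up to the cost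
  \<open>exp (\<kappa> / L)\<close> of the smoothing; the boxes have weight at least
  \<open>exp (\<beta> * (L - 41 / L))\<close>. The quotient of the two produces the 2 in the
  exponent, and the constant in front of \<open>1 / L\<close> adds up the two corrections. For this
  \<open>\<kappa>\<close> must be at least \<open>\<beta> / 2\<close>, so that the squared gradient
  outweighs the Boltzmann factor of its bond, and at most of order \<open>\<beta>\<close>.

  In (i) the argument gives the first power of \<open>\<beta>\<close>, which is stronger than the
  power 3/2 for \<open>\<beta> \<ge> 1\<close>.\<close>

lemma (in finite_measure) integrable_bounded:
  fixes f :: "'a \<Rightarrow> real"
  assumes "f \<in> borel_measurable M" "\<And>x. x \<in> space M \<Longrightarrow> \<bar>f x\<bar> \<le> B"
  shows "integrable M f"
  using assms by (intro integrable_const_bound[of _ B]) auto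

lemma (in prob_space) expectation_square_le:
  fixes f :: "'a \<Rightarrow> real"
  assumes "integrable M f" "integrable M (\<lambda>x. (f x)\<^sup>2)"
  shows "(expectation f)\<^sup>2 \<le> expectation (\<lambda>x. (f x)\<^sup>2)"
  using variance_eq[OF assms] variance_positive[of f] by simp

lemma (in prob_space) expectation_square_diff:
  fixes f :: "'a \<Rightarrow> real"
  assumes "integrable M f" "integrable M (\<lambda>x. (f x)\<^sup>2)"
  shows "expectation (\<lambda>x. (f x - c)\<^sup>2) = variance f + (expectation f - c)\<^sup>2"
  using assms by (simp add: variance_eq power2_diff prob_space algebra_simps)
    (simp add: power2_eq_square)

lemma abs_square_diff_le:
  fixes a b :: real
  assumes "\<bar>a\<bar> \<le> B" "\<bar>b\<bar> \<le> B"
  shows "\<bar>(a - b)\<^sup>2\<bar> \<le> 4 * B\<^sup>2"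
  using power_mono[of "\<bar>a - b\<bar>" "2 * B" 2] assms by (simp add: power_mult_distrib)

lemma (in prob_space) abs_expectation_le:
  fixes f :: "'a \<Rightarrow> real"
  assumes "f \<in> borel_measurable M" "\<And>x. x \<in> space M \<Longrightarrow> \<bar>f x\<bar> \<le> B"
  shows "\<bar>expectation f\<bar> \<le> B"
proof -
  have int: "integrable M f" using assms by (rule integrable_bounded)
  have "f x \<le> B" "- B \<le> f x" if "x \<in> space M" for x using assms(2)[OF that] by auto
  then have "expectation f \<le> B" "- B \<le> expectation f"
    using int by (auto intro!: integral_le_const integral_ge_const)
  then show ?thesis by simp
qed

text \<open>The law of total variance leaves the variance of the partial mean \<open>G\<close>.
  Since \<open>G x - m\<close> is the \<open>y\<close>-average of \<open>g (x, y) - H y\<close>,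
  Jensen's inequality bounds its square by the average square, which after exchanging the integrals
  is the mean variance in \<open>x\<close>.\<close>

lemma (in pair_prob_space) variance_pair_le:
  fixes g :: "'a \<times> 'b \<Rightarrow> real"
  assumes g[measurable]: "g \<in> borel_measurable (M1 \<Otimes>\<^sub>M M2)"
    and bnd: "\<And>z. z \<in> space (M1 \<Otimes>\<^sub>M M2) \<Longrightarrow> \<bar>g z\<bar> \<le> B"
  shows "variance g \<le> (\<integral>x. M2.variance (\<lambda>y. g (x, y)) \<partial>M1) + (\<integral>y. M1.variance (\<lambda>x. g (x, y)) \<partial>M2)"
proof -
  define m where "m = expectation g"
  define G where "G x = (\<integral>y. g (x, y) \<partial>M2)" for x
  define H where "H y = (\<integral>x. g (x, y) \<partial>M1)" for y
  have [measurable]: "G \<in> borel_measurable M1" unfolding G_def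
    by (rule M2.borel_measurable_lebesgue_integral) simp
  have [measurable]: "H \<in> borel_measurable M2" unfolding H_def
    by (rule M1.borel_measurable_lebesgue_integral) simp
  have bG: "\<bar>G x\<bar> \<le> B" if "x \<in> space M1" for x unfolding G_def
    using that by (intro M2.abs_expectation_le) (auto intro!: bnd simp: space_pair_measure)
  have bH: "\<bar>H y\<bar> \<le> B" if "y \<in> space M2" for y unfolding H_def
    using that by (intro M1.abs_expectation_le) (auto intro!: bnd simp: space_pair_measure)
  have bm: "\<bar>m\<bar> \<le> B" unfolding m_def by (rule abs_expectation_le[OF g bnd])
  have ig: "integrable (M1 \<Otimes>\<^sub>M M2) g" by (rule integrable_bounded[OF g bnd])
  have igx: "integrable M2 (\<lambda>y. g (x, y))" "integrable M2 (\<lambda>y. (g (x, y))\<^sup>2)" if "x \<in> space M1" for x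
  proof -
    have "\<bar>g (x, y)\<bar> \<le> B" if "y \<in> space M2" for y
      using \<open>x \<in> space M1\<close> that by (auto intro: bnd simp: space_pair_measure)
    moreover from this have "\<bar>(g (x, y))\<^sup>2\<bar> \<le> B\<^sup>2" if "y \<in> space M2" for y
      using that power_mono[of "\<bar>g (x,y)\<bar>" B 2] by auto
    ultimately show "integrable M2 (\<lambda>y. g (x, y))" "integrable M2 (\<lambda>y. (g (x, y))\<^sup>2)"
      using that by (auto intro!: M2.integrable_bounded)
  qed
  have igy: "integrable M1 (\<lambda>x. g (x, y))" if "y \<in> space M2" for y
    using that by (auto intro!: M1.integrable_bounded[of _ B] bnd simp: space_pair_measure)
  have mG: "m = (\<integral>x. G x \<partial>M1)" unfolding m_def G_def by (rule integral_fst'[OF ig, symmetric])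
  have mH: "m = (\<integral>y. H y \<partial>M2)" unfolding m_def H_def using integral_snd[of "\<lambda>x y. g (x, y)"] ig by simp
  have i1: "integrable (M1 \<Otimes>\<^sub>M M2) (\<lambda>z. (g z - m)\<^sup>2)"
    by (rule integrable_bounded[OF _ abs_square_diff_le[OF bnd bm]]) simp_all
  have i2: "integrable (M1 \<Otimes>\<^sub>M M2) (\<lambda>z. (g z - H (snd z))\<^sup>2)"
    by (rule integrable_bounded[OF _ abs_square_diff_le[OF bnd bH]]) (auto simp: space_pair_measure)
  have i3: "integrable (M1 \<Otimes>\<^sub>M M2) (\<lambda>z. (g z - G (fst z))\<^sup>2)"
    by (rule integrable_bounded[OF _ abs_square_diff_le[OF bnd bG]]) (auto simp: space_pair_measure)
  have i4: "integrable M1 (\<lambda>x. (G x - m)\<^sup>2)"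
    by (rule M1.integrable_bounded[OF _ abs_square_diff_le[OF bG bm]]) simp_all
  have V3: "integrable M1 (\<lambda>x. M2.variance (\<lambda>y. g (x, y)))"
    using integrable_fst'[OF i3] by (simp add: G_def)
  have "variance g = (\<integral>x. (\<integral>y. (g (x, y) - m)\<^sup>2 \<partial>M2) \<partial>M1)"
    unfolding m_def[symmetric] by (rule integral_fst'[OF i1, symmetric])
  also have "\<dots> = (\<integral>x. M2.variance (\<lambda>y. g (x, y)) + (G x - m)\<^sup>2 \<partial>M1)"
    by (intro Bochner_Integration.integral_cong refl) (subst M2.expectation_square_diff[OF igx], simp_all add: G_def)
  also have "\<dots> = (\<integral>x. M2.variance (\<lambda>y. g (x, y)) \<partial>M1) + (\<integral>x. (G x - m)\<^sup>2 \<partial>M1)"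
    by (rule Bochner_Integration.integral_add[OF V3 i4])
  also have "(\<integral>x. (G x - m)\<^sup>2 \<partial>M1) \<le> (\<integral>x. (\<integral>y. (g (x, y) - H y)\<^sup>2 \<partial>M2) \<partial>M1)"
  proof (rule integral_mono[OF i4])
    show "integrable M1 (\<lambda>x. \<integral>y. (g (x, y) - H y)\<^sup>2 \<partial>M2)" using integrable_fst'[OF i2] by simp
    fix x assume x: "x \<in> space M1"
    have bx: "\<bar>g (x, y)\<bar> \<le> B" if "y \<in> space M2" for y
      using x that by (auto intro: bnd simp: space_pair_measure)
    have iH: "integrable M2 H" by (rule M2.integrable_bounded[of _ B]) (auto intro: bH)
    have "G x - m = (\<integral>y. g (x, y) - H y \<partial>M2)"
      using igx[OF x] iH by (simp add: mH G_def)
    also have "\<dots>\<^sup>2 \<le> (\<integral>y. (g (x, y) - H y)\<^sup>2 \<partial>M2)"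
      using igx[OF x] iH x
      by (intro M2.expectation_square_le M2.integrable_bounded[OF _ abs_square_diff_le[OF bx bH]]) auto
    finally show "(G x - m)\<^sup>2 \<le> (\<integral>y. (g (x, y) - H y)\<^sup>2 \<partial>M2)" .
  qed
  also have "\<dots> = (\<integral>y. (\<integral>x. (g (x, y) - H y)\<^sup>2 \<partial>M1) \<partial>M2)"
    using Fubini_integral[of "\<lambda>x y. (g (x, y) - H y)\<^sup>2"] i2 by (simp add: split_def)
  finally show ?thesis by (simp add: H_def)
qed

text \<open>Efron--Stein inequality combined with one-coordinate bounds: the induction splits off
  one coordinate by \<open>variance_pair_le\<close>. The majorant \<open>h k\<close> is abstract and
  its hypothesis is phrased with updates \<open>x(k := u)\<close>, so that it passes to the sections
  \<open>x(i := y)\<close> to which the induction hypothesis is applied.\<close>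

lemma (in product_prob_space) variance_PiM_le:
  fixes g :: "('i \<Rightarrow> 'a) \<Rightarrow> real"
  assumes "finite I"
    and "g \<in> borel_measurable (PiM I M)" "\<And>x. x \<in> space (PiM I M) \<Longrightarrow> \<bar>g x\<bar> \<le> B"
    and "\<And>k. k \<in> I \<Longrightarrow> h k \<in> borel_measurable (PiM I M)"
    and "\<And>k x. k \<in> I \<Longrightarrow> x \<in> space (PiM I M) \<Longrightarrow> \<bar>h k x\<bar> \<le> B"
    and "\<And>k x. k \<in> I \<Longrightarrow> x \<in> space (PiM I M) \<Longrightarrow>
      (\<integral>u. (g (x(k := u)) - (\<integral>v. g (x(k := v)) \<partial>M k))\<^sup>2 \<partial>M k) \<le> (\<integral>u. h k (x(k := u)) \<partial>M k)"
  shows "(\<integral>x. (g x - (\<integral>y. g y \<partial>PiM I M))\<^sup>2 \<partial>PiM I M) \<le> (\<Sum>k\<in>I. \<integral>x. h k x \<partial>PiM I M)"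
  using assms
proof (induction I arbitrary: g h rule: finite_induct)
  case empty
  have "g x = (\<integral>y. g y \<partial>PiM {} M)" if "x \<in> space (PiM {} M)" for x
    using that by (auto simp: PiM_empty lebesgue_integral_count_space_finite)
  then have "(\<integral>x. (g x - (\<integral>y. g y \<partial>PiM {} M))\<^sup>2 \<partial>PiM {} M) = (\<integral>x. 0 \<partial>PiM {} M)"
    by (intro Bochner_Integration.integral_cong) auto
  then show ?case by simp
next
  case (insert i I)
  note g[measurable] = insert.prems(1) and bg = insert.prems(2)
    and h = insert.prems(3) and bh = insert.prems(4) and cond = insert.prems(5)
  let ?P = "PiM I M" and ?Q = "PiM (insert i I) M"
  interpret PI: prob_space ?P by (rule prob_space_PiM) (rule prob_space)
  interpret QI: prob_space ?Q by (rule prob_space_PiM) (rule prob_space)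
  interpret pp: pair_prob_space ?P "M i" ..
  have upd[measurable]: "(\<lambda>z. (fst z)(i := snd z)) \<in> ?P \<Otimes>\<^sub>M M i \<rightarrow>\<^sub>M ?Q"
    using measurable_add_dim[of i I M] by (simp add: split_def)
  have sp: "x(i := y) \<in> space ?Q" if "x \<in> space ?P" "y \<in> space (M i)" for x y
    using measurable_space[OF upd, of "(x, y)"] that by (simp add: space_pair_measure)
  have int: "integrable (?P \<Otimes>\<^sub>M M i) (\<lambda>z. F ((fst z)(i := snd z)))"
            "(\<integral>x. F x \<partial>?Q) = (\<integral>z. F ((fst z)(i := snd z)) \<partial>(?P \<Otimes>\<^sub>M M i))"
            "(\<integral>x. F x \<partial>?Q) = (\<integral>x. (\<integral>y. F (x(i := y)) \<partial>M i) \<partial>?P)"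
            "(\<integral>x. F x \<partial>?Q) = (\<integral>y. (\<integral>x. F (x(i := y)) \<partial>?P) \<partial>M i)"
    if F[measurable]: "F \<in> borel_measurable ?Q" and bF: "\<And>x. x \<in> space ?Q \<Longrightarrow> \<bar>F x\<bar> \<le> D" for F :: "('i \<Rightarrow> 'a) \<Rightarrow> real" and D
  proof -
    have "integrable ?Q F" using F bF by (rule QI.integrable_bounded)
    then show 1: "(\<integral>x. F x \<partial>?Q) = (\<integral>x. (\<integral>y. F (x(i := y)) \<partial>M i) \<partial>?P)"
      by (rule product_integral_insert[OF insert.hyps(1,2)])
    show 2: "integrable (?P \<Otimes>\<^sub>M M i) (\<lambda>z. F ((fst z)(i := snd z)))"
      by (rule pp.integrable_bounded[of _ D]) (auto intro!: bF sp simp: space_pair_measure)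
    show "(\<integral>x. F x \<partial>?Q) = (\<integral>z. F ((fst z)(i := snd z)) \<partial>(?P \<Otimes>\<^sub>M M i))"
      unfolding 1 using pp.integral_fst'[OF 2] by simp
    show "(\<integral>x. F x \<partial>?Q) = (\<integral>y. (\<integral>x. F (x(i := y)) \<partial>?P) \<partial>M i)"
      unfolding 1 using pp.Fubini_integral[of "\<lambda>x y. F (x(i := y))"] 2 by (simp add: split_def)
  qed
  have b2: "\<bar>(g x - (\<integral>y. g y \<partial>?Q))\<^sup>2\<bar> \<le> 4 * B\<^sup>2" if "x \<in> space ?Q" for x
    by (intro abs_square_diff_le bg that QI.abs_expectation_le g)
  have hint: "integrable (?P \<Otimes>\<^sub>M M i) (\<lambda>(x, y). h k (x(i := y)))" if "k \<in> insert i I" for k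
    unfolding split_def by (rule int(1)[OF h[OF that] bh[OF that]])
  define m where "m = (\<integral>y. g y \<partial>?Q)"
  have m: "m = pp.expectation (\<lambda>z. g ((fst z)(i := snd z)))" unfolding m_def by (rule int(2)[OF g bg])
  have "(\<integral>x. (g x - m)\<^sup>2 \<partial>?Q) = (\<integral>z. (g ((fst z)(i := snd z)) - m)\<^sup>2 \<partial>(?P \<Otimes>\<^sub>M M i))"
    by (rule int(2)[of "\<lambda>x. (g x - m)\<^sup>2" "4 * B\<^sup>2"]) (use b2 in \<open>auto simp: m_def\<close>)
  then have "(\<integral>x. (g x - (\<integral>y. g y \<partial>?Q))\<^sup>2 \<partial>?Q) = pp.variance (\<lambda>z. g ((fst z)(i := snd z)))"
    unfolding m[symmetric] by (simp only: m_def)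
  also have "\<dots> \<le> (\<integral>x. M.variance i (\<lambda>y. g (x(i := y))) \<partial>?P)
                 + (\<integral>y. PI.variance (\<lambda>x. g (x(i := y))) \<partial>M i)"
  proof -
    have "(\<lambda>z. g ((fst z)(i := snd z))) \<in> borel_measurable (?P \<Otimes>\<^sub>M M i)" by measurable
    moreover have "\<bar>g ((fst z)(i := snd z))\<bar> \<le> B" if "z \<in> space (?P \<Otimes>\<^sub>M M i)" for z
      using that by (intro bg sp) (auto simp: space_pair_measure)
    ultimately show ?thesis
      using pp.variance_pair_le[of "\<lambda>z. g ((fst z)(i := snd z))" B] by (simp only: fst_conv snd_conv)
  qed
  also have "(\<integral>x. M.variance i (\<lambda>y. g (x(i := y))) \<partial>?P) \<le> (\<integral>x. h i x \<partial>?Q)"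
  proof -
    have hi[measurable]: "h i \<in> borel_measurable ?Q" using h by simp
    have bhi: "\<bar>h i x\<bar> \<le> B" if "x \<in> space ?Q" for x using bh that by simp
    have e: "(\<integral>x. h i x \<partial>?Q) = (\<integral>x. (\<integral>y. h i (x(i := y)) \<partial>M i) \<partial>?P)"
      by (rule int(3)[OF hi bhi])
    have le: "M.variance i (\<lambda>y. g (x(i := y))) \<le> (\<integral>y. h i (x(i := y)) \<partial>M i)" if x: "x \<in> space ?P" for x
    proof -
      \<comment> \<open>The hypothesis speaks of points of the enlarged product, so an arbitrary
        value fills coordinate \<open>i\<close>; the updates in the inequality overwrite it.\<close>
      obtain y where y: "y \<in> space (M i)" using M.not_empty by blast
      from cond[of i "x(i := y)"] sp[OF x y] show ?thesis
        by (simp only: fun_upd_upd insert_iff simp_thms)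
    qed
    \<comment> \<open>The rule asks for integrability of the larger side only; that side is
      nonnegative because it dominates a variance.\<close>
    show ?thesis unfolding e
    proof (rule integral_mono'[OF _ le])
      show "integrable ?P (\<lambda>x. \<integral>y. h i (x(i := y)) \<partial>M i)"
        using pp.integrable_fst'[OF int(1)[OF hi bhi]] by simp
      show "0 \<le> (\<integral>y. h i (x(i := y)) \<partial>M i)" if "x \<in> space ?P" for x
        by (rule order_trans[OF _ le[OF that]]) simp
    qed
  qed
  also have "(\<integral>y. PI.variance (\<lambda>x. g (x(i := y))) \<partial>M i) \<le> (\<integral>y. (\<Sum>k\<in>I. \<integral>x. h k (x(i := y)) \<partial>?P) \<partial>M i)"
  proof -
    have le: "PI.variance (\<lambda>x. g (x(i := y))) \<le> (\<Sum>k\<in>I. \<integral>x. h k (x(i := y)) \<partial>?P)"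
      if y: "y \<in> space (M i)" for y
    proof -
    have updy: "(\<lambda>x. x(i := y)) \<in> ?P \<rightarrow>\<^sub>M ?Q"
      using measurable_compose[OF measurable_Pair2'[OF y] upd] by simp
    show ?thesis
    proof (rule insert.IH)
      show "(\<lambda>x. g (x(i := y))) \<in> borel_measurable ?P" by (rule measurable_compose[OF updy g])
      show "\<bar>g (x(i := y))\<bar> \<le> B" if "x \<in> space ?P" for x by (rule bg[OF sp[OF that y]])
      show "(\<lambda>x. h k (x(i := y))) \<in> borel_measurable ?P" if "k \<in> I" for k
        by (rule measurable_compose[OF updy h]) (use that in simp)
      show "\<bar>h k (x(i := y))\<bar> \<le> B" if "k \<in> I" "x \<in> space ?P" for k x
        by (rule bh[OF _ sp[OF that(2) y]]) (use that in simp)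
      fix k x assume k: "k \<in> I" and x: "x \<in> space ?P"
      have "i \<noteq> k" using k insert.hyps by auto
      then show "(\<integral>u. (g (x(k := u, i := y)) - (\<integral>v. g (x(k := v, i := y)) \<partial>M k))\<^sup>2 \<partial>M k)
          \<le> (\<integral>u. h k (x(k := u, i := y)) \<partial>M k)"
        using cond[OF insertI2[OF k] sp[OF x y]] by (simp only: fun_upd_twist[of i k] not_False_eq_True simp_thms)
    qed
    qed
    show ?thesis
    proof (rule integral_mono'[OF _ le])
      show "integrable (M i) (\<lambda>y. \<Sum>k\<in>I. \<integral>x. h k (x(i := y)) \<partial>?P)"
        by (intro Bochner_Integration.integrable_sum pp.integrable_snd hint) simp
      show "0 \<le> (\<Sum>k\<in>I. \<integral>x. h k (x(i := y)) \<partial>?P)" if "y \<in> space (M i)" for y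
        by (rule order_trans[OF _ le[OF that]]) simp
    qed
  qed
  also have "(\<integral>y. (\<Sum>k\<in>I. \<integral>x. h k (x(i := y)) \<partial>?P) \<partial>M i) = (\<Sum>k\<in>I. \<integral>x. h k x \<partial>?Q)"
  proof (subst Bochner_Integration.integral_sum)
    show "integrable (M i) (\<lambda>y. \<integral>x. h k (x(i := y)) \<partial>?P)" if "k \<in> I" for k
      using that by (intro pp.integrable_snd hint) simp
    show "(\<Sum>k\<in>I. \<integral>y. (\<integral>x. h k (x(i := y)) \<partial>?P) \<partial>M i) = (\<Sum>k\<in>I. \<integral>x. h k x \<partial>?Q)"
      by (intro sum.cong refl int(4)[symmetric, OF h bh]) auto
  qed
  finally show ?case using insert.hyps by simp
qed

section \<open>Poincare inequality on an interval whose weight decreases away from one end\<close>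

lemma integral_square_le:
  fixes f :: "real \<Rightarrow> real"
  assumes "s \<le> t" and cont: "continuous_on {s..t} f"
  shows "(integral {s..t} f)\<^sup>2 \<le> (t - s) * integral {s..t} (\<lambda>x. (f x)\<^sup>2)"
proof (cases "s = t")
  case False
  define m where "m = integral {s..t} f / (t - s)"
  have i: "f integrable_on {s..t}" "(\<lambda>x. (f x)\<^sup>2) integrable_on {s..t}"
    by (intro integrable_continuous_real continuous_intros cont)+
  have "0 \<le> integral {s..t} (\<lambda>x. (f x - m)\<^sup>2)"
    by (intro Henstock_Kurzweil_Integration.integral_nonneg integrable_continuous_real continuous_intros cont) auto
  also have "\<dots> = integral {s..t} (\<lambda>x. (f x)\<^sup>2 - 2 * m * f x + m\<^sup>2)"
    by (simp add: power2_diff algebra_simps)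
  also have "\<dots> = integral {s..t} (\<lambda>x. (f x)\<^sup>2) - 2 * m * integral {s..t} f + m\<^sup>2 * (t - s)"
  proof (rule integral_unique)
    have "((\<lambda>x. (f x)\<^sup>2 - 2 * m * f x + m\<^sup>2) has_integral
        integral {s..t} (\<lambda>x. (f x)\<^sup>2) - 2 * m * integral {s..t} f + (t - s) *\<^sub>R m\<^sup>2) {s..t}"
      using i has_integral_const_real[of "m\<^sup>2" s t] \<open>s \<le> t\<close>
      by (intro has_integral_add has_integral_diff has_integral_mult_right integrable_integral) auto
    then show "((\<lambda>x. (f x)\<^sup>2 - 2 * m * f x + m\<^sup>2) has_integral
        integral {s..t} (\<lambda>x. (f x)\<^sup>2) - 2 * m * integral {s..t} f + m\<^sup>2 * (t - s)) {s..t}"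
      by (simp add: mult.commute)
  qed
  also have "\<dots> = integral {s..t} (\<lambda>x. (f x)\<^sup>2) - (integral {s..t} f)\<^sup>2 / (t - s)"
  proof -
    have "t - s \<noteq> 0" using False by simp
    then show ?thesis unfolding m_def by (simp add: power2_eq_square)
  qed
  finally show ?thesis using False \<open>s \<le> t\<close> by (simp add: field_simps)
qed simp

text \<open>\<open>g x - g e\<close> is the integral of \<open>g'\<close> over the segment from
  \<open>e\<close> to \<open>x\<close>, and Cauchy--Schwarz bounds its square. The weight at
  \<open>x\<close> is the smallest on that segment, so \<open>w x\<close> may be replaced by
  \<open>w y\<close> under the integral sign. The resulting bound is uniform in \<open>x\<close> and
  involves no ratio of weights.\<close>

lemma weighted_poincare_interval:
  fixes w g g' :: "real \<Rightarrow> real"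
  assumes pq: "p \<le> q" and e: "e \<in> {p, q}"
    and w: "continuous_on {p..q} w" "\<And>x. x \<in> {p..q} \<Longrightarrow> 0 \<le> w x"
    and mono: "\<And>x y. x \<in> {p..q} \<Longrightarrow> y \<in> closed_segment e x \<Longrightarrow> w x \<le> w y"
    and g: "\<And>x. x \<in> {p..q} \<Longrightarrow> (g has_real_derivative g' x) (at x within {p..q})"
    and g': "continuous_on {p..q} g'"
  shows "integral {p..q} (\<lambda>x. w x * (g x - g e)\<^sup>2) \<le> (q - p)\<^sup>2 * integral {p..q} (\<lambda>x. w x * (g' x)\<^sup>2)"
proof -
  define J where "J = integral {p..q} (\<lambda>x. w x * (g' x)\<^sup>2)"
  have gc: "continuous_on {p..q} g" by (meson DERIV_continuous_on g)
  have pw: "w x * (g x - g e)\<^sup>2 \<le> (q - p) * J" if x: "x \<in> {p..q}" for x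
  proof -
    define s where "s = min e x"
    define t where "t = max e x"
    have st: "s \<le> t" "{s..t} \<subseteq> {p..q}" "closed_segment e x = {s..t}"
      using x e pq by (auto simp: s_def t_def closed_segment_eq_real_ivl)
    have "(g' has_integral (g t - g s)) {s..t}"
    proof (rule fundamental_theorem_of_calculus[OF st(1)])
      fix y assume "y \<in> {s..t}"
      then have "(g has_real_derivative g' y) (at y within {p..q})" using st g by auto
      then show "(g has_vector_derivative g' y) (at y within {s..t})"
        unfolding has_real_derivative_iff_has_vector_derivative[symmetric]
        by (rule has_field_derivative_subset[OF _ st(2)])
    qed
    then have "(g x - g e)\<^sup>2 = (integral {s..t} g')\<^sup>2"
      by (auto simp: integral_unique s_def t_def min_def max_def power2_commute)
    also have "\<dots> \<le> (t - s) * integral {s..t} (\<lambda>y. (g' y)\<^sup>2)"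
      using st g' by (intro integral_square_le) (auto intro: continuous_on_subset)
    finally have "w x * (g x - g e)\<^sup>2 \<le> (t - s) * (w x * integral {s..t} (\<lambda>y. (g' y)\<^sup>2))"
      using w(2)[OF x] by (simp add: mult_left_mono mult.left_commute)
    also have "w x * integral {s..t} (\<lambda>y. (g' y)\<^sup>2) = integral {s..t} (\<lambda>y. w x * (g' y)\<^sup>2)"
      by simp
    also have "\<dots> \<le> integral {s..t} (\<lambda>y. w y * (g' y)\<^sup>2)"
      using st g' w(1) mono[OF x]
      by (intro Henstock_Kurzweil_Integration.integral_le integrable_continuous_real continuous_intros mult_right_mono)
         (auto intro: continuous_on_subset)
    also have "\<dots> \<le> J" unfolding J_def
      using st g' w
      by (intro integral_subset_le integrable_continuous_real continuous_intros)
         (auto intro: continuous_on_subset)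
    finally have "w x * (g x - g e)\<^sup>2 \<le> (t - s) * J" using st by (simp add: mult_left_mono)
    moreover have "0 \<le> J" unfolding J_def
      using w g' by (intro Henstock_Kurzweil_Integration.integral_nonneg integrable_continuous_real continuous_intros) auto
    moreover have "t - s \<le> q - p" using st by auto
    ultimately show ?thesis by (meson mult_right_mono order_trans)
  qed
  have "integral {p..q} (\<lambda>x. w x * (g x - g e)\<^sup>2) \<le> integral {p..q} (\<lambda>x. (q - p) * J)"
    using pw w gc by (intro Henstock_Kurzweil_Integration.integral_le integrable_continuous_real continuous_intros) auto
  also have "\<dots> = (q - p)\<^sup>2 * J" using pq by (simp add: power2_eq_square)
  finally show ?thesis by (simp add: J_def)
qed

section \<open>Uniform measure on the torus\<close>

lemma sets_circle_measure [measurable_cong]: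
  "sets circle_measure = sets (restrict_space borel (sphere 0 1))"
  by (simp add: circle_measure_def)

lemma space_circle_measure: "space circle_measure = sphere 0 1"
  by (simp add: circle_measure_def space_restrict_space)

lemma measurable_cis_circle [measurable]: "cis \<in> borel \<rightarrow>\<^sub>M circle_measure"
proof -
  have "cis \<in> borel_measurable borel"
    by (intro borel_measurable_continuous_onI continuous_intros)
  then show ?thesis
    by (auto simp: measurable_cong_sets[OF refl sets_circle_measure] intro!: measurable_restrict_space2)
qed

lemma nn_integral_circle:
  assumes [measurable]: "f \<in> borel_measurable circle_measure"
  shows "(\<integral>\<^sup>+z. f z \<partial>circle_measure) = (\<integral>\<^sup>+t. f (cis t) * indicator {0..<2 * pi} t \<partial>lborel)"
proof -
  have m: "cis \<in> restrict_space lborel {0..<2 * pi} \<rightarrow>\<^sub>M restrict_space borel (sphere 0 1)"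
    using measurable_cis_circle
    by (auto simp: measurable_cong_sets[OF refl sets_circle_measure] intro!: measurable_restrict_space1)
  have f: "f \<in> borel_measurable (restrict_space borel (sphere 0 1))"
    using assms by (simp add: measurable_cong_sets[OF sets_circle_measure refl])
  show ?thesis
    unfolding circle_measure_def
    by (subst nn_integral_distr[OF m], use f in simp)
       (simp add: nn_integral_restrict_space)
qed

lemma emeasure_circle_measure: "emeasure circle_measure (space circle_measure) = ennreal (2 * pi)"
  using nn_integral_circle[of "\<lambda>_. 1"] by simp

lemma finite_measure_circle: "finite_measure circle_measure"
  by standard (simp add: emeasure_circle_measure)

lemma borel_measurable_circle:
  "f \<in> borel \<rightarrow>\<^sub>M M \<Longrightarrow> f \<in> circle_measure \<rightarrow>\<^sub>M M"
  by (simp add: measurable_cong_sets[OF sets_circle_measure refl] measurable_restrict_space1)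

lemma measurable_circle_id [measurable]: "(\<lambda>z. z) \<in> borel_measurable circle_measure"
  by (rule borel_measurable_circle) simp

lemma measurable_into_circle:
  assumes "f \<in> borel_measurable M" "\<And>x. x \<in> space M \<Longrightarrow> f x \<in> sphere 0 1"
  shows "f \<in> M \<rightarrow>\<^sub>M circle_measure"
  using assms by (auto simp: measurable_cong_sets[OF refl sets_circle_measure] intro!: measurable_restrict_space2)

text \<open>The shifted window is cut at \<open>2 * pi\<close>, and the overhang of length
  \<open>a\<close> is moved back by one period.\<close>

lemma nn_integral_periodic_shift:
  fixes h :: "real \<Rightarrow> ennreal"
  assumes [measurable]: "h \<in> borel_measurable borel" and per: "\<And>t. h (t + 2 * pi) = h t"
    and a: "0 \<le> a" "a < 2 * pi"
  shows "(\<integral>\<^sup>+t. h (a + t) * indicator {0..<2 * pi} t \<partial>lborel) = (\<integral>\<^sup>+t. h t * indicator {0..<2 * pi} t \<partial>lborel)"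
proof -
  have shift: "(\<integral>\<^sup>+t. f t \<partial>lborel) = (\<integral>\<^sup>+t. f (c + t) \<partial>lborel)"
    if "f \<in> borel_measurable borel" for f :: "real \<Rightarrow> ennreal" and c
    using nn_integral_real_affine[of f 1 c] that by simp
  have "(\<integral>\<^sup>+t. h (a + t) * indicator {0..<2 * pi} t \<partial>lborel)
      = (\<integral>\<^sup>+t. h t * indicator {0..<2 * pi} (t - a) \<partial>lborel)"
    by (subst shift[of "\<lambda>t. h t * indicator {0..<2 * pi} (t - a)" a]) simp_all
  also have "\<dots> = (\<integral>\<^sup>+t. h t * indicator {a..<2 * pi} t + h t * indicator {2 * pi..<2 * pi + a} t \<partial>lborel)"
    using a by (intro nn_integral_cong) (auto split: split_indicator)
  also have "\<dots> = (\<integral>\<^sup>+t. h t * indicator {a..<2 * pi} t \<partial>lborel)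
      + (\<integral>\<^sup>+t. h t * indicator {2 * pi..<2 * pi + a} t \<partial>lborel)"
    by (intro nn_integral_add) auto
  also have "(\<integral>\<^sup>+t. h t * indicator {2 * pi..<2 * pi + a} t \<partial>lborel)
      = (\<integral>\<^sup>+t. h t * indicator {0..<a} t \<partial>lborel)"
    by (subst shift[of _ "2 * pi"]) (auto simp: per add.commute[of "2 * pi"] intro!: nn_integral_cong split: split_indicator)
  also have "(\<integral>\<^sup>+t. h t * indicator {a..<2 * pi} t \<partial>lborel) + \<dots>
      = (\<integral>\<^sup>+t. h t * indicator {a..<2 * pi} t + h t * indicator {0..<a} t \<partial>lborel)"
    by (intro nn_integral_add[symmetric]) auto
  also have "\<dots> = (\<integral>\<^sup>+t. h t * indicator {0..<2 * pi} t \<partial>lborel)"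
    using a by (intro nn_integral_cong) (auto split: split_indicator)
  finally show ?thesis .
qed

lemma sphere_cis_cases:
  assumes "z \<in> sphere 0 1" obtains a where "0 \<le> a" "a < 2 * pi" "z = cis a"
proof
  show "z = cis (Arg2pi z)" using Arg2pi_eq[of z] assms by (simp add: cis_conv_exp)
qed (use Arg2pi_ge_0 Arg2pi_lt_2pi in auto)

lemma measurable_mult_circle:
  "c \<in> sphere 0 1 \<Longrightarrow> (\<lambda>z. c * z) \<in> circle_measure \<rightarrow>\<^sub>M circle_measure"
  by (rule measurable_into_circle) (auto simp: space_circle_measure norm_mult)

lemma nn_integral_circle_rotate:
  assumes f[measurable]: "f \<in> borel_measurable circle_measure" and c: "c \<in> sphere 0 1"
  shows "(\<integral>\<^sup>+z. f (c * z) \<partial>circle_measure) = (\<integral>\<^sup>+z. f z \<partial>circle_measure)"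
proof -
  obtain a where a: "0 \<le> a" "a < 2 * pi" "c = cis a" using c by (rule sphere_cis_cases)
  have [measurable]: "(\<lambda>t. f (cis t)) \<in> borel_measurable borel" by measurable
  have [measurable]: "(\<lambda>z. c * z) \<in> circle_measure \<rightarrow>\<^sub>M circle_measure" by (rule measurable_mult_circle[OF c])
  have "(\<integral>\<^sup>+z. f (c * z) \<partial>circle_measure) = (\<integral>\<^sup>+t. f (cis (a + t)) * indicator {0..<2 * pi} t \<partial>lborel)"
    using measurable_compose[OF measurable_mult_circle[OF c] f]
    by (subst nn_integral_circle) (auto simp: a cis_mult)
  also have "\<dots> = (\<integral>\<^sup>+t. f (cis t) * indicator {0..<2 * pi} t \<partial>lborel)"
    by (rule nn_integral_periodic_shift) (use a in \<open>auto simp: cis_mult[symmetric]\<close>)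
  also have "\<dots> = (\<integral>\<^sup>+z. f z \<partial>circle_measure)" by (simp add: nn_integral_circle)
  finally show ?thesis .
qed

interpretation circle: finite_measure circle_measure by (rule finite_measure_circle)
interpretation circles: product_sigma_finite "\<lambda>_::nat. circle_measure"
  by standard

lemma space_config_measure: "space (config_measure L) = configs L"
  by (simp add: config_measure_def configs_def space_PiM space_circle_measure)

lemma sets_config_measure [measurable_cong]:
  "sets (config_measure L) = sets (PiM {..<L} (\<lambda>_. circle_measure))"
  by (simp add: config_measure_def)

lemma emeasure_config_measure: "emeasure (config_measure L) (configs L) = ennreal ((2 * pi) ^ L)"
  unfolding config_measure_def configs_def space_circle_measure[symmetric]
  by (subst circles.emeasure_PiM) (simp_all add: emeasure_circle_measure ennreal_power)

lemma finite_measure_config: "finite_measure (config_measure L)"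
  by standard (simp add: space_config_measure emeasure_config_measure)

lemma nn_integral_config_Suc:
  assumes "f \<in> borel_measurable (config_measure (Suc n))"
  shows "(\<integral>\<^sup>+S. f S \<partial>config_measure (Suc n))
       = (\<integral>\<^sup>+S. (\<integral>\<^sup>+z. f (S(n := z)) \<partial>circle_measure) \<partial>config_measure n)"
  using circles.product_nn_integral_insert[of "{..<n}" n f] assms
  by (simp add: config_measure_def lessThan_Suc)

lemma measurable_config_update:
  "(\<lambda>(S, z). S(n := z)) \<in> config_measure n \<Otimes>\<^sub>M circle_measure \<rightarrow>\<^sub>M config_measure (Suc n)"
  using measurable_add_dim[of n "{..<n}" "\<lambda>_. circle_measure"]
  by (simp add: config_measure_def lessThan_Suc)

lemma measurable_config_component:
  "i < L \<Longrightarrow> (\<lambda>S. S i) \<in> config_measure L \<rightarrow>\<^sub>M circle_measure"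
  unfolding config_measure_def by (rule measurable_component_singleton) simp

section \<open>Increment coordinates: spins as products of independent increments\<close>

definition partial_products :: "nat \<Rightarrow> (nat \<Rightarrow> complex) \<Rightarrow> nat \<Rightarrow> complex" where
  "partial_products L U = (\<lambda>i\<in>{..<L}. \<Prod>j\<le>i. U j)"

lemma measurable_partial_products [measurable]:
  "partial_products L \<in> config_measure L \<rightarrow>\<^sub>M config_measure L"
proof -
  have "(\<lambda>U. \<Prod>j\<le>i. U j) \<in> config_measure L \<rightarrow>\<^sub>M circle_measure" if "i < L" for i
  proof (rule measurable_into_circle)
    have "(\<lambda>U. U j) \<in> borel_measurable (config_measure L)" if "j \<le> i" for j
      using measurable_compose[OF measurable_config_component measurable_circle_id] that \<open>i < L\<close> by simp
    then show "(\<lambda>U. \<Prod>j\<le>i. U j) \<in> borel_measurable (config_measure L)"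
      by (intro borel_measurable_prod) auto
    show "(\<Prod>j\<le>i. U j) \<in> sphere 0 1" if "U \<in> space (config_measure L)" for U
    proof -
      have "cmod (U j) = 1" if "j \<le> i" for j
        using that \<open>i < L\<close> \<open>U \<in> _\<close> by (auto simp: space_config_measure configs_def PiE_def Pi_def)
      then show ?thesis by (simp add: prod_norm[symmetric])
    qed
  qed
  then show ?thesis unfolding partial_products_def config_measure_def[of L]
    by (intro measurable_restrict) (auto simp: config_measure_def)
qed

lemma partial_products_in_configs: "U \<in> configs L \<Longrightarrow> partial_products L U \<in> configs L"
  using measurable_space[OF measurable_partial_products[of L]] by (simp add: space_config_measure)

text \<open>The last spin is the last increment times a factor depending on the earlier increments
  only. Rotation invariance of the circle removes that factor under the inner integral, and the
  induction hypothesis handles the rest.\<close>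

lemma nn_integral_partial_products:
  assumes "f \<in> borel_measurable (config_measure L)"
  shows "(\<integral>\<^sup>+U. f (partial_products L U) \<partial>config_measure L) = (\<integral>\<^sup>+S. f S \<partial>config_measure L)"
  using assms
proof (induction L arbitrary: f)
  case 0
  have "f (partial_products 0 U) = f U" if "U \<in> space (config_measure 0)" for U
    using that by (auto simp: partial_products_def space_config_measure configs_def restrict_def)
  then show ?case by (intro nn_integral_cong)
next
  case (Suc n)
  note f = Suc.prems
  note meas [measurable] = measurable_compose[OF measurable_config_update[unfolded split_def] f]
  \<comment> \<open>The last spin already built. For \<open>n = 0\<close> it has to be the empty
    product, since the truncated \<open>n - 1\<close> would point to no spin.\<close>
  define p where "p U = (if n = 0 then 1 else partial_products n U (n - 1))" for U :: "nat \<Rightarrow> complex"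
  have p: "p U \<in> sphere 0 1" if "U \<in> space (config_measure n)" for U
    using partial_products_in_configs[of U n] that
    by (auto simp: p_def space_config_measure configs_def PiE_def Pi_def)
  have upd: "partial_products (Suc n) (U(n := z)) = (partial_products n U)(n := p U * z)" for U z
  proof (rule ext)
    fix i
    have *: "(\<Prod>j\<le>i. (U(n := z)) j) = (\<Prod>j\<le>i. U j)" if "i < n" for i
      using that by (intro prod.cong) auto
    show "partial_products (Suc n) (U(n := z)) i = ((partial_products n U)(n := p U * z)) i"
      by (cases n) (auto simp: partial_products_def p_def * intro!: prod.cong)
  qed
  have "(\<integral>\<^sup>+U. f (partial_products (Suc n) U) \<partial>config_measure (Suc n))
      = (\<integral>\<^sup>+U. (\<integral>\<^sup>+z. f ((partial_products n U)(n := p U * z)) \<partial>circle_measure) \<partial>config_measure n)"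
    using measurable_compose[OF measurable_partial_products f]
    by (subst nn_integral_config_Suc) (auto simp: upd)
  also have "\<dots> = (\<integral>\<^sup>+U. (\<integral>\<^sup>+z. f ((partial_products n U)(n := z)) \<partial>circle_measure) \<partial>config_measure n)"
  proof (rule nn_integral_cong)
    fix U assume U: "U \<in> space (config_measure n)"
    then have "partial_products n U \<in> space (config_measure n)"
      by (simp add: space_config_measure partial_products_in_configs)
    then have "(\<lambda>z. (partial_products n U, z)) \<in> circle_measure \<rightarrow>\<^sub>M config_measure n \<Otimes>\<^sub>M circle_measure"
      by measurable
    from measurable_compose[OF this meas]
    have "(\<lambda>z. f ((partial_products n U)(n := z))) \<in> borel_measurable circle_measure"
      by (simp only: fst_conv snd_conv)
    from nn_integral_circle_rotate[OF this p[OF U]]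
    show "(\<integral>\<^sup>+z. f ((partial_products n U)(n := p U * z)) \<partial>circle_measure)
        = (\<integral>\<^sup>+z. f ((partial_products n U)(n := z)) \<partial>circle_measure)" .
  qed
  also have "\<dots> = (\<integral>\<^sup>+S. (\<integral>\<^sup>+z. f (S(n := z)) \<partial>circle_measure) \<partial>config_measure n)"
  proof (rule Suc.IH[of "\<lambda>S. \<integral>\<^sup>+z. f (S(n := z)) \<partial>circle_measure"])
    have "(\<lambda>(S,z). f (S(n := z))) \<in> borel_measurable (config_measure n \<Otimes>\<^sub>M circle_measure)"
      using meas by (simp add: split_def)
    then show "(\<lambda>S. \<integral>\<^sup>+z. f (S(n := z)) \<partial>circle_measure) \<in> borel_measurable (config_measure n)"
      by (rule circle.borel_measurable_nn_integral)
  qed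
  also have "\<dots> = (\<integral>\<^sup>+S. f S \<partial>config_measure (Suc n))" by (rule nn_integral_config_Suc[OF f, symmetric])
  finally show ?case .
qed

lemma distr_partial_products: "distr (config_measure L) (config_measure L) (partial_products L) = config_measure L"
proof (rule measure_eqI)
  fix A assume "A \<in> sets (distr (config_measure L) (config_measure L) (partial_products L))"
  then have A[measurable]: "A \<in> sets (config_measure L)" by simp
  then show "emeasure (distr (config_measure L) (config_measure L) (partial_products L)) A = emeasure (config_measure L) A"
    using nn_integral_partial_products[of "indicator A" L]
      nn_integral_distr[OF measurable_partial_products, of "indicator A" L]
    by simp
qed simp

section \<open>Invariance of the uniform measure under global rotations\<close>

lemma measurable_rotate_config:
  assumes "c \<in> sphere 0 1"
  shows "(\<lambda>S. \<lambda>i\<in>{..<L}. c * S i) \<in> config_measure L \<rightarrow>\<^sub>M config_measure L"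
  unfolding config_measure_def
  by (intro measurable_restrict measurable_compose[OF _ measurable_mult_circle[OF assms]]
      measurable_component_singleton) auto

lemma distr_rotate_config:
  assumes c: "c \<in> sphere 0 1"
  shows "distr (config_measure L) (config_measure L) (\<lambda>S. \<lambda>i\<in>{..<L}. c * S i) = config_measure L"
  unfolding config_measure_def[of L]
proof (rule circles.PiM_eqI)
  fix A :: "nat \<Rightarrow> complex set" assume A: "\<And>i. i \<in> {..<L} \<Longrightarrow> A i \<in> sets circle_measure"
  define B where "B i = (\<lambda>z. c * z) -` A i \<inter> space circle_measure" for i
  have B: "B i \<in> sets circle_measure" if "i \<in> {..<L}" for i
    unfolding B_def using A[OF that] measurable_mult_circle[OF c] by (rule measurable_sets[rotated])
  have pre: "(\<lambda>S. \<lambda>i\<in>{..<L}. c * S i) -` PiE {..<L} A \<inter> space (PiM {..<L} (\<lambda>_. circle_measure)) = PiE {..<L} B"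
    by (auto simp: space_PiM B_def PiE_def Pi_def extensional_def)
  have eB: "emeasure circle_measure (B i) = emeasure circle_measure (A i)" if "i \<in> {..<L}" for i
  proof -
    have [measurable]: "A i \<in> sets circle_measure" using A that by auto
    have "emeasure circle_measure (B i) = (\<integral>\<^sup>+z. indicator (B i) z \<partial>circle_measure)"
      using B[OF that] by simp
    also have "\<dots> = (\<integral>\<^sup>+z. indicator (A i) (c * z) \<partial>circle_measure)"
      by (intro nn_integral_cong) (auto simp: B_def split: split_indicator)
    also have "\<dots> = (\<integral>\<^sup>+z. indicator (A i) z \<partial>circle_measure)"
      by (rule nn_integral_circle_rotate[OF _ c]) auto
    finally show ?thesis using A[OF that] by simp
  qed
  show "emeasure (distr (PiM {..<L} (\<lambda>_. circle_measure)) (PiM {..<L} (\<lambda>_. circle_measure)) (\<lambda>S. \<lambda>i\<in>{..<L}. c * S i)) (PiE {..<L} A)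
     = (\<Prod>i\<in>{..<L}. emeasure circle_measure (A i))"
    using A measurable_rotate_config[OF c, of L] circles.emeasure_PiM[of "{..<L}" B] B
    by (subst emeasure_distr) (auto simp: pre config_measure_def eB intro!: sets_PiM_I_finite)
qed simp_all

section \<open>Von Mises distributions\<close>

lemma integral_circle_continuous:
  fixes f :: "complex \<Rightarrow> real"
  assumes f[measurable]: "f \<in> borel_measurable circle_measure"
    and cont: "continuous_on {0..2 * pi} (\<lambda>t. f (cis t))"
  shows "(\<integral>z. f z \<partial>circle_measure) = integral {0..2 * pi} (\<lambda>t. f (cis t))"
proof -
  have m: "cis \<in> restrict_space lborel {0..<2 * pi} \<rightarrow>\<^sub>M restrict_space borel (sphere 0 1)"
    using measurable_cis_circle
    by (auto simp: measurable_cong_sets[OF refl sets_circle_measure] intro!: measurable_restrict_space1)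
  have f': "f \<in> borel_measurable (restrict_space borel (sphere 0 1))"
    using f by (simp add: measurable_cong_sets[OF sets_circle_measure refl])
  have "(\<integral>z. f z \<partial>circle_measure) = set_lebesgue_integral lborel {0..<2 * pi} (\<lambda>t. f (cis t))"
    unfolding circle_measure_def
    by (subst integral_distr[OF m f'])
       (simp add: integral_restrict_space set_lebesgue_integral_def)
  also have "\<dots> = set_lebesgue_integral lborel {0..2 * pi} (\<lambda>t. f (cis t))"
    unfolding set_lebesgue_integral_def
  proof (rule integral_cong_AE)
    show "AE t in lborel. indicator {0..<2 * pi} t *\<^sub>R f (cis t) = indicator {0..2 * pi} t *\<^sub>R f (cis t)"
      using AE_lborel_singleton[of "2 * pi"] by eventually_elim (auto split: split_indicator)
  qed measurable
  also have "\<dots> = integral {0..2 * pi} (\<lambda>t. f (cis t))"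
    by (rule set_borel_integral_eq_integral(2)[OF borel_integrable_atLeastAtMost'[OF cont]])
  finally show ?thesis .
qed

text \<open>Equal to \<open>2 * pi\<close> times the modified Bessel function of order 0 at
  \<open>b\<close>.\<close>

definition von_mises_norm :: "real \<Rightarrow> real" where
  "von_mises_norm b = (\<integral>u. exp (b * Re u) \<partial>circle_measure)"

definition von_mises :: "real \<Rightarrow> complex measure" where
  "von_mises b = density circle_measure (\<lambda>u. ennreal (exp (b * Re u) / von_mises_norm b))"

lemma exp_Re_measurable [measurable]: "(\<lambda>u. exp (b * Re u)) \<in> borel_measurable circle_measure"
  by (rule borel_measurable_circle) measurable

lemma integrable_exp_Re: "integrable circle_measure (\<lambda>u. exp (b * Re u))"
proof (rule circle.integrable_bounded)
  fix u assume "u \<in> space circle_measure"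
  then have "\<bar>Re u\<bar> \<le> 1" using abs_Re_le_cmod[of u] by (simp add: space_circle_measure)
  then have "\<bar>b * Re u\<bar> \<le> \<bar>b\<bar> * 1" unfolding abs_mult by (intro mult_left_mono) auto
  then show "\<bar>exp (b * Re u)\<bar> \<le> exp \<bar>b\<bar>" by simp
qed simp

lemma von_mises_norm_pos: "von_mises_norm b > 0"
proof -
  have "(\<integral>u. exp (- \<bar>b\<bar>) \<partial>circle_measure) \<le> von_mises_norm b" unfolding von_mises_norm_def
  proof (rule integral_mono[OF _ integrable_exp_Re])
    fix u assume "u \<in> space circle_measure"
    then have "\<bar>Re u\<bar> \<le> 1" using abs_Re_le_cmod[of u] by (simp add: space_circle_measure)
    then have "\<bar>b * Re u\<bar> \<le> \<bar>b\<bar> * 1" unfolding abs_mult by (intro mult_left_mono) auto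
    then show "exp (- \<bar>b\<bar>) \<le> exp (b * Re u)" by simp
  qed simp
  moreover have "0 < (\<integral>u. exp (- \<bar>b\<bar>) \<partial>circle_measure)"
    by (simp add: measure_def emeasure_circle_measure)
  ultimately show ?thesis by linarith
qed

lemma space_von_mises: "space (von_mises b) = sphere 0 1"
  by (simp add: von_mises_def space_circle_measure)

lemma sets_von_mises [measurable_cong]: "sets (von_mises b) = sets circle_measure"
  by (simp add: von_mises_def)

lemma prob_space_von_mises: "prob_space (von_mises b)"
proof
  have "emeasure (von_mises b) (space (von_mises b))
      = (\<integral>\<^sup>+u. ennreal (exp (b * Re u) / von_mises_norm b) \<partial>circle_measure)"
    unfolding von_mises_def
    by (subst emeasure_density) (auto intro!: nn_integral_cong)
  also have "\<dots> = ennreal (\<integral>u. exp (b * Re u) / von_mises_norm b \<partial>circle_measure)"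
    using von_mises_norm_pos[of b] integrable_exp_Re
    by (intro nn_integral_eq_integral) (auto simp: less_imp_le)
  also have "\<dots> = 1" using von_mises_norm_pos[of b] by (simp add: von_mises_norm_def[symmetric])
  finally show "emeasure (von_mises b) (space (von_mises b)) = 1" .
qed

lemma integral_von_mises:
  fixes f :: "complex \<Rightarrow> real"
  assumes "f \<in> borel_measurable circle_measure"
  shows "(\<integral>u. f u \<partial>von_mises b) = (\<integral>u. exp (b * Re u) * f u \<partial>circle_measure) / von_mises_norm b"
  unfolding von_mises_def using assms von_mises_norm_pos[of b]
  by (subst integral_density) (auto simp: less_imp_le)

text \<open>The form of monotonicity required by \<open>weighted_poincare_interval\<close>, for the
  two arcs from the mode to the antipode; the second arc is the mirror image of the first.\<close>

lemma exp_cos_antimono: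
  fixes b :: real
  assumes b: "0 \<le> b"
  shows "x \<in> {0..pi} \<Longrightarrow> y \<in> closed_segment 0 x \<Longrightarrow> exp (b * cos x) \<le> exp (b * cos y)"
    and "x \<in> {pi..2 * pi} \<Longrightarrow> y \<in> closed_segment (2 * pi) x \<Longrightarrow> exp (b * cos x) \<le> exp (b * cos y)"
proof -
  show "exp (b * cos x) \<le> exp (b * cos y)" if "x \<in> {0..pi}" "y \<in> closed_segment 0 x"
    using that b by (auto simp: closed_segment_eq_real_ivl intro!: mult_left_mono cos_monotone_0_pi_le)
  show "exp (b * cos x) \<le> exp (b * cos y)" if "x \<in> {pi..2 * pi}" "y \<in> closed_segment (2 * pi) x"
  proof -
    have "cos (2 * pi - x) \<le> cos (2 * pi - y)"
      using that by (intro cos_monotone_0_pi_le) (auto simp: closed_segment_eq_real_ivl split: if_splits)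
    then show ?thesis using b by (auto intro!: mult_left_mono)
  qed
qed

text \<open>No factor depending on \<open>b\<close> is lost: the weight decreases along both arcs from the mode \<open>1\<close> to
  the antipode.\<close>

lemma von_mises_poincare:
  fixes f f' :: "complex \<Rightarrow> real"
  assumes b: "0 \<le> b"
    and f[measurable]: "f \<in> borel_measurable circle_measure" and f'[measurable]: "f' \<in> borel_measurable circle_measure"
    and deriv: "\<And>t. ((\<lambda>t. f (cis t)) has_real_derivative f' (cis t)) (at t)"
    and cont: "continuous_on UNIV (\<lambda>t. f' (cis t))"
  shows "(\<integral>u. (f u - (\<integral>v. f v \<partial>von_mises b))\<^sup>2 \<partial>von_mises b) \<le> pi\<^sup>2 * (\<integral>u. (f' u)\<^sup>2 \<partial>von_mises b)"
proof -
  interpret vm: prob_space "von_mises b" by (rule prob_space_von_mises)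
  let ?w = "\<lambda>t. exp (b * cos t)"
  have cf: "continuous_on UNIV (\<lambda>t. f (cis t))" by (auto intro!: continuous_at_imp_continuous_on DERIV_isCont deriv)
  have cont': "continuous_on A (\<lambda>t. f (cis t))" "continuous_on A (\<lambda>t. f' (cis t))" for A
    using cf cont by (auto intro: continuous_on_subset)
  have bd: "\<exists>B. \<forall>u\<in>sphere 0 1. \<bar>h u\<bar> \<le> B" if "continuous_on UNIV (\<lambda>t. h (cis t))" for h :: "complex \<Rightarrow> real"
  proof -
    have "compact ((\<lambda>t. h (cis t)) ` {0..2 * pi})"
      using that by (intro compact_continuous_image) (auto intro: continuous_on_subset)
    from compact_imp_bounded[OF this]
    obtain B where B: "\<forall>x\<in>(\<lambda>t. h (cis t)) ` {0..2 * pi}. \<bar>x\<bar> \<le> B"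
      unfolding bounded_real by blast
    have "\<bar>h u\<bar> \<le> B" if u: "u \<in> sphere 0 1" for u
    proof -
      obtain t where "0 \<le> t" "t < 2 * pi" "u = cis t" using u by (rule sphere_cis_cases)
      then show ?thesis using B by auto
    qed
    then show ?thesis by blast
  qed
  obtain B where B: "\<And>u. u \<in> sphere 0 1 \<Longrightarrow> \<bar>f u\<bar> \<le> B" using bd[OF cf] by blast
  have i1: "integrable (von_mises b) f"
    by (rule vm.integrable_bounded[of _ B]) (auto simp: space_von_mises B)
  have i2: "integrable (von_mises b) (\<lambda>u. (f u)\<^sup>2)"
  proof (rule vm.integrable_bounded[of _ "B\<^sup>2"])
    fix u assume "u \<in> space (von_mises b)"
    then have "\<bar>f u\<bar> \<le> B" by (simp add: space_von_mises B)
    then show "\<bar>(f u)\<^sup>2\<bar> \<le> B\<^sup>2" using power_mono[of "\<bar>f u\<bar>" B 2] by simp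
  qed simp
  have conv: "(\<integral>u. h u \<partial>von_mises b)
      = (integral {0..pi} (\<lambda>t. ?w t * h (cis t)) + integral {pi..2 * pi} (\<lambda>t. ?w t * h (cis t))) / von_mises_norm b"
    if [measurable]: "h \<in> borel_measurable circle_measure" and ch: "continuous_on UNIV (\<lambda>t. h (cis t))" for h
  proof -
    have c: "continuous_on {0..2 * pi} (\<lambda>t. ?w t * h (cis t))"
      using ch by (intro continuous_intros) (auto intro: continuous_on_subset)
    have "(\<integral>u. exp (b * Re u) * h u \<partial>circle_measure) = integral {0..2 * pi} (\<lambda>t. ?w t * h (cis t))"
      using c by (subst integral_circle_continuous) simp_all
    also have "\<dots> = integral {0..pi} (\<lambda>t. ?w t * h (cis t)) + integral {pi..2 * pi} (\<lambda>t. ?w t * h (cis t))"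
      by (rule Henstock_Kurzweil_Integration.integral_combine[symmetric]) (auto intro!: integrable_continuous_real c)
    finally show ?thesis by (simp add: integral_von_mises)
  qed
  \<comment> \<open>The centre is the value at the mode, which is both \<open>cis 0\<close> and
    \<open>cis (2 * pi)\<close>: the two arcs then separate, each starting from its own
    endpoint.\<close>
  have "vm.variance f \<le> (\<integral>u. (f u - f 1)\<^sup>2 \<partial>von_mises b)"
    by (subst vm.expectation_square_diff[OF i1 i2]) simp
  also have "\<dots> = (integral {0..pi} (\<lambda>t. ?w t * (f (cis t) - f 1)\<^sup>2)
      + integral {pi..2 * pi} (\<lambda>t. ?w t * (f (cis t) - f 1)\<^sup>2)) / von_mises_norm b"
  proof (rule conv)
    show "continuous_on UNIV (\<lambda>t. (f (cis t) - f 1)\<^sup>2)" by (intro continuous_intros cf)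
  qed measurable
  also have "\<dots> \<le> (pi\<^sup>2 * integral {0..pi} (\<lambda>t. ?w t * (f' (cis t))\<^sup>2)
      + pi\<^sup>2 * integral {pi..2 * pi} (\<lambda>t. ?w t * (f' (cis t))\<^sup>2)) / von_mises_norm b"
  proof (intro divide_right_mono add_mono)
    show "integral {0..pi} (\<lambda>t. ?w t * (f (cis t) - f 1)\<^sup>2) \<le> pi\<^sup>2 * integral {0..pi} (\<lambda>t. ?w t * (f' (cis t))\<^sup>2)"
    proof -
      have "integral {0..pi} (\<lambda>t. ?w t * (f (cis t) - f (cis (0)))\<^sup>2)
          \<le> (pi - 0)\<^sup>2 * integral {0..pi} (\<lambda>t. ?w t * (f' (cis t))\<^sup>2)"
      proof (rule weighted_poincare_interval)
        show "?w x \<le> ?w y" if "x \<in> {0..pi}" "y \<in> closed_segment (0) x" for x y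
          by (rule exp_cos_antimono(1)[OF b that])
        show "((\<lambda>t. f (cis t)) has_real_derivative f' (cis x)) (at x within {0..pi})" for x
          by (rule has_field_derivative_at_within[OF deriv])
      qed (auto intro!: continuous_intros cont')
      then show ?thesis by simp
    qed
    show "integral {pi..2 * pi} (\<lambda>t. ?w t * (f (cis t) - f 1)\<^sup>2) \<le> pi\<^sup>2 * integral {pi..2 * pi} (\<lambda>t. ?w t * (f' (cis t))\<^sup>2)"
    proof -
      have "integral {pi..2 * pi} (\<lambda>t. ?w t * (f (cis t) - f (cis (2 * pi)))\<^sup>2)
          \<le> (2 * pi - pi)\<^sup>2 * integral {pi..2 * pi} (\<lambda>t. ?w t * (f' (cis t))\<^sup>2)"
      proof (rule weighted_poincare_interval)
        show "?w x \<le> ?w y" if "x \<in> {pi..2 * pi}" "y \<in> closed_segment (2 * pi) x" for x y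
          by (rule exp_cos_antimono(2)[OF b that])
        show "((\<lambda>t. f (cis t)) has_real_derivative f' (cis x)) (at x within {pi..2 * pi})" for x
          by (rule has_field_derivative_at_within[OF deriv])
      qed (auto intro!: continuous_intros cont')
      then show ?thesis by simp
    qed
  qed (use von_mises_norm_pos[of b] in simp)
  also have "\<dots> = pi\<^sup>2 * (\<integral>u. (f' u)\<^sup>2 \<partial>von_mises b)"
    using conv[of "\<lambda>u. (f' u)\<^sup>2"] cont by (simp add: continuous_on_power distrib_left)
  finally show ?thesis .
qed

lemma product_prob_space_von_mises: "product_prob_space (\<lambda>i. von_mises (b i))"
  by (intro product_prob_spaceI prob_space_von_mises)

lemma PiM_von_mises:
  "PiM {..<L} (\<lambda>i. von_mises (b i)) =
     density (config_measure L) (\<lambda>U. ennreal (\<Prod>i<L. exp (b i * Re (U i)) / von_mises_norm (b i)))"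
    (is "_ = ?R")
proof -
  interpret vm: product_prob_space "\<lambda>i. von_mises (b i)" by (rule product_prob_space_von_mises)
  have "?R = PiM {..<L} (\<lambda>i. von_mises (b i))"
  proof (rule vm.PiM_eqI)
    show "sets ?R = sets (PiM {..<L} (\<lambda>i. von_mises (b i)))"
      by (auto simp: sets_config_measure sets_von_mises intro!: sets_PiM_cong)
    fix A assume "\<And>i. i \<in> {..<L} \<Longrightarrow> A i \<in> sets (von_mises (b i))"
    then have A[measurable]: "A i \<in> sets circle_measure" if "i < L" for i using that by (simp add: sets_von_mises)
    have d[measurable]: "(\<lambda>U. ennreal (\<Prod>i<L. exp (b i * Re (U i)) / von_mises_norm (b i))) \<in> borel_measurable (config_measure L)"
      using measurable_compose[OF measurable_config_component exp_Re_measurable, of _ L]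
      by (intro measurable_compose[OF _ measurable_ennreal] borel_measurable_prod) auto
    have Am: "PiE {..<L} A \<in> sets (config_measure L)"
      unfolding config_measure_def using A by (intro sets_PiM_I_finite) auto
    have "emeasure ?R (PiE {..<L} A) = (\<integral>\<^sup>+U. ennreal (\<Prod>i<L. exp (b i * Re (U i)) / von_mises_norm (b i)) * indicator (PiE {..<L} A) U \<partial>config_measure L)"
      using Am by (subst emeasure_density) auto
    also have "\<dots> = (\<integral>\<^sup>+U. (\<Prod>i<L. ennreal (exp (b i * Re (U i)) / von_mises_norm (b i)) * indicator (A i) (U i)) \<partial>config_measure L)"
    proof (rule nn_integral_cong)
      fix U assume "U \<in> space (config_measure L)"
      then have "indicator (PiE {..<L} A) U = (\<Prod>i<L. indicator (A i) (U i) :: ennreal)"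
        by (auto simp: space_config_measure configs_def PiE_def Pi_def split: split_indicator)
      then show "ennreal (\<Prod>i<L. exp (b i * Re (U i)) / von_mises_norm (b i)) * indicator (PiE {..<L} A) U
          = (\<Prod>i<L. ennreal (exp (b i * Re (U i)) / von_mises_norm (b i)) * indicator (A i) (U i))"
        using von_mises_norm_pos by (subst prod_ennreal[symmetric]) (auto simp: prod.distrib less_imp_le)
    qed
    also have "\<dots> = (\<Prod>i<L. \<integral>\<^sup>+u. ennreal (exp (b i * Re u) / von_mises_norm (b i)) * indicator (A i) u \<partial>circle_measure)"
      unfolding config_measure_def using A by (intro circles.product_nn_integral_prod) auto
    also have "\<dots> = (\<Prod>i<L. emeasure (von_mises (b i)) (A i))"
      unfolding von_mises_def using A by (intro prod.cong refl emeasure_density[symmetric]) auto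
    finally show "emeasure ?R (PiE {..<L} A) = (\<Prod>i<L. emeasure (von_mises (b i)) (A i))" .
  qed simp
  then show ?thesis by simp
qed

section \<open>Smooth functions on the torus\<close>

text \<open>A right inverse of the angular chart. It jumps at angle 0 but is Borel and takes values
  in a bounded box, which turns continuity on angle space into measurability and boundedness on
  configurations.\<close>

definition args :: "nat \<Rightarrow> (nat \<Rightarrow> complex) \<Rightarrow> nat \<Rightarrow> real" where
  "args L S = (\<lambda>i\<in>{..<L}. Arg2pi (S i))"

definition spin_deriv :: "nat \<Rightarrow> ((nat \<Rightarrow> complex) \<Rightarrow> real) \<Rightarrow> (nat \<Rightarrow> complex) \<Rightarrow> real" where
  "spin_deriv i f S = deriv (\<lambda>t. f (S(i := cis t * S i))) 0"

lemma args_in_PiE: "args L S \<in> {..<L} \<rightarrow>\<^sub>E UNIV"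
  by (auto simp: args_def)

lemma angle_config_in_configs: "angle_config L \<theta> \<in> configs L"
  by (auto simp: angle_config_def configs_def)

lemma angle_config_args:
  assumes "S \<in> configs L"
  shows "angle_config L (args L S) = S"
proof (rule ext)
  fix i
  have "i < L \<Longrightarrow> cmod (S i) = 1" using assms by (auto simp: configs_def PiE_def Pi_def)
  then have "i < L \<Longrightarrow> cis (Arg2pi (S i)) = S i"
    using Arg2pi_eq[of "S i"] by (simp add: cis_conv_exp)
  moreover have "\<not> i < L \<Longrightarrow> S i = undefined" using assms by (auto simp: configs_def PiE_def extensional_def)
  ultimately show "angle_config L (args L S) i = S i" by (simp add: angle_config_def args_def)
qed

lemma angle_config_restrict: "angle_config L (restrict \<theta> {..<L}) = angle_config L \<theta>"
  by (auto simp: angle_config_def)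

lemma norm_spin_gradient:
  assumes "S \<in> configs L" "i < L"
  shows "(norm (spin_gradient i f S))\<^sup>2 = (spin_deriv i f S)\<^sup>2"
proof -
  have "cmod (S i) = 1" using assms by (auto simp: configs_def PiE_def Pi_def)
  then show ?thesis by (simp add: spin_gradient_def spin_deriv_def norm_mult)
qed

lemma spin_deriv_angle_config:
  assumes "i < L"
  shows "spin_deriv i f (angle_config L \<theta>) = partial_deriv i (\<lambda>\<theta>. f (angle_config L \<theta>)) \<theta>"
proof -
  have eq: "(angle_config L \<theta>)(i := cis t * angle_config L \<theta> i) = angle_config L (\<theta>(i := t + \<theta> i))" for t
    using assms by (auto simp: angle_config_def cis_mult)
  have "spin_deriv i f (angle_config L \<theta>) = deriv (\<lambda>t. f (angle_config L (\<theta>(i := t + \<theta> i)))) 0"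
    unfolding spin_deriv_def eq ..
  also have "\<dots> = deriv (\<lambda>t. f (angle_config L (\<theta>(i := t)))) (\<theta> i)"
    using deriv_shift_0[of "\<lambda>t. f (angle_config L (\<theta>(i := t)))" "\<theta> i"]
    by (simp add: comp_def add.commute)
  finally show ?thesis by (simp add: partial_deriv_def)
qed

text \<open>\<open>Arg2pi\<close> vanishes on the nonnegative real axis and is continuous off
  it.\<close>

lemma Arg2pi_measurable [measurable]: "Arg2pi \<in> borel_measurable borel"
proof (rule measurable_piecewise_restrict[where C = "{\<real>\<^sub>\<ge>\<^sub>0, - \<real>\<^sub>\<ge>\<^sub>0}"])
  fix \<Omega> :: "complex set" assume "\<Omega> \<in> {\<real>\<^sub>\<ge>\<^sub>0, - \<real>\<^sub>\<ge>\<^sub>0}"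
  then consider "\<Omega> = \<real>\<^sub>\<ge>\<^sub>0" | "\<Omega> = - \<real>\<^sub>\<ge>\<^sub>0" by blast
  then show "Arg2pi \<in> borel_measurable (restrict_space borel \<Omega>)"
  proof cases
    case 1
    then have "Arg2pi z = 0" if "z \<in> space (restrict_space borel \<Omega>)" for z
      using that Arg2pi_eq_0[of z]
      by (auto simp: space_restrict_space complex_nonneg_Reals_iff complex_is_Real_iff)
    then show ?thesis by (simp cong: measurable_cong)
  next
    case 2
    then show ?thesis
      by (auto intro!: borel_measurable_continuous_on_restrict continuous_at_imp_continuous_on continuous_at_Arg2pi)
  qed
qed auto

lemma measurable_args: "args L \<in> borel_measurable (config_measure L)"
proof (rule measurable_coordinatewise_then_product)
  fix i
  show "(\<lambda>S. args L S i) \<in> borel_measurable (config_measure L)"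
    using measurable_compose[OF measurable_compose[OF measurable_config_component measurable_circle_id] Arg2pi_measurable, of i L]
    by (cases "i < L") (auto simp: args_def)
qed

lemma measurable_comp_args:
  fixes F :: "(nat \<Rightarrow> real) \<Rightarrow> real"
  assumes "continuous_on ({..<L} \<rightarrow>\<^sub>E UNIV) F"
  shows "(\<lambda>S. F (args L S)) \<in> borel_measurable (config_measure L)"
proof -
  have "args L \<in> config_measure L \<rightarrow>\<^sub>M restrict_space borel ({..<L} \<rightarrow>\<^sub>E UNIV)"
    using measurable_args args_in_PiE by (intro measurable_restrict_space2) auto
  from measurable_compose[OF this borel_measurable_continuous_on_restrict[OF assms]]
  show ?thesis .
qed

lemma bounded_comp_args:
  fixes F :: "(nat \<Rightarrow> real) \<Rightarrow> real"
  assumes "continuous_on ({..<L} \<rightarrow>\<^sub>E UNIV) F"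
  obtains B where "\<And>S. \<bar>F (args L S)\<bar> \<le> B"
proof -
  \<comment> \<open>Coordinates from \<open>L\<close> on are pinned at \<open>undefined\<close>, so
    that Tychonoff's theorem yields a compact set inside the extensional functions.\<close>
  let ?K = "PiE UNIV (\<lambda>i. if i < L then {0..2 * pi} else {undefined :: real})"
  have "compactin (product_topology (\<lambda>_. euclidean) UNIV) ?K"
    by (subst compactin_PiE) auto
  then have "compact ?K" by (simp add: euclidean_product_topology)
  moreover have "?K \<subseteq> {..<L} \<rightarrow>\<^sub>E UNIV"
    by (auto simp: PiE_def Pi_def extensional_def split: if_splits)
  ultimately have "compact (F ` ?K)"
    using assms by (intro compact_continuous_image) (auto intro: continuous_on_subset)
  from compact_imp_bounded[OF this]
  obtain B where B: "\<forall>x\<in>F ` ?K. \<bar>x\<bar> \<le> B" unfolding bounded_real by blast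
  have "args L S \<in> ?K" for S
    using Arg2pi_ge_0 Arg2pi_lt_2pi by (auto simp: args_def less_imp_le)
  then have "\<bar>F (args L S)\<bar> \<le> B" for S using B by (meson imageI)
  then show thesis by (rule that)
qed

text \<open>Continuous partial derivatives give the chain rule along a diagonal direction: the
  coordinates of \<open>J\<close> are moved one after another, each by the mean value theorem.
  Turning one increment of the chain moves many angles at once, whereas smoothness is defined
  through partial derivatives alone.\<close>

lemma has_derivative_shift_coordinates:
  fixes F :: "(nat \<Rightarrow> real) \<Rightarrow> real"
  assumes cont: "\<And>i. i < L \<Longrightarrow> continuous_on ({..<L} \<rightarrow>\<^sub>E UNIV) (partial_deriv i F)"
    and diff: "\<And>i \<theta>. i < L \<Longrightarrow> \<theta> \<in> {..<L} \<rightarrow>\<^sub>E UNIV \<Longrightarrow> (\<lambda>t. F (\<theta>(i := t))) differentiable at (\<theta> i)"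
    and J: "J \<subseteq> {..<L}" and \<theta>: "\<theta> \<in> {..<L} \<rightarrow>\<^sub>E UNIV"
  shows "((\<lambda>t. F (\<lambda>j. if j \<in> J then \<theta> j + t else \<theta> j)) has_real_derivative (\<Sum>j\<in>J. partial_deriv j F \<theta>)) (at 0)"
proof -
  have "finite J" using J finite_subset by blast
  then show ?thesis using J
  proof (induction J rule: finite_induct)
    case empty
    then show ?case by simp
  next
    case (insert k J)
    have k: "k < L" using insert by auto
    let ?s = "\<lambda>s j. if j \<in> J then \<theta> j + s else \<theta> j"
    let ?e = "\<lambda>z::real \<times> real. (?s (fst z))(k := \<theta> k + snd z)"
    have sJ: "?s s \<in> {..<L} \<rightarrow>\<^sub>E UNIV" for s
      using \<theta> insert.prems by (auto simp: PiE_def extensional_def)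
    have eJ: "?e z \<in> {..<L} \<rightarrow>\<^sub>E UNIV" for z using sJ[of "fst z"] k by (auto simp: PiE_def extensional_def)
    have cD: "continuous_on UNIV (\<lambda>z. partial_deriv k F (?e z))"
    proof (rule continuous_on_compose2[OF cont[OF k]])
      show "continuous_on UNIV ?e"
      proof (rule continuous_on_coordinatewise_then_product)
        fix i show "continuous_on UNIV (\<lambda>z. ?e z i)"
          by (cases "i = k"; cases "i \<in> J") (auto intro!: continuous_intros)
      qed
    qed (use eJ in blast)
    have dF: "((\<lambda>t. F ((?s s)(k := \<theta> k + t))) has_real_derivative partial_deriv k F (?e (s, t))) (at t)" for s t
    proof -
      have "(\<lambda>u. F ((?e (s, t))(k := u))) differentiable at (?e (s, t) k)" by (rule diff[OF k eJ])
      then have "((\<lambda>u. F ((?s s)(k := u))) has_real_derivative partial_deriv k F (?e (s, t))) (at (\<theta> k + t))"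
        by (simp only: DERIV_deriv_iff_real_differentiable[symmetric] partial_deriv_def fun_upd_upd fun_upd_same snd_conv fst_conv)
      then show ?thesis
        unfolding add.commute[of "\<theta> k"] fst_conv snd_conv by (rule DERIV_shift[THEN iffD1])
    qed
    \<comment> \<open>Coordinate \<open>k\<close> moves after those of \<open>J\<close>. The
      intermediate point is no further out than \<open>t\<close>, so the argument of the partial
      derivative tends to \<open>\<theta>\<close> and continuity identifies the limit.\<close>
    have "\<exists>\<xi>. \<bar>\<xi>\<bar> \<le> \<bar>t\<bar> \<and> F (?e (t, t)) - F (?s t) = t * partial_deriv k F (?e (t, \<xi>))" for t
    proof -
      have e0: "(?s t)(k := \<theta> k + 0) = ?s t" using insert.hyps by auto
      consider "t = 0" | "t > 0" | "t < 0" by linarith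
      then show ?thesis
      proof cases
        case 2
        have "\<exists>z. 0 < z \<and> z < t \<and> F ((?s t)(k := \<theta> k + t)) - F ((?s t)(k := \<theta> k + 0)) = (t - 0) * partial_deriv k F (?e (t, z))"
          by (rule MVT2[OF 2 dF])
        then obtain z where "0 < z" "z < t" "F ((?s t)(k := \<theta> k + t)) - F ((?s t)(k := \<theta> k + 0)) = (t - 0) * partial_deriv k F (?e (t, z))"
          by blast
        then show ?thesis unfolding e0 fst_conv snd_conv by (intro exI[of _ z]) (simp add: algebra_simps)
      next
        case 3
        have "\<exists>z. t < z \<and> z < 0 \<and> F ((?s t)(k := \<theta> k + 0)) - F ((?s t)(k := \<theta> k + t)) = (0 - t) * partial_deriv k F (?e (t, z))"
          by (rule MVT2[OF 3 dF])
        then obtain z where "t < z" "z < 0" "F ((?s t)(k := \<theta> k + 0)) - F ((?s t)(k := \<theta> k + t)) = (0 - t) * partial_deriv k F (?e (t, z))"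
          by blast
        then show ?thesis unfolding e0 fst_conv snd_conv by (intro exI[of _ z]) (simp add: algebra_simps)
      next
        case 1
        then show ?thesis using e0 by (simp only: fst_conv snd_conv) simp
      qed
    qed
    then obtain \<xi> where \<xi>: "\<And>t. \<bar>\<xi> t\<bar> \<le> \<bar>t\<bar>"
      "\<And>t. F (?e (t, t)) - F (?s t) = t * partial_deriv k F (?e (t, \<xi> t))" by metis
    have e00: "?e (0, 0) = \<theta>" by auto
    have "((\<lambda>t. partial_deriv k F (?e (t, \<xi> t))) \<longlongrightarrow> partial_deriv k F (?e (0, 0))) (at 0)"
    proof (rule isCont_tendsto_compose[where g = "\<lambda>z. partial_deriv k F (?e z)"])
      show "isCont (\<lambda>z. partial_deriv k F (?e z)) (0, 0)"
        using cD by (simp add: continuous_on_eq_continuous_at)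
      have "(\<xi> \<longlongrightarrow> 0) (at 0)"
        by (rule Lim_null_comparison[where g = "\<lambda>t. \<bar>t\<bar>"]) (auto simp: \<xi>(1) intro!: tendsto_eq_intros)
      then show "((\<lambda>t. (t, \<xi> t)) \<longlongrightarrow> (0, 0)) (at 0)" by (intro tendsto_Pair tendsto_ident_at)
    qed
    then have lim: "((\<lambda>t. partial_deriv k F (?e (t, \<xi> t))) \<longlongrightarrow> partial_deriv k F \<theta>) (at 0)"
      unfolding e00 .
    have s0: "?s 0 = \<theta>" by auto
    have "((\<lambda>t. F (?e (t, t)) - F (?s t)) has_real_derivative partial_deriv k F \<theta>) (at 0)"
      unfolding DERIV_def
    proof (rule Lim_transform_eventually[OF lim])
      show "\<forall>\<^sub>F t in at 0. partial_deriv k F (?e (t, \<xi> t)) = ((F (?e (0 + t, 0 + t)) - F (?s (0 + t))) - (F (?e (0, 0)) - F (?s 0))) / t"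
        unfolding e00 s0 by (intro eventually_at_filter[THEN iffD2] always_eventually) (simp only: \<xi>(2) add_0 diff_self diff_0_right nonzero_mult_div_cancel_left simp_thms, simp)
    qed
    from DERIV_add[OF this insert.IH] insert.prems
    have "((\<lambda>t. F (?e (t, t))) has_real_derivative partial_deriv k F \<theta> + (\<Sum>j\<in>J. partial_deriv j F \<theta>)) (at 0)" by simp
    moreover have "?e (t, t) = (\<lambda>j. if j \<in> insert k J then \<theta> j + t else \<theta> j)" for t by auto
    ultimately show ?case using insert.hyps by simp
  qed
qed

lemma smooth_on_configsD:
  fixes f :: "(nat \<Rightarrow> complex) \<Rightarrow> real"
  assumes "smooth_on_configs L f"
  defines "F \<equiv> \<lambda>\<theta>. f (angle_config L \<theta>)"
  shows "continuous_on ({..<L} \<rightarrow>\<^sub>E UNIV) F"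
    and "\<And>i. i < L \<Longrightarrow> continuous_on ({..<L} \<rightarrow>\<^sub>E UNIV) (partial_deriv i F)"
    and "\<And>i \<theta>. i < L \<Longrightarrow> \<theta> \<in> {..<L} \<rightarrow>\<^sub>E UNIV \<Longrightarrow> (\<lambda>t. F (\<theta>(i := t))) differentiable at (\<theta> i)"
proof -
  have *: "continuous_on ({..<L} \<rightarrow>\<^sub>E UNIV) (foldr partial_deriv ks F)"
    "\<And>i \<theta>. i < L \<Longrightarrow> \<theta> \<in> {..<L} \<rightarrow>\<^sub>E UNIV \<Longrightarrow> (\<lambda>t. foldr partial_deriv ks F (\<theta>(i := t))) differentiable at (\<theta> i)"
    if "set ks \<subseteq> {..<L}" for ks
    using assms that by (auto simp: smooth_on_configs_def C_infinity_def F_def)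
  show "continuous_on ({..<L} \<rightarrow>\<^sub>E UNIV) F" using *(1)[of "[]"] by simp
  show "continuous_on ({..<L} \<rightarrow>\<^sub>E UNIV) (partial_deriv i F)" if "i < L" for i using *(1)[of "[i]"] that by simp
  show "(\<lambda>t. F (\<theta>(i := t))) differentiable at (\<theta> i)" if "i < L" "\<theta> \<in> {..<L} \<rightarrow>\<^sub>E UNIV" for i \<theta>
    using *(2)[of "[]"] that by simp
qed

lemma spin_deriv_eq_partial_deriv_args:
  assumes "S \<in> configs L" "i < L"
  shows "spin_deriv i f S = partial_deriv i (\<lambda>\<theta>. f (angle_config L \<theta>)) (args L S)"
  using spin_deriv_angle_config[of i L f "args L S"] assms by (simp add: angle_config_args)

lemma smooth_on_configs_measurable:
  assumes f: "smooth_on_configs L f"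
  shows "f \<in> borel_measurable (config_measure L)"
    and "i < L \<Longrightarrow> spin_deriv i f \<in> borel_measurable (config_measure L)"
proof -
  have "(\<lambda>S. f (angle_config L (args L S))) \<in> borel_measurable (config_measure L)"
    by (rule measurable_comp_args[OF smooth_on_configsD(1)[OF f]])
  then show "f \<in> borel_measurable (config_measure L)"
    by (rule measurable_cong[THEN iffD1, rotated]) (simp add: space_config_measure angle_config_args)
  show "spin_deriv i f \<in> borel_measurable (config_measure L)" if "i < L"
    using measurable_comp_args[OF smooth_on_configsD(2)[OF f that]]
    by (rule measurable_cong[THEN iffD1, rotated])
       (simp add: space_config_measure spin_deriv_eq_partial_deriv_args that)
qed

lemma smooth_on_configs_bounded:
  assumes f: "smooth_on_configs L f"
  obtains B where "\<And>S. S \<in> configs L \<Longrightarrow> \<bar>f S\<bar> \<le> B"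
    "\<And>i S. i < L \<Longrightarrow> S \<in> configs L \<Longrightarrow> \<bar>spin_deriv i f S\<bar> \<le> B"
proof -
  obtain B where B: "\<And>S. \<bar>f (angle_config L (args L S))\<bar> \<le> B"
    using bounded_comp_args[OF smooth_on_configsD(1)[OF f]] by blast
  have "\<forall>i\<in>{..<L}. \<exists>D. \<forall>S. \<bar>partial_deriv i (\<lambda>\<theta>. f (angle_config L \<theta>)) (args L S)\<bar> \<le> D"
    using bounded_comp_args[OF smooth_on_configsD(2)[OF f]] by (metis lessThan_iff)
  then obtain D where D: "\<And>i S. i < L \<Longrightarrow> \<bar>partial_deriv i (\<lambda>\<theta>. f (angle_config L \<theta>)) (args L S)\<bar> \<le> D i"
    by (metis lessThan_iff)
  have D': "D i \<le> (\<Sum>i<L. \<bar>D i\<bar>)" if "i < L" for i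
    using that member_le_sum[of i "{..<L}" "\<lambda>i. \<bar>D i\<bar>"] by auto
  have s0: "0 \<le> (\<Sum>i<L. \<bar>D i\<bar>)" by (intro sum_nonneg) auto
  show thesis
  proof (rule that[of "\<bar>B\<bar> + (\<Sum>i<L. \<bar>D i\<bar>)"])
    fix S assume S: "S \<in> configs L"
    show "\<bar>f S\<bar> \<le> \<bar>B\<bar> + (\<Sum>i<L. \<bar>D i\<bar>)"
    proof -
      have "\<bar>f S\<bar> \<le> B" using B[of S] by (simp add: angle_config_args[OF S])
      with s0 show ?thesis by linarith
    qed
    fix i assume i: "i < L"
    show "\<bar>spin_deriv i f S\<bar> \<le> \<bar>B\<bar> + (\<Sum>i<L. \<bar>D i\<bar>)"
    proof -
      have "\<bar>spin_deriv i f S\<bar> \<le> D i"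
        using D[OF i, of S] by (simp add: spin_deriv_eq_partial_deriv_args[OF S i])
      with D'[OF i] show ?thesis by linarith
    qed
  qed
qed

section \<open>The open chain\<close>

interpretation config: finite_measure "config_measure L" for L by (rule finite_measure_config)

definition chain_weight :: "nat \<Rightarrow> real \<Rightarrow> (nat \<Rightarrow> complex) \<Rightarrow> real" where
  "chain_weight L \<beta> S = exp (\<beta> * (\<Sum>i\<in>{1..<L}. S (i - 1) \<bullet> S i))"

lemma config_norm: "S \<in> configs L \<Longrightarrow> i < L \<Longrightarrow> cmod (S i) = 1"
  by (auto simp: configs_def PiE_def Pi_def)

text \<open>Consecutive spins differ by the factor \<open>U i\<close>, and
  \<open>p \<bullet> (p * u) = Re u\<close> when \<open>p\<close> has modulus 1.\<close>

lemma partial_products_inner: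
  assumes U: "U \<in> configs L" and i: "0 < i" "i < L"
  shows "partial_products L U (i - 1) \<bullet> partial_products L U i = Re (U i)"
proof -
  obtain j where j: "i = Suc j" using i by (cases i) auto
  let ?p = "\<Prod>j\<le>j. U j"
  have "cmod ?p = 1" using config_norm[OF U] i j by (simp add: prod_norm[symmetric])
  then have "Re ?p * Re ?p + Im ?p * Im ?p = 1"
    by (metis cmod_power2 one_power2 power2_eq_square)
  moreover have "?p \<bullet> (?p * U (Suc j)) = (Re ?p * Re ?p + Im ?p * Im ?p) * Re (U (Suc j))"
    by (simp add: inner_complex_def algebra_simps)
  ultimately show ?thesis using i j by (simp add: partial_products_def mult.commute)
qed

lemma chain_weight_partial_products:
  assumes "U \<in> configs L"
  shows "chain_weight L \<beta> (partial_products L U) = (\<Prod>i<L. exp ((if i = 0 then 0 else \<beta>) * Re (U i)))"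
proof -
  have "(\<Sum>i<L. (if i = 0 then 0 else \<beta>) * Re (U i)) = (\<Sum>i\<in>{1..<L}. \<beta> * Re (U i))"
    by (rule sum.mono_neutral_cong_right) auto
  also have "\<dots> = \<beta> * (\<Sum>i\<in>{1..<L}. partial_products L U (i - 1) \<bullet> partial_products L U i)"
    unfolding sum_distrib_left using assms by (intro sum.cong refl) (simp add: partial_products_inner del: One_nat_def)
  finally have "chain_weight L \<beta> (partial_products L U) = exp (\<Sum>i<L. (if i = 0 then 0 else \<beta>) * Re (U i))"
    by (simp add: chain_weight_def)
  then show ?thesis by (simp only: exp_sum finite_lessThan)
qed

lemma measurable_inner_config:
  "i < L \<Longrightarrow> j < L \<Longrightarrow> (\<lambda>S. S i \<bullet> S j) \<in> borel_measurable (config_measure L)"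
  using measurable_compose[OF measurable_config_component measurable_circle_id]
  by (intro borel_measurable_inner) auto

lemma measurable_chain_weight [measurable]: "chain_weight L \<beta> \<in> borel_measurable (config_measure L)"
  unfolding chain_weight_def
  by (intro borel_measurable_exp[THEN measurable_compose[rotated]] borel_measurable_times borel_measurable_const
      borel_measurable_sum measurable_inner_config) auto

text \<open>In increment coordinates the weight of the open chain factorises over the sites.
  Increment 0 is the free global rotation, hence its parameter 0. The prefactor is the partition
  function of the open chain.\<close>

lemma integral_chain_weight:
  fixes h :: "(nat \<Rightarrow> complex) \<Rightarrow> real" and \<beta> :: real
  assumes h[measurable]: "h \<in> borel_measurable (config_measure L)"
  defines "b \<equiv> \<lambda>i::nat. if i = 0 then 0 else \<beta>"
  shows "(\<integral>S. chain_weight L \<beta> S * h S \<partial>config_measure L)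
       = (\<Prod>i<L. von_mises_norm (b i)) * (\<integral>U. h (partial_products L U) \<partial>PiM {..<L} (\<lambda>i. von_mises (b i)))"
proof -
  have [measurable]: "(\<lambda>U. \<Prod>i<L. exp (b i * Re (U i)) / von_mises_norm (b i)) \<in> borel_measurable (config_measure L)"
    using measurable_compose[OF measurable_config_component exp_Re_measurable, of _ L]
    by (intro borel_measurable_prod) auto
  have "(\<integral>S. chain_weight L \<beta> S * h S \<partial>config_measure L)
      = (\<integral>U. chain_weight L \<beta> (partial_products L U) * h (partial_products L U) \<partial>config_measure L)"
    by (subst distr_partial_products[of L, symmetric]) (simp add: integral_distr)
  also have "\<dots> = (\<integral>U. (\<Prod>i<L. von_mises_norm (b i)) *
      ((\<Prod>i<L. exp (b i * Re (U i)) / von_mises_norm (b i)) * h (partial_products L U)) \<partial>config_measure L)"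
  proof (rule Bochner_Integration.integral_cong[OF refl])
    fix U assume "U \<in> space (config_measure L)"
    moreover have "(\<Prod>i<L. von_mises_norm (b i)) \<noteq> 0"
      using von_mises_norm_pos by (simp add: less_imp_neq[symmetric])
    ultimately show "chain_weight L \<beta> (partial_products L U) * h (partial_products L U) =
      (\<Prod>i<L. von_mises_norm (b i)) * ((\<Prod>i<L. exp (b i * Re (U i)) / von_mises_norm (b i)) * h (partial_products L U))"
      by (simp add: space_config_measure chain_weight_partial_products b_def prod_dividef)
  qed
  also have "\<dots> = (\<Prod>i<L. von_mises_norm (b i)) * (\<integral>U. h (partial_products L U) \<partial>PiM {..<L} (\<lambda>i. von_mises (b i)))"
    unfolding PiM_von_mises
    by (subst integral_density) (auto intro!: prod_nonneg simp: less_imp_le[OF von_mises_norm_pos])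
  finally show ?thesis .
qed

lemma partial_products_angle_config:
  "partial_products L (angle_config L \<phi>) = angle_config L (\<lambda>j. \<Sum>i\<le>j. \<phi> i)"
proof -
  have "(\<Prod>i\<le>j. cis (\<phi> i)) = cis (\<Sum>i\<le>j. \<phi> i)" for j
    by (induction j) (auto simp: cis_mult)
  then show ?thesis by (auto simp: partial_products_def angle_config_def)
qed

text \<open>Turning the \<open>k\<close>-th increment rotates all the spins from \<open>k\<close> on.\<close>

lemma deriv_partial_products:
  fixes f :: "(nat \<Rightarrow> complex) \<Rightarrow> real"
  assumes f: "smooth_on_configs L f" and U: "U \<in> configs L" and k: "k < L"
  defines "g' \<equiv> \<lambda>t. \<Sum>j\<in>{k..<L}. spin_deriv j f (partial_products L (U(k := cis t)))"
  shows "((\<lambda>t. f (partial_products L (U(k := cis t)))) has_real_derivative g' t) (at t)"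
    and "continuous_on UNIV g'"
proof -
  define F where "F \<theta> = f (angle_config L \<theta>)" for \<theta>
  define \<alpha> where "\<alpha> = args L U"
  define \<Theta> where "\<Theta> t = (\<lambda>j\<in>{..<L}. \<Sum>i\<le>j. (\<alpha>(k := t)) i)" for t
  have \<Theta>P: "\<Theta> t \<in> {..<L} \<rightarrow>\<^sub>E UNIV" for t by (auto simp: \<Theta>_def)
  have "U(k := cis t) = angle_config L (\<alpha>(k := t))" for t
  proof (rule ext)
    show "(U(k := cis t)) i = angle_config L (\<alpha>(k := t)) i" for i
      using fun_cong[OF angle_config_args[OF U], of i] k
      by (auto simp: \<alpha>_def angle_config_def split: if_splits)
  qed
  then have pp: "partial_products L (U(k := cis t)) = angle_config L (\<Theta> t)" for t
    by (simp add: partial_products_angle_config \<Theta>_def angle_config_restrict)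
  have g': "g' = (\<lambda>t. \<Sum>j\<in>{k..<L}. partial_deriv j F (\<Theta> t))"
    by (simp add: g'_def pp spin_deriv_angle_config F_def[abs_def])
  have shift: "\<Theta> (t + s) = (\<lambda>j. if j \<in> {k..<L} then \<Theta> t j + s else \<Theta> t j)" for t s
  proof (rule ext)
    fix j
    show "\<Theta> (t + s) j = (if j \<in> {k..<L} then \<Theta> t j + s else \<Theta> t j)"
    proof (cases "k \<le> j")
      case True
      then have "(\<Sum>i\<le>j. (\<alpha>(k := r)) i) = r + (\<Sum>i\<in>{..j} - {k}. \<alpha> i)" for r
        by (subst sum.remove[of _ k]) (auto intro!: sum.cong)
      then show ?thesis using True by (simp add: \<Theta>_def)
    next
      case False
      then have "(\<Sum>i\<le>j. (\<alpha>(k := r)) i) = (\<Sum>i\<le>j. \<alpha> i)" for r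
        by (intro sum.cong) auto
      then show ?thesis using False by (simp add: \<Theta>_def)
    qed
  qed
  have "((\<lambda>s. F (\<Theta> (t + s))) has_real_derivative (\<Sum>j\<in>{k..<L}. partial_deriv j F (\<Theta> t))) (at 0)"
    unfolding shift
    by (rule has_derivative_shift_coordinates[where L = L])
       (use smooth_on_configsD[OF f] \<Theta>P in \<open>auto simp: F_def[abs_def] simp del: fun_upd_apply\<close>)
  then have "((\<lambda>s. F (\<Theta> s)) has_real_derivative g' t) (at t)"
    unfolding g' using DERIV_shift[of "\<lambda>s. F (\<Theta> s)" _ 0 t] by (simp add: add.commute)
  then show "((\<lambda>t. f (partial_products L (U(k := cis t)))) has_real_derivative g' t) (at t)"
    by (simp add: pp F_def)
  have "continuous_on UNIV \<Theta>"
  proof (rule continuous_on_coordinatewise_then_product)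
    fix j
    have "continuous_on UNIV (\<lambda>t. (\<alpha>(k := t)) i)" for i
      by (cases "i = k") (auto intro!: continuous_intros)
    then have "continuous_on UNIV (\<lambda>t. \<Sum>i\<le>j. (\<alpha>(k := t)) i)" by (intro continuous_on_sum)
    then show "continuous_on UNIV (\<lambda>t. \<Theta> t j)" by (cases "j < L") (simp_all add: \<Theta>_def)
  qed
  then show "continuous_on UNIV g'"
    unfolding g'
    by (intro continuous_on_sum continuous_on_compose2[OF smooth_on_configsD(2)[OF f, folded F_def]])
       (use \<Theta>P in auto)
qed

text \<open>The centre is the mean under the open chain, and the integrals stay unnormalised, ready
  for the comparison of weights. One factor \<open>L\<close> is the number of increments; the other
  comes from Cauchy--Schwarz for the sum of spin derivatives that a single increment
  produces.\<close>

lemma chain_poincare: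
  fixes f :: "(nat \<Rightarrow> complex) \<Rightarrow> real"
  assumes f: "smooth_on_configs L f" and \<beta>: "0 \<le> \<beta>"
  shows "\<exists>m. (\<integral>S. chain_weight L \<beta> S * (f S - m)\<^sup>2 \<partial>config_measure L)
     \<le> pi\<^sup>2 * (real L)\<^sup>2 * (\<integral>S. chain_weight L \<beta> S * (\<Sum>j<L. (spin_deriv j f S)\<^sup>2) \<partial>config_measure L)"
proof -
  define b where "b i = (if i = 0 then 0 else \<beta>)" for i :: nat
  have b0: "0 \<le> b i" for i using \<beta> by (simp add: b_def)
  let ?P = "PiM {..<L} (\<lambda>i. von_mises (b i))" and ?T = "partial_products L"
  interpret vm: product_prob_space "\<lambda>i. von_mises (b i)" by (rule product_prob_space_von_mises)
  interpret P: prob_space ?P by (rule prob_space_PiM) (rule prob_space_von_mises)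
  have sP: "sets ?P = sets (config_measure L)" by (simp add: PiM_von_mises)
  have spP: "space ?P = configs L" by (simp add: PiM_von_mises space_config_measure)
  have mP: "borel_measurable ?P = borel_measurable (config_measure L)"
    by (rule measurable_cong_sets[OF sP refl])
  note [measurable] = smooth_on_configs_measurable[OF f]
  obtain B where B: "\<And>S. S \<in> configs L \<Longrightarrow> \<bar>f S\<bar> \<le> B"
    "\<And>i S. i < L \<Longrightarrow> S \<in> configs L \<Longrightarrow> \<bar>spin_deriv i f S\<bar> \<le> B"
    using smooth_on_configs_bounded[OF f] by metis
  define h where "h k U = pi\<^sup>2 * (\<Sum>j\<in>{k..<L}. spin_deriv j f (?T U))\<^sup>2" for k U
  define q where "q S = (\<Sum>j<L. (spin_deriv j f S)\<^sup>2)" for S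
  have qm[measurable]: "q \<in> borel_measurable (config_measure L)" unfolding q_def by measurable
  have sqm[measurable]: "(\<lambda>U. spin_deriv j f (?T U)) \<in> borel_measurable (config_measure L)" if "j < L" for j
    using that by measurable
  have hm[measurable]: "h k \<in> borel_measurable (config_measure L)" for k
    unfolding h_def using sqm by (intro borel_measurable_times borel_measurable_power borel_measurable_sum) auto
  have cs: "(\<Sum>j\<in>{k..<L}. spin_deriv j f S)\<^sup>2 \<le> real L * q S" for k S
  proof -
    have "(\<Sum>j\<in>{k..<L}. spin_deriv j f S)\<^sup>2 \<le> (\<Sum>j\<in>{k..<L}. (spin_deriv j f S)\<^sup>2) * real (card {k..<L})"
      by (rule sum_squared_le_sum_of_squares)
    also have "\<dots> \<le> q S * real L"
      unfolding q_def by (intro mult_mono sum_mono2 sum_nonneg) auto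
    finally show ?thesis by (simp add: mult.commute)
  qed
  have qB: "q S \<le> real L * B\<^sup>2" if "S \<in> configs L" for S
  proof -
    have "(spin_deriv j f S)\<^sup>2 \<le> B\<^sup>2" if "j < L" for j
      using power_mono[OF B(2)[OF that \<open>S \<in> configs L\<close>], of 2] by simp
    then have "q S \<le> (\<Sum>j<L. B\<^sup>2)" unfolding q_def by (intro sum_mono) auto
    then show ?thesis by simp
  qed
  have hq: "h k U \<le> pi\<^sup>2 * (real L * q (?T U))" for k U
    unfolding h_def by (intro mult_left_mono cs) auto
  have q0: "0 \<le> q S" for S unfolding q_def by (intro sum_nonneg) auto
  have hB: "\<bar>h k U\<bar> \<le> pi\<^sup>2 * (real L * (real L * B\<^sup>2))" if "U \<in> configs L" for k U
  proof -
    have "0 \<le> h k U" by (simp add: h_def)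
    moreover have "h k U \<le> pi\<^sup>2 * (real L * (real L * B\<^sup>2))"
      by (rule order_trans[OF hq]) (intro mult_left_mono qB partial_products_in_configs that; simp)
    ultimately show ?thesis by simp
  qed
  \<comment> \<open>\<open>variance_PiM_le\<close> takes one common bound for the function and for
    the majorants.\<close>
  define M where "M = \<bar>B\<bar> + pi\<^sup>2 * (real L * (real L * B\<^sup>2))"
  define m where "m = (\<integral>U. f (?T U) \<partial>?P)"
  have "(\<integral>U. (f (?T U) - m)\<^sup>2 \<partial>?P) \<le> (\<Sum>k<L. \<integral>U. h k U \<partial>?P)"
    unfolding m_def
  proof (rule product_prob_space.variance_PiM_le[OF product_prob_space_von_mises[of b], of "{..<L}" "\<lambda>U. f (?T U)" M h])
    show "(\<lambda>U. f (?T U)) \<in> borel_measurable ?P" unfolding mP by measurable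
    show "h k \<in> borel_measurable ?P" for k unfolding mP by (rule hm)
    show "\<bar>f (?T U)\<bar> \<le> M" if "U \<in> space ?P" for U
    proof -
      have "\<bar>f (?T U)\<bar> \<le> B" using that by (intro B partial_products_in_configs) (simp add: spP)
      moreover have "0 \<le> pi\<^sup>2 * (real L * (real L * B\<^sup>2))" by simp
      ultimately show ?thesis unfolding M_def by linarith
    qed
    show "\<bar>h k U\<bar> \<le> M" if "U \<in> space ?P" for k U
      using hB[of U k] that unfolding M_def spP by linarith
    fix k U assume k: "k \<in> {..<L}" and "U \<in> space ?P"
    then have U: "U \<in> configs L" and k: "k < L" by (simp_all add: spP)
    have upd: "(\<lambda>u. U(k := u)) \<in> circle_measure \<rightarrow>\<^sub>M config_measure L"
      unfolding config_measure_def
    proof (rule measurable_PiM_single')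
      have Ui: "U i \<in> space circle_measure" if "i < L" for i
        using config_norm[OF U that] by (simp add: space_circle_measure)
      show "(\<lambda>u. (U(k := u)) i) \<in> circle_measure \<rightarrow>\<^sub>M circle_measure" if "i \<in> {..<L}" for i
        using Ui[of i] that by (cases "i = k") simp_all
      have "U i = undefined" if "\<not> i < L" for i
        using U that by (simp add: configs_def PiE_def extensional_def)
      then show "(\<lambda>u. U(k := u)) \<in> space circle_measure \<rightarrow> ({..<L} \<rightarrow>\<^sub>E space circle_measure)"
        using Ui k by (intro Pi_I PiE_I) auto
    qed
    have "(\<integral>u. (f (?T (U(k := u))) - (\<integral>v. f (?T (U(k := v))) \<partial>von_mises (b k)))\<^sup>2 \<partial>von_mises (b k))
      \<le> pi\<^sup>2 * (\<integral>u. (\<Sum>j\<in>{k..<L}. spin_deriv j f (?T (U(k := u))))\<^sup>2 \<partial>von_mises (b k))"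
    proof (rule von_mises_poincare[OF b0])
      show "(\<lambda>u. f (?T (U(k := u)))) \<in> borel_measurable circle_measure"
        by (rule measurable_compose[OF upd]) measurable
      show "(\<lambda>u. \<Sum>j\<in>{k..<L}. spin_deriv j f (?T (U(k := u)))) \<in> borel_measurable circle_measure"
        by (rule measurable_compose[OF upd]) (intro borel_measurable_sum sqm; simp)
    qed (use deriv_partial_products[OF f U k] in auto)
    then show "(\<integral>u. (f (?T (U(k := u))) - (\<integral>v. f (?T (U(k := v))) \<partial>von_mises (b k)))\<^sup>2 \<partial>von_mises (b k))
      \<le> (\<integral>u. h k (U(k := u)) \<partial>von_mises (b k))"
      by (simp only: h_def integral_mult_right_zero)
  qed simp
  also have "\<dots> \<le> (\<Sum>k<L. \<integral>U. pi\<^sup>2 * (real L * q (?T U)) \<partial>?P)"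
  proof (rule sum_mono)
    fix k
    have mq: "(\<lambda>U. q (?T U)) \<in> borel_measurable ?P" unfolding mP by measurable
    have "integrable ?P (\<lambda>U. q (?T U))"
      using qB q0 by (intro P.integrable_bounded[OF mq, of "real L * B\<^sup>2"]) (simp add: spP partial_products_in_configs)
    moreover have "integrable ?P (h k)"
      by (rule P.integrable_bounded[OF _ hB]) (simp_all add: mP spP)
    ultimately show "(\<integral>U. h k U \<partial>?P) \<le> (\<integral>U. pi\<^sup>2 * (real L * q (?T U)) \<partial>?P)"
      using hq by (intro integral_mono) auto
  qed
  also have "\<dots> = pi\<^sup>2 * (real L)\<^sup>2 * (\<integral>U. q (?T U) \<partial>?P)"
    by (simp add: power2_eq_square)
  finally have main: "(\<integral>U. (f (?T U) - m)\<^sup>2 \<partial>?P) \<le> pi\<^sup>2 * (real L)\<^sup>2 * (\<integral>U. q (?T U) \<partial>?P)" .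
  have N: "0 \<le> (\<Prod>i<L. von_mises_norm (b i))"
    using von_mises_norm_pos by (intro prod_nonneg) (simp add: less_imp_le)
  have "(\<integral>S. chain_weight L \<beta> S * (f S - m)\<^sup>2 \<partial>config_measure L)
      = (\<Prod>i<L. von_mises_norm (b i)) * (\<integral>U. (f (?T U) - m)\<^sup>2 \<partial>?P)"
    unfolding b_def by (rule integral_chain_weight) measurable
  also have "\<dots> \<le> (\<Prod>i<L. von_mises_norm (b i)) * (pi\<^sup>2 * (real L)\<^sup>2 * (\<integral>U. q (?T U) \<partial>?P))"
    by (rule mult_left_mono[OF main N])
  also have "\<dots> = pi\<^sup>2 * (real L)\<^sup>2 * ((\<Prod>i<L. von_mises_norm (b i)) * (\<integral>U. q (?T U) \<partial>?P))"
    by simp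
  also have "(\<Prod>i<L. von_mises_norm (b i)) * (\<integral>U. q (?T U) \<partial>?P) = (\<integral>S. chain_weight L \<beta> S * q S \<partial>config_measure L)"
    unfolding b_def by (rule integral_chain_weight[OF qm, symmetric])
  finally show ?thesis unfolding q_def by blast
qed

section \<open>The periodic chain: upper bound\<close>

lemma measurable_hamiltonian [measurable]: "hamiltonian L \<in> borel_measurable (config_measure L)"
  unfolding hamiltonian_def
  by (intro borel_measurable_uminus borel_measurable_sum measurable_inner_config) auto

lemma abs_inner_config_le:
  assumes "S \<in> configs L" "i < L" "j < L"
  shows "\<bar>S i \<bullet> S j\<bar> \<le> 1"
  using Cauchy_Schwarz_ineq2[of "S i" "S j"] assms by (simp add: config_norm)

lemma abs_hamiltonian_le:
  assumes S: "S \<in> configs L"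
  shows "\<bar>hamiltonian L S\<bar> \<le> real L"
proof -
  have "\<bar>\<Sum>i<L. S i \<bullet> S (Suc i mod L)\<bar> \<le> (\<Sum>i<L. \<bar>S i \<bullet> S (Suc i mod L)\<bar>)" by (rule sum_abs)
  also have "\<dots> \<le> (\<Sum>i<L. 1)" by (intro sum_mono abs_inner_config_le[OF S]) auto
  finally show ?thesis by (simp add: hamiltonian_def)
qed

lemma boltzmann_bounds:
  assumes "S \<in> configs L"
  shows "exp (- (\<bar>\<beta>\<bar> * real L)) \<le> exp (- \<beta> * hamiltonian L S)"
    and "exp (- \<beta> * hamiltonian L S) \<le> exp (\<bar>\<beta>\<bar> * real L)"
proof -
  have "\<bar>\<beta> * hamiltonian L S\<bar> \<le> \<bar>\<beta>\<bar> * real L"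
    unfolding abs_mult by (intro mult_left_mono abs_hamiltonian_le assms) auto
  then show "exp (- (\<bar>\<beta>\<bar> * real L)) \<le> exp (- \<beta> * hamiltonian L S)"
    and "exp (- \<beta> * hamiltonian L S) \<le> exp (\<bar>\<beta>\<bar> * real L)" by auto
qed

lemma integrable_boltzmann:
  fixes h :: "(nat \<Rightarrow> complex) \<Rightarrow> real"
  assumes [measurable]: "h \<in> borel_measurable (config_measure L)" and B: "\<And>S. S \<in> configs L \<Longrightarrow> \<bar>h S\<bar> \<le> B"
  shows "integrable (config_measure L) (\<lambda>S. exp (- \<beta> * hamiltonian L S) * h S)"
proof (rule config.integrable_bounded)
  fix S assume "S \<in> space (config_measure L)"
  then have "S \<in> configs L" by (simp add: space_config_measure)
  then show "\<bar>exp (- \<beta> * hamiltonian L S) * h S\<bar> \<le> exp (\<bar>\<beta>\<bar> * real L) * B"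
    unfolding abs_mult using boltzmann_bounds[of S L \<beta>] B[of S] by (intro mult_mono) auto
qed measurable

lemma integral_config_ge:
  fixes h :: "(nat \<Rightarrow> complex) \<Rightarrow> real"
  assumes "integrable (config_measure L) h" "\<And>S. S \<in> configs L \<Longrightarrow> c \<le> h S"
  shows "c * (2 * pi) ^ L \<le> (\<integral>S. h S \<partial>config_measure L)"
proof -
  have "(\<integral>S. c \<partial>config_measure L) \<le> (\<integral>S. h S \<partial>config_measure L)"
    using assms by (intro integral_mono) (auto simp: space_config_measure)
  then show ?thesis by (simp add: measure_def space_config_measure emeasure_config_measure mult.commute)
qed

lemma partition_function_pos: "0 < partition_function L \<beta>"
proof -
  have "exp (- (\<bar>\<beta>\<bar> * real L)) * (2 * pi) ^ L \<le> partition_function L \<beta>"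
    unfolding partition_function_def
  proof (rule integral_config_ge)
    show "integrable (config_measure L) (\<lambda>S. exp (- \<beta> * hamiltonian L S))"
      using integrable_boltzmann[of "\<lambda>_. 1" L 1 \<beta>] by simp
  qed (rule boltzmann_bounds)
  then show ?thesis by (rule less_le_trans[rotated]) simp
qed

lemma integral_gibbs:
  fixes h :: "(nat \<Rightarrow> complex) \<Rightarrow> real"
  assumes [measurable]: "h \<in> borel_measurable (config_measure L)"
  shows "(\<integral>S. h S \<partial>gibbs L \<beta>) = (\<integral>S. exp (- \<beta> * hamiltonian L S) * h S \<partial>config_measure L) / partition_function L \<beta>"
  unfolding gibbs_def using less_imp_le[OF partition_function_pos[of L \<beta>]]
  by (subst integral_density) auto

lemma space_gibbs: "space (gibbs L \<beta>) = configs L"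
  by (simp add: gibbs_def space_config_measure)

lemma sets_gibbs [measurable_cong]: "sets (gibbs L \<beta>) = sets (config_measure L)"
  by (simp add: gibbs_def)

lemma prob_space_gibbs: "prob_space (gibbs L \<beta>)"
proof
  have "emeasure (gibbs L \<beta>) (space (gibbs L \<beta>))
      = (\<integral>\<^sup>+S. ennreal (exp (- \<beta> * hamiltonian L S) / partition_function L \<beta>) \<partial>config_measure L)"
    unfolding gibbs_def by (subst emeasure_density) (auto intro!: nn_integral_cong)
  also have "\<dots> = ennreal (\<integral>S. exp (- \<beta> * hamiltonian L S) / partition_function L \<beta> \<partial>config_measure L)"
    using partition_function_pos[of L \<beta>] integrable_boltzmann[of "\<lambda>_. 1" L 1 \<beta>]
    by (intro nn_integral_eq_integral) (auto simp: less_imp_le)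
  also have "\<dots> = 1"
    using partition_function_pos[of L \<beta>] by (simp add: partition_function_def)
  finally show "emeasure (gibbs L \<beta>) (space (gibbs L \<beta>)) = 1" .
qed

interpretation gibbs: prob_space "gibbs L \<beta>" for L \<beta> by (rule prob_space_gibbs)

lemma integrable_gibbs:
  fixes h :: "(nat \<Rightarrow> complex) \<Rightarrow> real"
  assumes "h \<in> borel_measurable (config_measure L)" "\<And>S. S \<in> configs L \<Longrightarrow> \<bar>h S\<bar> \<le> B"
  shows "integrable (gibbs L \<beta>) h"
  using assms by (intro gibbs.integrable_bounded[of h L \<beta> B])
    (simp_all only: space_gibbs measurable_cong_sets[OF sets_gibbs refl])

lemma boltzmann_eq_chain_weight:
  assumes "0 < L"
  shows "exp (- \<beta> * hamiltonian L S) = chain_weight L \<beta> S * exp (\<beta> * (S (L - 1) \<bullet> S 0))"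
proof -
  obtain n where n: "L = Suc n" using assms gr0_implies_Suc by blast
  have "(\<Sum>i<L. S i \<bullet> S (Suc i mod L)) = (\<Sum>i<n. S i \<bullet> S (Suc i)) + S n \<bullet> S 0"
    unfolding n by (simp add: sum.lessThan_Suc)
  also have "(\<Sum>i<n. S i \<bullet> S (Suc i)) = (\<Sum>i\<in>{1..<L}. S (i - 1) \<bullet> S i)"
    unfolding n by (rule sum.reindex_bij_witness[of _ "\<lambda>i. i - 1" Suc]) auto
  finally have "hamiltonian L S = - ((\<Sum>i\<in>{1..<L}. S (i - 1) \<bullet> S i) + S (L - 1) \<bullet> S 0)"
    by (simp only: hamiltonian_def n diff_Suc_1)
  then show ?thesis
    by (simp only: chain_weight_def exp_add[symmetric]) (simp add: algebra_simps)
qed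

lemma dirichlet_form_eq:
  assumes f: "smooth_on_configs L f"
  shows "dirichlet_form L \<beta> f = 1 / \<beta> * (\<integral>S. (\<Sum>j<L. (spin_deriv j f S)\<^sup>2) \<partial>gibbs L \<beta>)"
proof -
  obtain B where B: "\<And>i S. i < L \<Longrightarrow> S \<in> configs L \<Longrightarrow> \<bar>spin_deriv i f S\<bar> \<le> B"
    using smooth_on_configs_bounded[OF f] by metis
  have "integrable (gibbs L \<beta>) (\<lambda>S. (spin_deriv j f S)\<^sup>2)" if "j < L" for j
  proof (rule integrable_gibbs[of _ _ "B\<^sup>2"])
    show "(\<lambda>S. (spin_deriv j f S)\<^sup>2) \<in> borel_measurable (config_measure L)"
      using smooth_on_configs_measurable(2)[OF f that] by measurable
    show "\<bar>(spin_deriv j f S)\<^sup>2\<bar> \<le> B\<^sup>2" if "S \<in> configs L" for S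
      using power_mono[OF B[OF \<open>j < L\<close> that], of 2] by simp
  qed
  then have "(\<integral>S. (\<Sum>j<L. (spin_deriv j f S)\<^sup>2) \<partial>gibbs L \<beta>) = (\<Sum>j<L. \<integral>S. (spin_deriv j f S)\<^sup>2 \<partial>gibbs L \<beta>)"
    by (intro Bochner_Integration.integral_sum) auto
  also have "\<dots> = (\<Sum>j<L. \<integral>S. (norm (spin_gradient j f S))\<^sup>2 \<partial>gibbs L \<beta>)"
    by (intro sum.cong refl Bochner_Integration.integral_cong) (auto simp: space_gibbs norm_spin_gradient)
  finally show ?thesis by (simp add: dirichlet_form_def)
qed

lemma smooth_square_bounds:
  fixes f :: "(nat \<Rightarrow> complex) \<Rightarrow> real"
  assumes f: "smooth_on_configs L f"
  obtains B where "\<And>S. S \<in> configs L \<Longrightarrow> \<bar>(f S - c)\<^sup>2\<bar> \<le> B"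
    "\<And>S. S \<in> configs L \<Longrightarrow> \<bar>\<Sum>j<L. (spin_deriv j f S)\<^sup>2\<bar> \<le> B"
proof -
  obtain B where B: "\<And>S. S \<in> configs L \<Longrightarrow> \<bar>f S\<bar> \<le> B"
    "\<And>i S. i < L \<Longrightarrow> S \<in> configs L \<Longrightarrow> \<bar>spin_deriv i f S\<bar> \<le> B"
    using smooth_on_configs_bounded[OF f] by metis
  define K where "K = 4 * (\<bar>B\<bar> + \<bar>c\<bar>)\<^sup>2 + real L * B\<^sup>2"
  have 1: "\<bar>(f S - c)\<^sup>2\<bar> \<le> K" if "S \<in> configs L" for S
  proof -
    have "\<bar>(f S - c)\<^sup>2\<bar> \<le> 4 * (\<bar>B\<bar> + \<bar>c\<bar>)\<^sup>2"
      using B(1)[OF that] by (intro abs_square_diff_le) auto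
    moreover have "0 \<le> real L * B\<^sup>2" by simp
    ultimately show ?thesis unfolding K_def by linarith
  qed
  have 2: "\<bar>\<Sum>j<L. (spin_deriv j f S)\<^sup>2\<bar> \<le> K" if S: "S \<in> configs L" for S
  proof -
    have "(\<Sum>j<L. (spin_deriv j f S)\<^sup>2) \<le> (\<Sum>j<L. B\<^sup>2)"
    proof (rule sum_mono)
      fix j assume "j \<in> {..<L}"
      then show "(spin_deriv j f S)\<^sup>2 \<le> B\<^sup>2" using power_mono[OF B(2)[OF _ S], of j 2] by simp
    qed
    then have "\<bar>\<Sum>j<L. (spin_deriv j f S)\<^sup>2\<bar> \<le> real L * B\<^sup>2" by (simp add: sum_nonneg)
    moreover have "0 \<le> 4 * (\<bar>B\<bar> + \<bar>c\<bar>)\<^sup>2" by simp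
    ultimately show ?thesis unfolding K_def by linarith
  qed
  from that[OF 1 2] show thesis .
qed

text \<open>A factor \<open>exp \<beta>\<close> is lost when the second moment about
  \<open>m\<close> passes to the chain weight, another when the energy passes back. The centre
  \<open>m\<close> of the open chain is admissible because the variance is the least second moment.
  Both sides are divided by the periodic partition function, so that of the open chain never
  enters.\<close>

lemma gibbs_poincare:
  fixes f :: "(nat \<Rightarrow> complex) \<Rightarrow> real"
  assumes f: "smooth_on_configs L f" and L: "0 < L" and \<beta>: "0 \<le> \<beta>"
  shows "gibbs.variance L \<beta> f \<le> pi\<^sup>2 * (real L)\<^sup>2 * exp (2 * \<beta>) * (\<integral>S. (\<Sum>j<L. (spin_deriv j f S)\<^sup>2) \<partial>gibbs L \<beta>)"
proof -
  let ?G = "\<lambda>S. exp (- \<beta> * hamiltonian L S)" and ?W = "chain_weight L \<beta>"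
  let ?Z = "partition_function L \<beta>"
  define q where "q S = (\<Sum>j<L. (spin_deriv j f S)\<^sup>2)" for S
  note fm[measurable] = smooth_on_configs_measurable[OF f]
  have qm[measurable]: "q \<in> borel_measurable (config_measure L)" unfolding q_def by measurable
  obtain m where m: "(\<integral>S. ?W S * (f S - m)\<^sup>2 \<partial>config_measure L)
     \<le> pi\<^sup>2 * (real L)\<^sup>2 * (\<integral>S. ?W S * q S \<partial>config_measure L)"
    using chain_poincare[OF f \<beta>] by (auto simp: q_def)
  obtain B where B: "\<And>S. S \<in> configs L \<Longrightarrow> \<bar>(f S - m)\<^sup>2\<bar> \<le> B" "\<And>S. S \<in> configs L \<Longrightarrow> \<bar>q S\<bar> \<le> B"
    using smooth_square_bounds[OF f, of m] unfolding q_def by metis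
  obtain B' where B': "\<And>S. S \<in> configs L \<Longrightarrow> \<bar>(f S)\<^sup>2\<bar> \<le> B'"
    using smooth_square_bounds[OF f, of 0] by (metis diff_zero)
  obtain B'' where B'': "\<And>S. S \<in> configs L \<Longrightarrow> \<bar>f S\<bar> \<le> B''"
    using smooth_on_configs_bounded[OF f] by metis
  have GW: "?G S \<le> exp \<beta> * ?W S" "?W S \<le> exp \<beta> * ?G S" if "S \<in> configs L" for S
  proof -
    have "\<bar>S (L - 1) \<bullet> S 0\<bar> \<le> 1" using L by (intro abs_inner_config_le[OF that]) auto
    then have "\<bar>\<beta> * (S (L - 1) \<bullet> S 0)\<bar> \<le> \<beta> * 1" unfolding abs_mult using \<beta> by (simp add: mult_left_le)
    then have *: "exp (\<beta> * (S (L - 1) \<bullet> S 0)) \<le> exp \<beta>" "1 \<le> exp (\<beta> + \<beta> * (S (L - 1) \<bullet> S 0))"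
      by (auto simp: abs_le_iff)
    have W0: "0 \<le> ?W S" by (simp add: chain_weight_def)
    have eq: "?G S = ?W S * exp (\<beta> * (S (L - 1) \<bullet> S 0))" by (rule boltzmann_eq_chain_weight[OF L])
    show "?G S \<le> exp \<beta> * ?W S" unfolding eq using mult_left_mono[OF *(1) W0] by (simp add: mult.commute)
    show "?W S \<le> exp \<beta> * ?G S" unfolding eq using mult_left_mono[OF *(2) W0] by (simp add: exp_add algebra_simps)
  qed
  have iG: "integrable (config_measure L) (\<lambda>S. ?G S * (f S - m)\<^sup>2)" "integrable (config_measure L) (\<lambda>S. ?G S * q S)"
    by (rule integrable_boltzmann[OF _ B(1)], measurable) (rule integrable_boltzmann[OF qm B(2)])
  have W0: "0 \<le> ?W S" for S by (simp add: chain_weight_def)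
  have iW: "integrable (config_measure L) (\<lambda>S. ?W S * h S)"
    if [measurable]: "h \<in> borel_measurable (config_measure L)" and "integrable (config_measure L) (\<lambda>S. ?G S * h S)"
      and "\<And>S. 0 \<le> h S" for h
  proof (rule Bochner_Integration.integrable_bound)
    show "integrable (config_measure L) (\<lambda>S. exp \<beta> * (?G S * h S))" using that by simp
    have "norm (?W S * h S) \<le> norm (exp \<beta> * (?G S * h S))" if "S \<in> configs L" for S
      using mult_right_mono[OF GW(2)[OF that] \<open>0 \<le> h S\<close>] \<open>0 \<le> h S\<close> W0 by (simp add: abs_mult mult.assoc)
    then show "AE S in config_measure L. norm (?W S * h S) \<le> norm (exp \<beta> * (?G S * h S))"
      by (intro AE_I2) (simp only: space_config_measure)
  qed measurable
  have q0: "0 \<le> q S" for S unfolding q_def by (intro sum_nonneg) auto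
  have if': "integrable (gibbs L \<beta>) f" "integrable (gibbs L \<beta>) (\<lambda>S. (f S)\<^sup>2)"
    by (rule integrable_gibbs[OF _ B''], measurable) (rule integrable_gibbs[OF _ B'], measurable)
  have "gibbs.variance L \<beta> f \<le> (\<integral>S. (f S - m)\<^sup>2 \<partial>gibbs L \<beta>)"
    by (subst gibbs.expectation_square_diff[OF if']) simp
  also have "\<dots> = (\<integral>S. ?G S * (f S - m)\<^sup>2 \<partial>config_measure L) / ?Z"
    by (rule integral_gibbs) measurable
  also have "(\<integral>S. ?G S * (f S - m)\<^sup>2 \<partial>config_measure L) \<le> (\<integral>S. exp \<beta> * (?W S * (f S - m)\<^sup>2) \<partial>config_measure L)"
  proof (rule integral_mono[OF iG(1)])
    show "integrable (config_measure L) (\<lambda>S. exp \<beta> * (?W S * (f S - m)\<^sup>2))"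
      by (intro integrable_mult_right iW iG(1)) auto
    show "?G S * (f S - m)\<^sup>2 \<le> exp \<beta> * (?W S * (f S - m)\<^sup>2)" if "S \<in> space (config_measure L)" for S
      using mult_right_mono[OF GW(1), of S "(f S - m)\<^sup>2"] that by (simp add: space_config_measure mult.assoc)
  qed
  also have "\<dots> \<le> exp \<beta> * (pi\<^sup>2 * (real L)\<^sup>2 * (\<integral>S. ?W S * q S \<partial>config_measure L))"
    using m by simp
  also have "(\<integral>S. ?W S * q S \<partial>config_measure L) \<le> (\<integral>S. exp \<beta> * (?G S * q S) \<partial>config_measure L)"
  proof (rule integral_mono)
    show "integrable (config_measure L) (\<lambda>S. ?W S * q S)" by (rule iW[OF qm iG(2) q0])
    show "integrable (config_measure L) (\<lambda>S. exp \<beta> * (?G S * q S))" using iG(2) by simp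
    show "?W S * q S \<le> exp \<beta> * (?G S * q S)" if "S \<in> space (config_measure L)" for S
      using mult_right_mono[OF GW(2) q0, of S] that by (simp add: space_config_measure mult.assoc)
  qed
  also have "exp \<beta> * (pi\<^sup>2 * (real L)\<^sup>2 * (\<integral>S. exp \<beta> * (?G S * q S) \<partial>config_measure L)) / ?Z
      = pi\<^sup>2 * (real L)\<^sup>2 * exp (2 * \<beta>) * ((\<integral>S. ?G S * q S \<partial>config_measure L) / ?Z)"
    by (simp add: exp_double power2_eq_square)
  also have "(\<integral>S. ?G S * q S \<partial>config_measure L) / ?Z = (\<integral>S. q S \<partial>gibbs L \<beta>)"
    by (rule integral_gibbs[OF qm, symmetric])
  finally show ?thesis
    using less_imp_le[OF partition_function_pos[of L \<beta>]]
    by (simp add: q_def divide_right_mono mult_left_mono)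
qed

section \<open>Boxes of angles and strict positivity of the variance\<close>

definition angle_box :: "nat \<Rightarrow> (nat \<Rightarrow> real) \<Rightarrow> real \<Rightarrow> (nat \<Rightarrow> complex) set" where
  "angle_box L a r = {S \<in> configs L. \<forall>i<L. a i \<le> args L S i \<and> args L S i < a i + r}"

lemma angle_box_eq_PiE:
  "angle_box L a r = PiE {..<L} (\<lambda>i. {z \<in> space circle_measure. a i \<le> Arg2pi z \<and> Arg2pi z < a i + r})"
  by (auto simp: angle_box_def args_def configs_def space_circle_measure PiE_def Pi_def)

lemma arc_measurable: "{z \<in> space circle_measure. a \<le> Arg2pi z \<and> Arg2pi z < b} \<in> sets circle_measure"
  using borel_measurable_circle[OF Arg2pi_measurable] by measurable

lemma angle_box_measurable: "angle_box L a r \<in> sets (config_measure L)"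
  unfolding angle_box_eq_PiE config_measure_def by (intro sets_PiM_I_finite arc_measurable) auto

lemma emeasure_arc:
  assumes "0 \<le> a" "a \<le> b" "b \<le> 2 * pi"
  shows "emeasure circle_measure {z \<in> space circle_measure. a \<le> Arg2pi z \<and> Arg2pi z < b} = ennreal (b - a)"
proof -
  let ?A = "{z \<in> space circle_measure. a \<le> Arg2pi z \<and> Arg2pi z < b}"
  have [measurable]: "?A \<in> sets circle_measure" by (rule arc_measurable)
  have Arg: "Arg2pi (cis t) = t" if "0 \<le> t" "t < 2 * pi" for t
    using that by (intro Arg2pi_unique[of 1]) (auto simp: cis_conv_exp)
  have "emeasure circle_measure ?A = (\<integral>\<^sup>+z. indicator ?A z \<partial>circle_measure)" by simp
  also have "\<dots> = (\<integral>\<^sup>+t. indicator ?A (cis t) * indicator {0..<2 * pi} t \<partial>lborel)"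
    by (rule nn_integral_circle) measurable
  also have "\<dots> = (\<integral>\<^sup>+t. indicator {a..<b} t \<partial>lborel)"
    using assms by (intro nn_integral_cong) (auto simp: Arg space_circle_measure split: split_indicator)
  finally show ?thesis using assms by simp
qed

lemma emeasure_angle_box:
  assumes "\<And>i. i < L \<Longrightarrow> 0 \<le> a i \<and> a i + r \<le> 2 * pi" and "0 \<le> r"
  shows "emeasure (config_measure L) (angle_box L a r) = ennreal (r ^ L)"
proof -
  have "emeasure (config_measure L) (angle_box L a r) = (\<Prod>i<L. ennreal r)"
    unfolding angle_box_eq_PiE config_measure_def using assms
    by (subst circles.emeasure_PiM) (auto simp: arc_measurable emeasure_arc intro!: prod.cong)
  then show ?thesis using assms by (simp add: ennreal_power)
qed

text \<open>Were the variance 0, \<open>f\<close> would equal its mean almost everywhere; but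
  \<open>f\<close> is continuous in the angles, so around a configuration with another value a box
  of positive measure avoids the mean. Positivity matters because division by 0 yields 0, and such
  an \<open>f\<close> would spoil the infimum in \<open>spectral_gap\<close>.\<close>

lemma gibbs_variance_pos:
  assumes f: "smooth_on_configs L f" and nc: "\<not> f constant_on configs L"
  shows "0 < gibbs.variance L \<beta> f"
proof (rule ccontr)
  define m where "m = gibbs.expectation L \<beta> f"
  define F where "F \<theta> = f (angle_config L \<theta>)" for \<theta>
  note fm[measurable] = smooth_on_configs_measurable(1)[OF f]
  assume "\<not> ?thesis"
  then have v0: "(\<integral>S. (f S - m)\<^sup>2 \<partial>gibbs L \<beta>) = 0"
    using gibbs.variance_positive[of L \<beta> f] by (simp add: m_def)
  obtain B where B: "\<And>S. S \<in> configs L \<Longrightarrow> \<bar>(f S - m)\<^sup>2\<bar> \<le> B"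
    using smooth_square_bounds[OF f, of m] by metis
  have "integrable (gibbs L \<beta>) (\<lambda>S. (f S - m)\<^sup>2)"
    by (rule integrable_gibbs[OF _ B]) measurable
  with v0 have "AE S in gibbs L \<beta>. f S = m"
    by (subst (asm) integral_nonneg_eq_0_iff_AE) auto
  then have ae: "AE S in config_measure L. f S = m"
    unfolding gibbs_def using partition_function_pos[of L \<beta>]
    by (subst (asm) AE_density) auto
  obtain S0 where S0: "S0 \<in> configs L" "f S0 \<noteq> m" using nc by (auto simp: constant_on_def)
  define \<theta> where "\<theta> = args L S0"
  have \<theta>: "\<theta> \<in> {..<L} \<rightarrow>\<^sub>E UNIV" by (simp add: \<theta>_def args_in_PiE)
  have "continuous_on ({..<L} \<rightarrow>\<^sub>E UNIV) F" using smooth_on_configsD(1)[OF f] by (simp add: F_def[abs_def])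
  then have "\<exists>U. open U \<and> U \<inter> ({..<L} \<rightarrow>\<^sub>E UNIV) = F -` (- {m}) \<inter> ({..<L} \<rightarrow>\<^sub>E UNIV)"
    by (simp add: continuous_on_open_invariant open_Compl)
  then obtain U where U: "open U" "U \<inter> ({..<L} \<rightarrow>\<^sub>E UNIV) = F -` (- {m}) \<inter> ({..<L} \<rightarrow>\<^sub>E UNIV)" by blast
  have "F \<theta> \<noteq> m" using S0 by (simp add: F_def \<theta>_def angle_config_args)
  then have "\<theta> \<in> U" using \<theta> U(2) by blast
  have "openin (product_topology (\<lambda>_. euclidean) UNIV) U" using U(1) unfolding open_fun_def .
  from product_topology_open_contains_basis[OF this \<open>\<theta> \<in> U\<close>]
  obtain X where X: "\<theta> \<in> PiE UNIV X" "\<And>i. open (X i)" "PiE UNIV X \<subseteq> U" by auto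
  \<comment> \<open>One-sided intervals stay within the range of \<open>Arg2pi\<close>; at angle 0 a
    two-sided neighbourhood would wrap around.\<close>
  have "\<exists>r>0. \<theta> i + r \<le> 2 * pi \<and> {\<theta> i..<\<theta> i + r} \<subseteq> X i" if "i < L" for i
  proof -
    have "\<theta> i \<in> X i" using X(1) by auto
    then obtain e where e: "e > 0" "ball (\<theta> i) e \<subseteq> X i" using X(2)[of i] open_contains_ball by blast
    define r where "r = min e (2 * pi - \<theta> i)"
    have "\<theta> i < 2 * pi" using that Arg2pi_lt_2pi by (simp add: \<theta>_def args_def)
    then have "r > 0" "\<theta> i + r \<le> 2 * pi" "r \<le> e" using e by (auto simp: r_def)
    moreover from this have "{\<theta> i..<\<theta> i + r} \<subseteq> X i" using e(2) by (auto simp: ball_def dist_real_def)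
    ultimately show ?thesis by blast
  qed
  then obtain r where r: "\<And>i. i < L \<Longrightarrow> r i > 0 \<and> \<theta> i + r i \<le> 2 * pi \<and> {\<theta> i..<\<theta> i + r i} \<subseteq> X i" by metis
  \<comment> \<open>The inserted 1 keeps the minimum meaningful when \<open>L = 0\<close>.\<close>
  define \<rho> where "\<rho> = Min (insert 1 (r ` {..<L}))"
  have \<rho>: "\<rho> > 0" "\<And>i. i < L \<Longrightarrow> \<rho> \<le> r i" using r by (auto simp: \<rho>_def)
  have box: "f S \<noteq> m" if "S \<in> angle_box L \<theta> \<rho>" for S
  proof -
    have S: "S \<in> configs L" using that by (simp add: angle_box_def)
    have "args L S i \<in> X i" for i
    proof (cases "i < L")
      case True
      then have "args L S i \<in> {\<theta> i..<\<theta> i + r i}" using that \<rho>(2)[of i] by (auto simp: angle_box_def)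
      then show ?thesis using r[OF True] by blast
    next
      case False
      then have "args L S i = \<theta> i" by (simp add: \<theta>_def args_def)
      then show ?thesis using X(1) by auto
    qed
    then have "args L S \<in> U" using X(3) by auto
    then have "F (args L S) \<noteq> m" using U(2) args_in_PiE[of L S] by blast
    then show ?thesis using S by (simp add: F_def angle_config_args)
  qed
  have "angle_box L \<theta> \<rho> \<in> null_sets (config_measure L)"
    using ae box angle_box_measurable[of L \<theta> \<rho>] by (intro AE_iff_null_sets[THEN iffD2]) auto
  moreover have "emeasure (config_measure L) (angle_box L \<theta> \<rho>) = ennreal (\<rho> ^ L)"
  proof (rule emeasure_angle_box)
    fix i assume i: "i < L"
    have "0 \<le> \<theta> i" using i Arg2pi_ge_0 by (simp add: \<theta>_def args_def)
    then show "0 \<le> \<theta> i \<and> \<theta> i + \<rho> \<le> 2 * pi" using r[OF i] \<rho>(2)[OF i] by linarith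
  qed (use \<rho> in simp)
  ultimately show False using \<rho> by auto
qed

lemma relaxation_time_upper:
  assumes L: "0 < L" and \<beta>: "1 \<le> \<beta>"
  shows "relaxation_time L \<beta> \<le> ereal (pi\<^sup>2 * \<beta> powr (3/2) * exp (2 * \<beta>) * (real L)\<^sup>2)"
proof -
  define K where "K = pi\<^sup>2 * (real L)\<^sup>2 * exp (2 * \<beta>) * \<beta>"
  have K: "0 < K" using assms by (simp add: K_def)
  have "ereal (1 / K) \<le> spectral_gap L \<beta>"
    unfolding spectral_gap_def
  proof (rule INF_greatest)
    fix f assume "f \<in> {f. smooth_on_configs L f \<and> \<not> f constant_on configs L}"
    then have f: "smooth_on_configs L f" "\<not> f constant_on configs L" by auto
    have v: "0 < gibbs.variance L \<beta> f" by (rule gibbs_variance_pos[OF f])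
    have "gibbs.variance L \<beta> f \<le> K * dirichlet_form L \<beta> f"
      using gibbs_poincare[OF f(1) L, of \<beta>] \<beta> by (simp add: dirichlet_form_eq[OF f(1)] K_def)
    then have "1 / K \<le> dirichlet_form L \<beta> f / gibbs.variance L \<beta> f"
      using v K by (simp add: field_simps)
    then show "ereal (1 / K) \<le> ereal (dirichlet_form L \<beta> f / gibbs.variance L \<beta> f)" by simp
  qed
  then have "inverse (spectral_gap L \<beta>) \<le> inverse (ereal (1 / K))"
    using K by (intro ereal_inverse_antimono) auto
  also have "\<dots> = ereal K" using K by simp
  \<comment> \<open>The first power of \<open>\<beta>\<close> in \<open>K\<close> undoes the
    prefactor of the Dirichlet form; it is weakened here to the power 3/2.\<close>
  also have "\<dots> \<le> ereal (pi\<^sup>2 * \<beta> powr (3/2) * exp (2 * \<beta>) * (real L)\<^sup>2)"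
  proof -
    have "\<beta> powr 1 \<le> \<beta> powr (3/2)" using \<beta> by (intro powr_mono) auto
    then have "\<beta> \<le> \<beta> powr (3/2)" using \<beta> by simp
    then have "(pi\<^sup>2 * exp (2 * \<beta>) * (real L)\<^sup>2) * \<beta> \<le> (pi\<^sup>2 * exp (2 * \<beta>) * (real L)\<^sup>2) * \<beta> powr (3/2)"
      by (intro mult_left_mono) auto
    then show ?thesis by (simp add: K_def mult_ac)
  qed
  finally show ?thesis by (simp add: relaxation_time_def divide_ereal_def)
qed

section \<open>Smooth sums of ridge functions and a periodic primitive\<close>

text \<open>Supplies the infinite tower of derivatives that smoothness asks for: along the real axis
  differentiation commutes with taking real parts.\<close>

lemma entire_real_derivs:
  fixes g :: "complex \<Rightarrow> complex"
  assumes "g holomorphic_on UNIV"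
  shows "((\<lambda>x::real. Re ((deriv ^^ k) g (of_real x))) has_real_derivative Re ((deriv ^^ Suc k) g (of_real x))) (at x)"
  using has_field_derivative_higher_deriv[OF assms, of "of_real x" k]
  by (intro has_field_derivative_Re has_vector_derivative_real_field) (auto intro: has_field_derivative_at_within)

text \<open>Ridge sums with fixed directions \<open>A n\<close> are stable under partial
  derivatives: the coefficient picks up \<open>A n k\<close> and the profile advances from
  \<open>h n m\<close> to \<open>h n (Suc m)\<close>. The coefficients \<open>c n\<close> carry the
  factors accumulated by earlier derivatives.\<close>

lemma partial_deriv_ridge_sum:
  fixes h :: "'n \<Rightarrow> nat \<Rightarrow> real \<Rightarrow> real" and A :: "'n \<Rightarrow> nat \<Rightarrow> real"
  assumes h: "\<And>n m x. n \<in> N \<Longrightarrow> (h n m has_real_derivative h n (Suc m) x) (at x)" and k: "k < L"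
  shows "((\<lambda>t. \<Sum>n\<in>N. c n * h n m (\<Sum>i<L. A n i * (\<theta>(k := t)) i))
      has_real_derivative (\<Sum>n\<in>N. A n k * c n * h n (Suc m) (\<Sum>i<L. A n i * (\<theta>(k := t)) i))) (at t)"
proof -
  have inner: "(\<Sum>i<L. A n i * (\<theta>(k := t)) i) = A n k * t + (\<Sum>i\<in>{..<L} - {k}. A n i * \<theta> i)" for n t
    using k by (subst sum.remove[of _ k]) (auto intro!: sum.cong)
  show ?thesis unfolding inner
  proof (rule DERIV_sum)
    fix n assume n: "n \<in> N"
    have "((\<lambda>t. h n m (A n k * t + (\<Sum>i\<in>{..<L} - {k}. A n i * \<theta> i))) has_real_derivative
        h n (Suc m) (A n k * t + (\<Sum>i\<in>{..<L} - {k}. A n i * \<theta> i)) * A n k) (at t)"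
      by (rule DERIV_chain2[OF h[OF n]]) (auto intro!: derivative_eq_intros)
    from DERIV_cmult[OF this, of "c n"]
    show "((\<lambda>t. c n * h n m (A n k * t + (\<Sum>i\<in>{..<L} - {k}. A n i * \<theta> i))) has_real_derivative
        A n k * c n * h n (Suc m) (A n k * t + (\<Sum>i\<in>{..<L} - {k}. A n i * \<theta> i))) (at t)"
      by (simp add: mult_ac)
  qed
qed

lemma partial_derivs_ridge_sum:
  fixes h :: "'n \<Rightarrow> nat \<Rightarrow> real \<Rightarrow> real" and A :: "'n \<Rightarrow> nat \<Rightarrow> real"
  assumes h: "\<And>n m x. n \<in> N \<Longrightarrow> (h n m has_real_derivative h n (Suc m) x) (at x)" and ks: "set ks \<subseteq> {..<L}"
  shows "foldr partial_deriv ks (\<lambda>\<theta>. \<Sum>n\<in>N. h n 0 (\<Sum>i<L. A n i * \<theta> i))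
       = (\<lambda>\<theta>. \<Sum>n\<in>N. (\<Prod>k\<leftarrow>ks. A n k) * h n (length ks) (\<Sum>i<L. A n i * \<theta> i))"
  using ks
proof (induction ks)
  case (Cons k ks)
  then have k: "k < L" by simp
  let ?G = "\<lambda>\<theta>. \<Sum>n\<in>N. (\<Prod>k\<leftarrow>ks. A n k) * h n (length ks) (\<Sum>i<L. A n i * \<theta> i)"
  have "partial_deriv k ?G \<theta>
      = (\<Sum>n\<in>N. A n k * (\<Prod>k\<leftarrow>ks. A n k) * h n (Suc (length ks)) (\<Sum>i<L. A n i * (\<theta>(k := \<theta> k)) i))" for \<theta>
    unfolding partial_deriv_def
    by (rule DERIV_imp_deriv[OF partial_deriv_ridge_sum[where N = N and h = h, OF h k]])
  moreover have "foldr partial_deriv ks (\<lambda>\<theta>. \<Sum>n\<in>N. h n 0 (\<Sum>i<L. A n i * \<theta> i)) = ?G"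
    using Cons by simp
  ultimately show ?case by (auto simp only: foldr_Cons comp_apply list.map prod_list.Cons list.size fun_upd_triv add_0_right add_Suc_right)
qed simp

lemma C_infinity_ridge_sum:
  fixes h :: "'n \<Rightarrow> nat \<Rightarrow> real \<Rightarrow> real" and A :: "'n \<Rightarrow> nat \<Rightarrow> real"
  assumes h: "\<And>n m x. n \<in> N \<Longrightarrow> (h n m has_real_derivative h n (Suc m) x) (at x)"
  shows "C_infinity L (\<lambda>\<theta>. \<Sum>n\<in>N. h n 0 (\<Sum>i<L. A n i * \<theta> i))"
  unfolding C_infinity_def
proof (intro allI impI conjI ballI)
  fix ks :: "nat list" assume ks: "set ks \<subseteq> {..<L}"
  have eq: "foldr partial_deriv ks (\<lambda>\<theta>. \<Sum>n\<in>N. h n 0 (\<Sum>i<L. A n i * \<theta> i))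
       = (\<lambda>\<theta>. \<Sum>n\<in>N. (\<Prod>k\<leftarrow>ks. A n k) * h n (length ks) (\<Sum>i<L. A n i * \<theta> i))"
    by (rule partial_derivs_ridge_sum[where N = N and h = h and A = A, OF h ks])
  have ch: "continuous_on UNIV (h n m)" if "n \<in> N" for n m
    using h[OF that] by (intro continuous_at_imp_continuous_on) (auto intro: DERIV_isCont)
  have lin: "continuous_on ({..<L} \<rightarrow>\<^sub>E UNIV) (\<lambda>\<theta>. \<Sum>i<L. A n i * \<theta> i)" for n
    by (intro continuous_on_sum continuous_on_mult continuous_on_const
        continuous_on_subset[OF continuous_on_product_coordinates subset_UNIV])
  show "continuous_on ({..<L} \<rightarrow>\<^sub>E UNIV) (foldr partial_deriv ks (\<lambda>\<theta>. \<Sum>n\<in>N. h n 0 (\<Sum>i<L. A n i * \<theta> i)))"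
    unfolding eq
  proof (intro continuous_on_sum continuous_on_mult[OF continuous_on_const])
    show "continuous_on ({..<L} \<rightarrow>\<^sub>E UNIV) (\<lambda>\<theta>. h n (length ks) (\<Sum>i<L. A n i * \<theta> i))" if "n \<in> N" for n
      by (rule continuous_on_compose2[OF ch[OF that] lin]) simp
  qed
  fix i and \<theta> :: "nat \<Rightarrow> real" assume i: "i < L"
  show "(\<lambda>t. foldr partial_deriv ks (\<lambda>\<theta>. \<Sum>n\<in>N. h n 0 (\<Sum>i<L. A n i * \<theta> i)) (\<theta>(i := t))) differentiable at (\<theta> i)"
    unfolding eq using partial_deriv_ridge_sum[where N = N and h = h and A = A and c = "\<lambda>n. \<Prod>k\<leftarrow>ks. A n k" and m = "length ks" and \<theta> = \<theta>, OF h i]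
    by (meson real_differentiable_def)
qed

text \<open>The weight \<open>exp (- \<kappa> * cos x)\<close> concentrates at the antipode \<open>x = pi\<close>; its primitive \<open>P\<close> is
  used to build an approximate winding number. Complex analysis supplies all derivatives at once.\<close>

lemma antipodal_primitive:
  fixes \<kappa> :: real
  obtains P :: "nat \<Rightarrow> real \<Rightarrow> real" where
    "\<And>m x. (P m has_real_derivative P (Suc m) x) (at x)"
    "P (Suc 0) = (\<lambda>x. exp (- \<kappa> * cos x))" "P 0 0 = 0"
proof -
  define E where "E z = exp (- of_real \<kappa> * cos z)" for z :: complex
  have E: "E holomorphic_on UNIV" unfolding E_def by (intro holomorphic_intros)
  then have "continuous_on UNIV E" "\<And>z. E field_differentiable at z"
    by (auto intro: holomorphic_on_imp_continuous_on holomorphic_on_imp_differentiable_at)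
  then obtain Q where Q: "\<And>z. (Q has_field_derivative E z) (at z)"
    using holomorphic_convex_primitive[of UNIV "{}" E] by auto
  define R where "R z = Q z - Q 0" for z
  have R: "(R has_field_derivative E z) (at z)" for z
    unfolding R_def using Q[of z] by (auto intro!: derivative_eq_intros)
  have "R holomorphic_on UNIV" using R by (auto simp: holomorphic_on_open)
  from entire_real_derivs[OF this] show thesis
  proof (rule that)
    have "Re (deriv R (of_real x)) = exp (- \<kappa> * cos x)" for x
      by (simp only: DERIV_imp_deriv[OF R] E_def of_real_minus[symmetric] cos_of_real of_real_mult[symmetric]
          exp_of_real Re_complex_of_real)
    then show "(\<lambda>x. Re ((deriv ^^ Suc 0) R (of_real x))) = (\<lambda>x. exp (- \<kappa> * cos x))" by simp
    show "Re ((deriv ^^ 0) R (of_real 0)) = 0" by (simp add: R_def)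
  qed
qed

section \<open>The smoothed angle \<open>\<psi>\<close>\<close>

locale antipodal =
  fixes \<kappa> :: real and P :: "real \<Rightarrow> real"
  assumes \<kappa>: "0 \<le> \<kappa>" and P: "\<And>x. (P has_real_derivative exp (- \<kappa> * cos x)) (at x)" and P0: "P 0 = 0"
begin

text \<open>Makes \<open>c * P\<close> grow by \<open>2 * pi\<close> over a period, exactly like the
  identity, so that their difference is periodic. In classical terms it is the reciprocal of the
  modified Bessel function of order 0 at \<open>\<kappa>\<close>.\<close>

definition c :: real where "c = 2 * pi / P (2 * pi)"

lemma P_mono: "x \<le> y \<Longrightarrow> P x \<le> P y"
  by (rule DERIV_nonneg_imp_nondecreasing[where f = P]) (auto intro: P)

text \<open>Only the mass within distance \<open>r\<close> of the antipode is kept, where the weight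
  is at least \<open>exp (\<kappa> * cos r)\<close>. The width stays free: \<open>1 / L\<close>
  serves the sharp energy bound, \<open>pi / 3\<close> a crude bound on \<open>c\<close>.\<close>

lemma P_total_ge:
  assumes r: "0 \<le> r" "r \<le> pi"
  shows "2 * r * exp (\<kappa> * cos r) \<le> P (2 * pi)"
proof (cases "r = 0")
  case True
  then show ?thesis using P_mono[of 0 "2 * pi"] P0 by simp
next
  case False
  then have "pi - r < pi + r" using r by simp
  from MVT2[OF this P] obtain z where z: "pi - r < z" "z < pi + r"
    "P (pi + r) - P (pi - r) = (pi + r - (pi - r)) * exp (- \<kappa> * cos z)" by blast
  have "cos r \<le> cos (z - pi)"
    using cos_monotone_0_pi_le[of "\<bar>z - pi\<bar>" r] z r by (simp only: cos_abs_real)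
  then have "cos r \<le> - cos z" by (simp add: cos_diff)
  from mult_left_mono[OF this \<kappa>] have "exp (\<kappa> * cos r) \<le> exp (- \<kappa> * cos z)" by simp
  then have "2 * r * exp (\<kappa> * cos r) \<le> P (pi + r) - P (pi - r)"
    using r unfolding z(3) by (simp add: mult_left_mono)
  also have "\<dots> \<le> P (2 * pi) - P 0" using r by (intro diff_mono P_mono) auto
  finally show ?thesis by (simp add: P0)
qed

lemma P_total_pos: "0 < P (2 * pi)"
  using P_total_ge[of 1] pi_ge_two by (intro less_le_trans[OF _ P_total_ge[of 1]]) auto

lemma c_pos: "0 < c" unfolding c_def using P_total_pos by simp

lemma c_le:
  assumes r: "0 < r" "r \<le> pi"
  shows "c \<le> pi / r * exp (- \<kappa> * cos r)"
proof -
  have "c \<le> 2 * pi / (2 * r * exp (\<kappa> * cos r))"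
    unfolding c_def using P_total_ge[of r] r by (intro divide_left_mono mult_pos_pos P_total_pos) auto
  then show ?thesis by (simp add: exp_minus divide_simps)
qed

lemma P_shift: "P (x + 2 * pi) = P x + P (2 * pi)"
proof -
  have "((\<lambda>x. P (x + 2 * pi) - P x) has_real_derivative 0) (at x)" for x
    using DERIV_shift[of P "exp (- \<kappa> * cos (x + 2 * pi))" x "2 * pi"] P[of "x + 2 * pi"] P[of x]
    by (auto intro!: derivative_eq_intros)
  from DERIV_isconst_all[OF allI[OF this], of x 0] show ?thesis by (simp add: P0)
qed

text \<open>For large \<open>\<kappa>\<close> the function \<open>c * P\<close> is close to a
  staircase with steps of height \<open>2 * pi\<close> at the odd multiples of pi, so this is a
  smooth periodic substitute for the angle in (-pi, pi).\<close>

definition \<psi> :: "real \<Rightarrow> real" where "\<psi> x = x - c * P x"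

lemma \<psi>_periodic: "\<psi> (x + 2 * pi) = \<psi> x"
proof -
  have "c * P (2 * pi) = 2 * pi" using P_total_pos by (simp add: c_def)
  then show ?thesis unfolding \<psi>_def P_shift by (simp add: distrib_left)
qed

lemma \<psi>_periodic_int: "\<psi> (x + 2 * pi * of_int n) = \<psi> x"
proof (induction n rule: int_induct[where k = 0])
  case (step1 i)
  have "\<psi> (x + 2 * pi * of_int (i + 1)) = \<psi> ((x + 2 * pi * of_int i) + 2 * pi)" by (simp add: algebra_simps)
  then show ?case using step1 by (simp add: \<psi>_periodic)
next
  case (step2 i)
  have "\<psi> (x + 2 * pi * of_int i) = \<psi> ((x + 2 * pi * of_int (i - 1)) + 2 * pi)" by (simp add: algebra_simps)
  then show ?case using step2 by (simp add: \<psi>_periodic)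
qed simp

text \<open>By periodicity the jump of \<open>Arg2pi\<close> is invisible, and any lift of a bond
  angle may be used in its place.\<close>

lemma \<psi>_Arg2pi: "\<psi> (Arg2pi (cis x)) = \<psi> x"
proof -
  have "cis (Arg2pi (cis x)) = cis x" using Arg2pi_eq[of "cis x"] by (simp add: cis_conv_exp[symmetric])
  then have "sin (Arg2pi (cis x)) = sin x \<and> cos (Arg2pi (cis x)) = cos x" by (auto simp: complex_eq_iff)
  then obtain n :: int where "Arg2pi (cis x) = x + 2 * pi * of_int n"
    using sin_cos_eq_iff by (metis mult.commute mult.assoc)
  then show ?thesis by (simp add: \<psi>_periodic_int)
qed

lemma P_small:
  assumes "\<bar>x\<bar> \<le> a" "a \<le> pi"
  shows "\<bar>P x\<bar> \<le> a * exp (- \<kappa> * cos a)"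
proof -
  have "\<bar>P x - P 0\<bar> \<le> exp (- \<kappa> * cos a) * \<bar>x - 0\<bar>"
    unfolding real_norm_def[symmetric]
  proof (rule field_differentiable_bound[where S = "{-a..a}" and f' = "\<lambda>x. exp (- \<kappa> * cos x)"])
    fix z assume z: "z \<in> {-a..a}"
    show "(P has_real_derivative exp (- \<kappa> * cos z)) (at z within {-a..a})"
      by (rule has_field_derivative_at_within[OF P])
    have "cos a \<le> cos \<bar>z\<bar>" using z assms by (intro cos_monotone_0_pi_le) auto
    then have "cos a \<le> cos z" by (simp only: cos_abs_real)
    then show "norm (exp (- \<kappa> * cos z)) \<le> exp (- \<kappa> * cos a)" using \<kappa> by (simp add: mult_left_mono)
  qed (use assms in auto)
  also have "\<dots> \<le> exp (- \<kappa> * cos a) * a" using assms by (intro mult_left_mono) auto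
  finally show ?thesis by (simp add: P0 mult.commute)
qed

end

section \<open>Lower bound\<close>

lemma relaxation_time_lower:
  assumes f: "smooth_on_configs L f" "\<not> f constant_on configs L" and \<beta>: "0 < \<beta>" and q: "0 < q"
    and le: "dirichlet_form L \<beta> f \<le> q * gibbs.variance L \<beta> f"
  shows "ereal (1 / q) \<le> relaxation_time L \<beta>"
proof -
  \<comment> \<open>Nonnegativity of the gap permits the inversion of the bound; a vanishing gap is
    covered as well, its inverse being infinite.\<close>
  have "0 \<le> dirichlet_form L \<beta> g" for g
    unfolding dirichlet_form_def using \<beta> by (intro mult_nonneg_nonneg sum_nonneg) auto
  then have "0 \<le> spectral_gap L \<beta>"
    unfolding spectral_gap_def by (intro INF_greatest) (auto intro!: divide_nonneg_nonneg)
  moreover have "spectral_gap L \<beta> \<le> ereal q"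
  proof -
    have "spectral_gap L \<beta> \<le> ereal (dirichlet_form L \<beta> f / gibbs.variance L \<beta> f)"
      unfolding spectral_gap_def by (rule INF_lower) (use f in auto)
    also have "\<dots> \<le> ereal q"
      using le gibbs_variance_pos[OF f, of \<beta>] by (simp add: field_simps)
    finally show ?thesis .
  qed
  ultimately have "inverse (ereal q) \<le> inverse (spectral_gap L \<beta>)"
    by (intro ereal_inverse_antimono) auto
  then show ?thesis using q by (simp add: relaxation_time_def divide_ereal_def inverse_eq_divide)
qed

section \<open>Global rotation as the slow mode\<close>

lemma integral_gibbs_rotate:
  fixes h :: "(nat \<Rightarrow> complex) \<Rightarrow> real"
  assumes h[measurable]: "h \<in> borel_measurable (config_measure L)" and c: "c \<in> sphere 0 1"
  shows "(\<integral>S. h (\<lambda>i\<in>{..<L}. c * S i) \<partial>gibbs L \<beta>) = (\<integral>S. h S \<partial>gibbs L \<beta>)"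
proof -
  let ?R = "\<lambda>S. \<lambda>i\<in>{..<L}. c * S i"
  have R[measurable]: "?R \<in> config_measure L \<rightarrow>\<^sub>M config_measure L" by (rule measurable_rotate_config[OF c])
  have inner: "(c * x) \<bullet> (c * y) = x \<bullet> y" for x y :: complex
  proof -
    have "Re c * Re c + Im c * Im c = 1" using c by (metis cmod_power2 mem_sphere_0 one_power2 power2_eq_square)
    moreover have "(c * x) \<bullet> (c * y) = (Re c * Re c + Im c * Im c) * (x \<bullet> y)"
      by (simp add: inner_complex_def algebra_simps)
    ultimately show ?thesis by simp
  qed
  have H: "hamiltonian L (?R S) = hamiltonian L S" for S
    unfolding hamiltonian_def by (intro arg_cong[where f = uminus] sum.cong refl) (simp add: inner)
  have "(\<integral>S. exp (- \<beta> * hamiltonian L S) * h S \<partial>config_measure L)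
      = (\<integral>S. exp (- \<beta> * hamiltonian L (?R S)) * h (?R S) \<partial>config_measure L)"
    by (subst distr_rotate_config[OF c, of L, symmetric]) (subst integral_distr[OF R]; measurable)
  moreover have "(\<lambda>S. h (?R S)) \<in> borel_measurable (config_measure L)" by measurable
  ultimately show ?thesis by (simp add: integral_gibbs H)
qed

text \<open>For \<open>Re (S 0)\<close> the squared gradient is at most 1. Rotation by -1 shows that
  the mean is 0; rotation by \<open>\<i>\<close> exchanges the squares of the real and imaginary
  parts, which add up to 1, so the variance is 1/2.\<close>

lemma relaxation_time_rotation:
  assumes L: "0 < L" and \<beta>: "0 < \<beta>"
  shows "ereal (\<beta> / 2) \<le> relaxation_time L \<beta>"
proof -
  define h where "h n m x = Re ((deriv ^^ m) cos (complex_of_real x))" for n m :: nat and x :: real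
  define A where "A n i = (if i = 0 then 1 else 0 :: real)" for n i :: nat
  define f where "f S = Re (S 0)" for S :: "nat \<Rightarrow> complex"
  have h: "(h n m has_real_derivative h n (Suc m) x) (at x)" for n m x
    unfolding h_def by (rule entire_real_derivs[OF holomorphic_on_cos])
  have h0: "h n 0 x = cos x" for n x by (simp add: h_def cos_of_real)
  have h1: "h n (Suc 0) x = - sin x" for n x
    using DERIV_unique[OF h[of n 0 x, unfolded h0[abs_def]] DERIV_cos] .
  have Asum: "(\<Sum>i<L. A n i * \<theta> i) = \<theta> 0" for n \<theta>
    using L by (simp add: A_def if_distrib[of "\<lambda>x. x * _"] sum.delta cong: if_cong)
  have F: "(\<lambda>\<theta>. f (angle_config L \<theta>)) = (\<lambda>\<theta>. \<Sum>n\<in>{0::nat}. h n 0 (\<Sum>i<L. A n i * \<theta> i))"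
    using L by (simp add: Asum h0 f_def angle_config_def)
  have smooth: "smooth_on_configs L f"
    unfolding smooth_on_configs_def F by (rule C_infinity_ridge_sum) (rule h)
  have nc: "\<not> f constant_on configs L"
  proof
    assume "f constant_on configs L"
    then obtain k where k: "\<And>S. S \<in> configs L \<Longrightarrow> f S = k" by (auto simp: constant_on_def)
    have "f (angle_config L (\<lambda>_. x)) = cos x" for x using L by (simp add: f_def angle_config_def)
    then have "cos x = k" for x using k[OF angle_config_in_configs] by metis
    then have "cos 0 = cos pi" by metis
    then show False by simp
  qed
  have q: "(\<Sum>j<L. (spin_deriv j f S)\<^sup>2) \<le> 1" if S: "S \<in> configs L" for S
  proof -
    have "spin_deriv j f S = A 0 j * h 0 (Suc 0) (args L S 0)" if "j < L" for j
      using partial_derivs_ridge_sum[of "{0::nat}" h "[j]" L A, OF h] that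
      by (simp add: spin_deriv_eq_partial_deriv_args[OF S that] F Asum)
    then have "(\<Sum>j<L. (spin_deriv j f S)\<^sup>2) = (\<Sum>j<L. if j = 0 then (sin (args L S 0))\<^sup>2 else 0)"
      by (intro sum.cong) (auto simp: A_def h1)
    also have "\<dots> = (sin (args L S 0))\<^sup>2" using L by simp
    also have "\<dots> \<le> 1" by (simp add: abs_square_le_1)
    finally show ?thesis .
  qed
  note qm = smooth_on_configs_measurable[OF smooth]
  have "(\<integral>S. (\<Sum>j<L. (spin_deriv j f S)\<^sup>2) \<partial>gibbs L \<beta>) \<le> 1"
  proof (rule gibbs.integral_le_const)
    show "integrable (gibbs L \<beta>) (\<lambda>S. \<Sum>j<L. (spin_deriv j f S)\<^sup>2)"
      using qm q by (intro integrable_gibbs[where B = 1] borel_measurable_sum borel_measurable_power) (auto simp: sum_nonneg)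
  qed (use q in \<open>auto simp: space_gibbs\<close>)
  then have D: "dirichlet_form L \<beta> f \<le> 1 / \<beta>"
    using \<beta> by (simp add: dirichlet_form_eq[OF smooth] divide_right_mono)
  have cm: "(\<lambda>S. S 0) \<in> borel_measurable (config_measure L)"
    using measurable_compose[OF measurable_config_component measurable_circle_id, of 0 L] L by simp
  have fm[measurable]: "f \<in> borel_measurable (config_measure L)" by (rule qm(1))
  have f1: "\<bar>f S\<bar> \<le> 1" if "S \<in> configs L" for S
    using abs_Re_le_cmod[of "S 0"] config_norm[OF that L] by (simp add: f_def)
  then have f2: "\<bar>(f S)\<^sup>2\<bar> \<le> 1" if "S \<in> configs L" for S using that by (simp add: abs_square_le_1)
  have if': "integrable (gibbs L \<beta>) f" "integrable (gibbs L \<beta>) (\<lambda>S. (f S)\<^sup>2)"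
    using f1 f2 by (intro integrable_gibbs[where B = 1]; simp)+
  have mean: "gibbs.expectation L \<beta> f = 0"
  proof -
    have "gibbs.expectation L \<beta> f = (\<integral>S. f (\<lambda>i\<in>{..<L}. - 1 * S i) \<partial>gibbs L \<beta>)"
      by (rule integral_gibbs_rotate[OF fm, symmetric]) simp
    also have "\<dots> = - gibbs.expectation L \<beta> f" using L by (simp add: f_def[abs_def])
    finally show ?thesis by simp
  qed
  have "(\<integral>S. (f S)\<^sup>2 \<partial>gibbs L \<beta>) = (\<integral>S. (f (\<lambda>i\<in>{..<L}. \<i> * S i))\<^sup>2 \<partial>gibbs L \<beta>)"
    by (rule integral_gibbs_rotate[symmetric]) (simp_all add: fm)
  also have "\<dots> = (\<integral>S. 1 - (f S)\<^sup>2 \<partial>gibbs L \<beta>)"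
  proof (rule Bochner_Integration.integral_cong[OF refl])
    fix S assume "S \<in> space (gibbs L \<beta>)"
    then have "cmod (S 0) = 1" using L by (simp add: space_gibbs config_norm)
    then have "(Re (S 0))\<^sup>2 + (Im (S 0))\<^sup>2 = 1" by (metis cmod_power2 one_power2)
    then show "(f (\<lambda>i\<in>{..<L}. \<i> * S i))\<^sup>2 = 1 - (f S)\<^sup>2" using L by (simp add: f_def)
  qed
  also have "\<dots> = 1 - (\<integral>S. (f S)\<^sup>2 \<partial>gibbs L \<beta>)"
    using if' by (simp add: gibbs.prob_space)
  finally have "gibbs.variance L \<beta> f = 1 / 2" by (simp add: mean)
  then have "dirichlet_form L \<beta> f \<le> (2 / \<beta>) * gibbs.variance L \<beta> f"
    unfolding \<open>gibbs.variance L \<beta> f = 1 / 2\<close> using D by simp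
  from relaxation_time_lower[OF smooth nc \<beta> _ this] \<beta> show ?thesis by simp
qed

lemma sum_cyclic_shift:
  fixes g :: "nat \<Rightarrow> 'a :: comm_monoid_add"
  assumes "0 < L"
  shows "(\<Sum>i<L. g (Suc i mod L)) = (\<Sum>i<L. g i)"
proof -
  obtain n where n: "L = Suc n" using assms gr0_implies_Suc by blast
  have "(\<Sum>i<L. g (Suc i mod L)) = (\<Sum>i<n. g (Suc i)) + g 0"
    unfolding n by (simp add: sum.lessThan_Suc)
  also have "\<dots> = (\<Sum>i<L. g i)"
    unfolding n sum.lessThan_Suc_shift by (rule add.commute)
  finally show ?thesis .
qed

lemma cos_ge_quadratic: "1 - x\<^sup>2 / 2 \<le> cos x" for x :: real
proof -
  have "(sin (x / 2))\<^sup>2 \<le> (x / 2)\<^sup>2"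
    by (rule abs_le_square_iff[THEN iffD1]) (rule abs_sin_x_le_abs_x)
  moreover have "cos x = 1 - 2 * (sin (x / 2))\<^sup>2" using cos_double_sin[of "x / 2"] by simp
  ultimately show ?thesis by (simp add: power_divide)
qed

section \<open>The smoothed winding number: gradient and values\<close>

context antipodal
begin

text \<open>Where no bond is close to \<open>pi\<close>, \<open>\<psi>\<close> is the principal angle up to a small error, so the sum over
  the bonds is close to \<open>2 * pi\<close> times the winding number of the configuration.\<close>

definition winding :: "nat \<Rightarrow> (nat \<Rightarrow> complex) \<Rightarrow> real" where
  "winding L S = (\<Sum>i<L. \<psi> (Arg2pi (S (Suc i mod L) * cnj (S i))))"

text \<open>Used with two different lifts: differences of site angles, whose sum telescopes to 0,
  give a smooth formula; lifts that are small at every bond expose the winding number in the linear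
  sum.\<close>

lemma winding_lift:
  assumes "\<And>i. i < L \<Longrightarrow> S (Suc i mod L) * cnj (S i) = cis (\<eta> i)"
  shows "winding L S = (\<Sum>i<L. \<eta> i) - c * (\<Sum>i<L. P (\<eta> i))"
proof -
  have "winding L S = (\<Sum>i<L. \<psi> (\<eta> i))" using assms by (simp add: winding_def \<psi>_Arg2pi)
  then show ?thesis by (simp add: \<psi>_def sum_subtractf sum_distrib_left)
qed

lemma winding_angle_config:
  assumes "0 < L"
  shows "winding L (angle_config L \<theta>) = - c * (\<Sum>i<L. P (\<theta> (Suc i mod L) - \<theta> i))"
proof -
  have "winding L (angle_config L \<theta>)
      = (\<Sum>i<L. \<theta> (Suc i mod L) - \<theta> i) - c * (\<Sum>i<L. P (\<theta> (Suc i mod L) - \<theta> i))"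
    using assms by (intro winding_lift) (simp add: angle_config_def cis_cnj cis_mult)
  then show ?thesis by (simp add: sum_subtractf sum_cyclic_shift[OF assms])
qed

text \<open>Row \<open>i\<close> of the cyclic incidence matrix, the direction of the ridge function
  attached to bond \<open>i\<close>.\<close>

definition bond :: "nat \<Rightarrow> nat \<Rightarrow> nat \<Rightarrow> real" where
  "bond L i k = (if k = Suc i mod L then 1 else 0) - (if k = i then 1 else 0)"

lemma abs_bond_le: "\<bar>bond L i k\<bar> \<le> 1"
  by (simp add: bond_def)

lemma sum_bond: "i < L \<Longrightarrow> (\<Sum>k<L. bond L i k * \<theta> k) = \<theta> (Suc i mod L) - \<theta> i"
  by (simp add: bond_def left_diff_distrib sum_subtractf if_distrib[of "\<lambda>x. x * _"] sum.delta cong: if_cong)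

context
  fixes D :: "nat \<Rightarrow> real \<Rightarrow> real"
  assumes D: "\<And>m x. (D m has_real_derivative D (Suc m) x) (at x)" and D0: "D 0 = P"
begin

lemma winding_ridge_sum:
  assumes "0 < L"
  shows "(\<lambda>\<theta>. winding L (angle_config L \<theta>)) = (\<lambda>\<theta>. \<Sum>n<L. - c * D 0 (\<Sum>i<L. bond L n i * \<theta> i))"
  by (simp add: winding_angle_config[OF assms] sum_bond D0 sum_distrib_left sum_negf)

lemma cD: "((\<lambda>x. - c * D m x) has_real_derivative - c * D (Suc m) x) (at x)"
  by (rule DERIV_cmult[OF D])

lemma smooth_winding: "0 < L \<Longrightarrow> smooth_on_configs L (winding L)"
  unfolding smooth_on_configs_def winding_ridge_sum
  by (rule C_infinity_ridge_sum[where h = "\<lambda>_ m x. - c * D m x"]) (rule cD)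

text \<open>Only the bonds meeting site \<open>j\<close> contribute. Majorising by the sum over all
  bonds costs a power of \<open>L\<close>, which the constant depending on \<open>L\<close>
  absorbs.\<close>

lemma abs_spin_deriv_winding_le:
  assumes S: "S \<in> configs L" and j: "j < L"
  shows "\<bar>spin_deriv j (winding L) S\<bar> \<le> c * (\<Sum>i<L. exp (- \<kappa> * (S i \<bullet> S (Suc i mod L))))"
proof -
  define \<theta> where "\<theta> = args L S"
  have L: "0 < L" using j by simp
  have S\<theta>: "S i = cis (\<theta> i)" if "i < L" for i
    using angle_config_args[OF S] that by (metis \<theta>_def angle_config_def lessThan_iff restrict_apply')
  have D1: "D (Suc 0) x = exp (- \<kappa> * cos x)" for x
    using DERIV_unique[OF D[of 0 x, unfolded D0] P] .
  have cos: "cos (\<theta> (Suc i mod L) - \<theta> i) = S i \<bullet> S (Suc i mod L)" if "i < L" for i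
    using that L by (simp add: S\<theta> inner_complex_def cos_diff mult.commute)
  have "foldr partial_deriv [j] (\<lambda>\<theta>. \<Sum>n<L. - c * D 0 (\<Sum>i<L. bond L n i * \<theta> i))
      = (\<lambda>\<theta>. \<Sum>n<L. (\<Prod>k\<leftarrow>[j]. bond L n k) * (- c * D (length [j]) (\<Sum>i<L. bond L n i * \<theta> i)))"
    by (rule partial_derivs_ridge_sum[where h = "\<lambda>_ m x. - c * D m x"]) (use cD j in auto)
  then have "spin_deriv j (winding L) S = (\<Sum>n<L. bond L n j * (- c * exp (- \<kappa> * (S n \<bullet> S (Suc n mod L)))))"
    by (simp add: spin_deriv_eq_partial_deriv_args[OF S j] winding_ridge_sum[OF L] sum_bond D1 cos \<theta>_def[symmetric])
  also have "\<bar>\<dots>\<bar> \<le> (\<Sum>n<L. \<bar>bond L n j * (- c * exp (- \<kappa> * (S n \<bullet> S (Suc n mod L))))\<bar>)" by (rule sum_abs)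
  also have "\<dots> \<le> (\<Sum>n<L. c * exp (- \<kappa> * (S n \<bullet> S (Suc n mod L))))"
    using abs_bond_le c_pos by (intro sum_mono) (simp add: abs_mult mult_le_cancel_right1)
  finally show ?thesis by (simp add: sum_distrib_left)
qed

text \<open>With \<open>\<beta> \<le> 2 * \<kappa>\<close> the squared gradient compensates the Boltzmann factor of its own bond,
  and what remains is the energy of a configuration with one bond at \<open>pi\<close>.\<close>

lemma winding_energy_le:
  assumes S: "S \<in> configs L" and L: "0 < L" and \<beta>: "0 \<le> \<beta>" "\<beta> \<le> 2 * \<kappa>"
  shows "exp (- \<beta> * hamiltonian L S) * (\<Sum>j<L. (spin_deriv j (winding L) S)\<^sup>2)
    \<le> real L ^ 3 * (c\<^sup>2 * exp (2 * \<kappa>)) * exp (\<beta> * (real L - 2))"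
proof -
  define x where "x i = S i \<bullet> S (Suc i mod L)" for i
  have x: "\<bar>x i\<bar> \<le> 1" if "i < L" for i
    unfolding x_def by (rule abs_inner_config_le[OF S that]) (use L in simp)
  have G: "exp (- \<beta> * hamiltonian L S) = exp (\<beta> * (\<Sum>i<L. x i))"
    by (simp add: hamiltonian_def x_def)
  \<comment> \<open>Of the three factors \<open>L\<close> in the claim, one comes from
    Cauchy--Schwarz here, one from the sum over spins and one from the sum over bonds.\<close>
  have "(spin_deriv j (winding L) S)\<^sup>2 \<le> real L * c\<^sup>2 * (\<Sum>i<L. exp (- 2 * \<kappa> * x i))" if "j < L" for j
  proof -
    have "(spin_deriv j (winding L) S)\<^sup>2 \<le> (c * (\<Sum>i<L. exp (- \<kappa> * x i)))\<^sup>2"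
      using power_mono[OF abs_spin_deriv_winding_le[OF S that], of 2] by (simp add: x_def)
    also have "\<dots> \<le> c\<^sup>2 * ((\<Sum>i<L. (exp (- \<kappa> * x i))\<^sup>2) * real (card {..<L}))"
      unfolding power_mult_distrib by (intro mult_left_mono sum_squared_le_sum_of_squares) auto
    finally show ?thesis by (simp add: mult_ac exp_double[symmetric])
  qed
  then have "(\<Sum>j<L. (spin_deriv j (winding L) S)\<^sup>2) \<le> (\<Sum>j<L. real L * c\<^sup>2 * (\<Sum>i<L. exp (- 2 * \<kappa> * x i)))"
    by (intro sum_mono) auto
  then have "exp (- \<beta> * hamiltonian L S) * (\<Sum>j<L. (spin_deriv j (winding L) S)\<^sup>2)
      \<le> exp (\<beta> * (\<Sum>i<L. x i)) * (real L * (real L * c\<^sup>2 * (\<Sum>i<L. exp (- 2 * \<kappa> * x i))))"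
    unfolding G by (intro mult_left_mono) auto
  also have "\<dots> = real L * real L * c\<^sup>2 * (\<Sum>i<L. exp (\<beta> * (\<Sum>k<L. x k)) * exp (- 2 * \<kappa> * x i))"
    by (simp add: sum_distrib_left mult_ac)
  also have "\<dots> \<le> real L * real L * c\<^sup>2 * (\<Sum>i<L. exp (2 * \<kappa>) * exp (\<beta> * (real L - 2)))"
  proof (intro mult_left_mono sum_mono)
    fix i assume "i \<in> {..<L}"
    then have i: "i < L" by simp
    have "(\<Sum>k\<in>{..<L} - {i}. x k) \<le> (\<Sum>k\<in>{..<L} - {i}. 1)"
      using x by (intro sum_mono) (auto simp: abs_le_iff)
    also have "\<dots> = real L - 1" using i by simp
    finally have "\<beta> * (\<Sum>k\<in>{..<L} - {i}. x k) \<le> \<beta> * (real L - 1)" using \<beta> by (intro mult_left_mono)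
    \<comment> \<open>In the combined exponent \<open>x i\<close> has coefficient
      \<open>\<beta> - 2 * \<kappa>\<close>, which is at most 0, so the worst case is
      \<open>x i = -1\<close>.\<close>
    moreover have "- ((2 * \<kappa> - \<beta>) * x i) \<le> (2 * \<kappa> - \<beta>) * 1"
      unfolding minus_mult_right using \<beta> x[OF i] by (intro mult_left_mono) auto
    moreover have "(\<Sum>k<L. x k) = x i + (\<Sum>k\<in>{..<L} - {i}. x k)" using i by (subst sum.remove[of _ i]) auto
    ultimately have "\<beta> * (\<Sum>k<L. x k) + (- 2 * \<kappa> * x i) \<le> 2 * \<kappa> + \<beta> * (real L - 2)"
      by (simp add: algebra_simps)
    then show "exp (\<beta> * (\<Sum>k<L. x k)) * exp (- 2 * \<kappa> * x i) \<le> exp (2 * \<kappa>) * exp (\<beta> * (real L - 2))"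
      by (simp only: exp_add[symmetric] exp_le_cancel_iff)
  qed auto
  also have "\<dots> = real L ^ 3 * (c\<^sup>2 * exp (2 * \<kappa>)) * exp (\<beta> * (real L - 2))"
    by (simp add: power3_eq_cube mult_ac)
  finally show ?thesis .
qed

end

text \<open>With width \<open>r = 1 / L\<close> in \<open>c_le\<close> the loss
  \<open>2 * \<kappa> * (1 - cos r)\<close> in the exponent is at most \<open>\<kappa> / L\<close>.
  A fixed width would lose a fixed multiple of \<open>\<kappa>\<close> and spoil the 2 in the final
  exponent.\<close>

lemma c_square_le:
  assumes "0 < L"
  shows "c\<^sup>2 * exp (2 * \<kappa>) \<le> pi\<^sup>2 * (real L)\<^sup>2 * exp (\<kappa> / real L)"
proof -
  have L: "1 \<le> real L" using assms by simp
  have r: "1 / real L \<le> pi"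
  proof -
    have "1 / real L \<le> 1" using L by simp
    then show ?thesis using pi_ge_two by linarith
  qed
  have "c \<le> pi / (1 / real L) * exp (- \<kappa> * cos (1 / real L))" using L r by (intro c_le) auto
  then have "c\<^sup>2 \<le> (pi * real L * exp (- \<kappa> * cos (1 / real L)))\<^sup>2"
    using c_pos by (intro power_mono) auto
  also have "\<dots> = pi\<^sup>2 * (real L)\<^sup>2 * exp (- 2 * \<kappa> * cos (1 / real L))"
    by (simp add: power_mult_distrib exp_double[symmetric])
  finally have "c\<^sup>2 * exp (2 * \<kappa>) \<le> pi\<^sup>2 * (real L)\<^sup>2 * exp (- 2 * \<kappa> * cos (1 / real L)) * exp (2 * \<kappa>)"
    by (intro mult_right_mono) auto
  also have "\<dots> = pi\<^sup>2 * (real L)\<^sup>2 * exp (2 * \<kappa> * (1 - cos (1 / real L)))"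
    by (simp add: exp_add[symmetric] algebra_simps)
  also have "\<dots> \<le> pi\<^sup>2 * (real L)\<^sup>2 * exp (\<kappa> / real L)"
  proof -
    have "1 - cos (1 / real L) \<le> (1 / real L)\<^sup>2 / 2" using cos_ge_quadratic[of "1 / real L"] by simp
    also have "\<dots> \<le> (1 / real L) / 2" using L by (intro divide_right_mono) (auto simp: power2_eq_square divide_simps)
    finally have "2 * \<kappa> * (1 - cos (1 / real L)) \<le> 2 * \<kappa> * (1 / real L / 2)" using \<kappa> by (intro mult_left_mono) auto
    then show ?thesis by (intro mult_left_mono) auto
  qed
  finally show ?thesis .
qed

text \<open>Every bond has a lift of size at most \<open>9 / L\<close>: the box contributes 1 and
  the turn \<open>2 * pi\<close>, which is at most 8. For \<open>9 \<le> L\<close> this is at most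
  1, where the cosine is at least 1/2 and \<open>P\<close> is exponentially small. Each bond loses
  at most half the squared lift in energy, and 81/2 is rounded up to 41. The parameter
  \<open>w\<close> treats the aligned box and the box of winding number 1 together.\<close>

lemma winding_box:
  assumes w: "0 \<le> w" "w \<le> 1" and wi: "w \<in> \<int>" and L: "9 \<le> L" and \<kappa>8: "8 \<le> \<kappa>"
    and S: "S \<in> angle_box L (\<lambda>i. 2 * pi * w * real i / real L) (1 / real L)"
  shows "\<bar>winding L S - 2 * pi * w\<bar> \<le> 1 / 2"
    and "hamiltonian L S \<le> - (real L - 41 / real L)"
proof -
  define \<theta> where "\<theta> = args L S"
  \<comment> \<open>The closing bond receives the full turn \<open>2 * pi * w\<close>: this makes
    its lift small as well, and the lifts then add up to \<open>2 * pi * w\<close> instead of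
    0.\<close>
  define \<eta> where "\<eta> i = (if Suc i < L then \<theta> (Suc i) - \<theta> i else \<theta> 0 - \<theta> i + 2 * pi * w)" for i
  have L0: "0 < real L" "9 \<le> real L" using L by auto
  have SC: "S \<in> configs L" using S by (simp add: angle_box_def)
  have S\<theta>: "S i = cis (\<theta> i)" if "i < L" for i
    using angle_config_args[OF SC] that by (metis \<theta>_def angle_config_def lessThan_iff restrict_apply')
  have cw: "cis (2 * pi * w) = 1" using wi by (auto elim!: Ints_cases simp: cis_multiple_2pi)
  have Suc_mod: "Suc i mod L = (if Suc i < L then Suc i else 0)" if "i < L" for i
    using that by (cases "Suc i = L") auto
  have \<eta>: "S (Suc i mod L) * cnj (S i) = cis (\<eta> i)" if "i < L" for i
  proof (cases "Suc i < L")
    case True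
    then show ?thesis using that by (simp add: S\<theta> \<eta>_def cis_cnj cis_mult)
  next
    case False
    then have "S (Suc i mod L) * cnj (S i) = cis (\<theta> 0 - \<theta> i) * cis (2 * pi * w)"
      using that L by (simp add: Suc_mod S\<theta> cis_cnj cis_mult cw)
    then show ?thesis using False by (simp only: cis_mult \<eta>_def if_False)
  qed
  have sum_\<eta>: "(\<Sum>i<L. \<eta> i) = 2 * pi * w"
  proof -
    have "(\<Sum>i<L. \<eta> i) = (\<Sum>i<L. (\<theta> (Suc i mod L) - \<theta> i) + (if i = L - 1 then 2 * pi * w else 0))"
      using L by (intro sum.cong) (auto simp: \<eta>_def Suc_mod)
    also have "\<dots> = (\<Sum>i<L. \<theta> (Suc i mod L)) - (\<Sum>i<L. \<theta> i) + 2 * pi * w"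
      using L by (simp add: sum.distrib sum_subtractf)
    also have "(\<Sum>i<L. \<theta> (Suc i mod L)) = (\<Sum>i<L. \<theta> i)" using L by (intro sum_cyclic_shift) simp
    finally show ?thesis by simp
  qed
  define \<epsilon> where "\<epsilon> i = \<theta> i - 2 * pi * w * real i / real L" for i
  have \<epsilon>: "0 \<le> \<epsilon> i" "\<epsilon> i < 1 / real L" if "i < L" for i
    using S that by (auto simp: angle_box_def \<theta>_def \<epsilon>_def)
  have abs_\<eta>: "\<bar>\<eta> i\<bar> \<le> 9 / real L" if "i < L" for i
  proof -
    define i' where "i' = (if Suc i < L then Suc i else 0)"
    have i': "i' < L" using L by (simp add: i'_def)
    have "\<eta> i = \<epsilon> i' - \<epsilon> i + 2 * pi * w / real L"
    proof (cases "Suc i < L")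
      case True
      then show ?thesis using L0 by (simp add: \<eta>_def \<epsilon>_def i'_def field_simps)
    next
      case False
      then have e: "real i = real L - 1" using that by (simp add: of_nat_diff)
      have "2 * pi * w * real i + 2 * pi * w = 2 * pi * w * real L"
        unfolding e by (simp add: algebra_simps)
      then have "2 * pi * w * real i / real L + 2 * pi * w / real L = 2 * pi * w"
        using L0 by (simp only: add_divide_distrib[symmetric]) simp
      then show ?thesis using False by (simp add: \<eta>_def \<epsilon>_def i'_def)
    qed
    moreover have "\<bar>\<epsilon> i' - \<epsilon> i\<bar> \<le> 1 / real L" using \<epsilon>[OF that] \<epsilon>[OF i'] by linarith
    moreover have "\<bar>2 * pi * w / real L\<bar> \<le> 8 / real L"
    proof -
      have "2 * pi * w \<le> 2 * pi * 1" using w by (intro mult_left_mono) auto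
      also have "\<dots> \<le> 8" using pi_less_4 by simp
      finally show ?thesis using w L0 by (simp add: divide_right_mono)
    qed
    ultimately have "\<bar>\<eta> i\<bar> \<le> 1 / real L + 8 / real L" by linarith
    then show ?thesis by (simp add: add_divide_distrib[symmetric])
  qed
  have a1: "9 / real L \<le> 1" using L0 by simp
  have cos_half: "1 / 2 \<le> cos (9 / real L)"
  proof -
    have "(9 / real L)\<^sup>2 \<le> 1" using a1 L0 by (simp add: abs_square_le_1)
    then show ?thesis using cos_ge_quadratic[of "9 / real L"] by linarith
  qed
  have "\<bar>P (\<eta> i)\<bar> \<le> 9 / real L * exp (- \<kappa> / 2)" if "i < L" for i
  proof -
    have "\<bar>P (\<eta> i)\<bar> \<le> 9 / real L * exp (- \<kappa> * cos (9 / real L))"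
      using abs_\<eta>[OF that] a1 pi_ge_two by (intro P_small) auto
    also have "\<dots> \<le> 9 / real L * exp (- \<kappa> / 2)"
      using mult_left_mono[OF cos_half \<kappa>] L0 by (intro mult_left_mono) auto
    finally show ?thesis .
  qed
  then have "(\<Sum>i<L. \<bar>P (\<eta> i)\<bar>) \<le> (\<Sum>i<L. 9 / real L * exp (- \<kappa> / 2))" by (intro sum_mono) auto
  also have "\<dots> = 9 * exp (- \<kappa> / 2)" using L0 by simp
  finally have sumP: "\<bar>\<Sum>i<L. P (\<eta> i)\<bar> \<le> 9 * exp (- \<kappa> / 2)" by (rule order_trans[OF sum_abs])
  \<comment> \<open>The half-width \<open>pi / 3\<close> has cosine 1/2, so \<open>c\<close> and the
    sum of the \<open>P\<close> terms each contribute a factor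
    \<open>exp (- \<kappa> / 2)\<close>.\<close>
  have "c \<le> pi / (pi / 3) * exp (- \<kappa> * cos (pi / 3))" by (intro c_le) auto
  then have c3: "c \<le> 3 * exp (- \<kappa> / 2)" by (simp add: cos_60)
  have "winding L S = (\<Sum>i<L. \<eta> i) - c * (\<Sum>i<L. P (\<eta> i))" by (rule winding_lift) (rule \<eta>)
  then have "\<bar>winding L S - 2 * pi * w\<bar> = c * \<bar>\<Sum>i<L. P (\<eta> i)\<bar>"
    using c_pos by (simp add: sum_\<eta> abs_mult)
  also have "\<dots> \<le> 3 * exp (- \<kappa> / 2) * (9 * exp (- \<kappa> / 2))"
    using c3 sumP by (intro mult_mono) auto
  also have "\<dots> = 27 * exp (- \<kappa>)" by (simp add: exp_add[symmetric])
  also have "\<dots> \<le> 1 / 2"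
  proof -
    \<comment> \<open>What is needed is \<open>54 \<le> exp \<kappa>\<close>, and
      \<open>2 ^ 8 = 256\<close> provides it.\<close>
    have "(2::real) ^ 8 \<le> exp 1 ^ 8" using exp_ge_add_one_self[of 1] by (intro power_mono) auto
    also have "\<dots> = exp 8" by (simp add: exp_of_nat_mult[symmetric])
    also have "\<dots> \<le> exp \<kappa>" using \<kappa>8 by simp
    finally have "54 \<le> exp \<kappa>" by simp
    then show ?thesis by (simp add: exp_minus field_simps)
  qed
  finally show "\<bar>winding L S - 2 * pi * w\<bar> \<le> 1 / 2" .
  have "1 - 41 / (real L)\<^sup>2 \<le> S i \<bullet> S (Suc i mod L)" if "i < L" for i
  proof -
    have "S i \<bullet> S (Suc i mod L) = Re (S (Suc i mod L) * cnj (S i))" by (simp add: inner_complex_def mult.commute)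
    also have "\<dots> = cos (\<eta> i)" by (simp add: \<eta>[OF that])
    finally have "S i \<bullet> S (Suc i mod L) = cos (\<eta> i)" .
    moreover have "(\<eta> i)\<^sup>2 \<le> (9 / real L)\<^sup>2" using power_mono[OF abs_\<eta>[OF that], of 2] by simp
    moreover have "(9 / real L)\<^sup>2 / 2 \<le> 41 / (real L)\<^sup>2"
    proof -
      have "(9 / real L)\<^sup>2 / 2 = (81 / 2) / (real L)\<^sup>2" by (simp add: power_divide)
      also have "\<dots> \<le> 41 / (real L)\<^sup>2" by (rule divide_right_mono) auto
      finally show ?thesis .
    qed
    ultimately show ?thesis using cos_ge_quadratic[of "\<eta> i"] by linarith
  qed
  then have "(\<Sum>i<L. 1 - 41 / (real L)\<^sup>2) \<le> (\<Sum>i<L. S i \<bullet> S (Suc i mod L))" by (intro sum_mono) auto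
  then show "hamiltonian L S \<le> - (real L - 41 / real L)"
    using L0 by (simp add: hamiltonian_def power2_eq_square right_diff_distrib)
qed

end

section \<open>Assembling the lower bound\<close>

lemma integral_ge_on_angle_box:
  fixes h :: "(nat \<Rightarrow> complex) \<Rightarrow> real"
  assumes h: "integrable (config_measure L) h" "\<And>S. S \<in> configs L \<Longrightarrow> 0 \<le> h S"
    and v: "\<And>S. S \<in> angle_box L a r \<Longrightarrow> v \<le> h S" and r: "0 \<le> r"
    and a: "\<And>i. i < L \<Longrightarrow> 0 \<le> a i \<and> a i + r \<le> 2 * pi"
  shows "v * r ^ L \<le> (\<integral>S. h S \<partial>config_measure L)"
proof -
  have m: "measure (config_measure L) (angle_box L a r) = r ^ L"
    using emeasure_angle_box[OF a r, of L] r by (simp add: measure_def)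
  have "v * r ^ L = (\<integral>S. v * indicator (angle_box L a r) S \<partial>config_measure L)"
    using angle_box_measurable[of L a r] by (simp add: m)
  also have "\<dots> \<le> (\<integral>S. h S \<partial>config_measure L)"
  proof (rule integral_mono)
    show "integrable (config_measure L) (\<lambda>S. v * indicator (angle_box L a r) S)"
      using angle_box_measurable[of L a r] by (simp add: integrable_real_indicator config.emeasure_finite less_top[symmetric])
    show "v * indicator (angle_box L a r) S \<le> h S" if "S \<in> space (config_measure L)" for S
      using that h(2)[of S] v[of S] by (auto simp: space_config_measure split: split_indicator)
  qed (rule h)
  finally show ?thesis .
qed

lemma angle_box_nonempty:
  assumes r: "0 < r" and a: "\<And>i. i < L \<Longrightarrow> 0 \<le> a i \<and> a i + r \<le> 2 * pi"
  shows "angle_box L a r \<noteq> {}"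
proof -
  have "emeasure (config_measure L) (angle_box L a r) \<noteq> 0"
    using emeasure_angle_box[OF a, of L] r by simp
  then show ?thesis by auto
qed

text \<open>The energy integrand is bounded uniformly over all configurations, the variance from
  below by a single box of volume \<open>r ^ L\<close>; the partition function is common to both and
  cancels. The factor \<open>\<beta>\<close> is the inverse of the prefactor of the Dirichlet
  form.\<close>

lemma relaxation_time_winding:
  assumes L: "9 \<le> L" and \<beta>: "1 \<le> \<beta>"
  defines "M \<equiv> 4 * (2 * pi) ^ L * real L ^ 5 * pi\<^sup>2 * real L ^ L"
  shows "ereal (1 / M * \<beta> * exp ((2 - 49 / real L) * \<beta>)) \<le> relaxation_time L \<beta>"
proof -
  \<comment> \<open>For \<open>\<beta> \<ge> 1\<close> this meets both requirements,
    \<open>\<beta> \<le> 2 * \<kappa>\<close> for the energy and \<open>8 \<le> \<kappa>\<close> for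
    the boxes, while \<open>exp (\<kappa> / L)\<close> costs only \<open>8 * \<beta> / L\<close> in
    the exponent.\<close>
  define \<kappa> where "\<kappa> = 8 * \<beta>"
  obtain D where D: "\<And>m x. (D m has_real_derivative D (Suc m) x) (at x)"
    "D (Suc 0) = (\<lambda>x. exp (- \<kappa> * cos x))" "D 0 0 = 0"
    using antipodal_primitive[of \<kappa>] by blast
  interpret antipodal \<kappa> "D 0"
  proof
    show "(D 0 has_real_derivative exp (- \<kappa> * cos x)) (at x)" for x using D(1)[of 0 x] D(2) by simp
  qed (use \<beta> D(3) in \<open>simp_all add: \<kappa>_def\<close>)
  have L0: "0 < L" "1 \<le> real L" using L by auto
  define f where "f = winding L"
  define a where "a w i = 2 * pi * w * real i / real L" for w :: real and i :: nat
  define r where "r = 1 / real L"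
  have r: "0 < r" using L0 by (simp add: r_def)
  \<comment> \<open>Even with winding number 1 the last arc ends before \<open>2 * pi\<close>, since
    its length \<open>1 / L\<close> is below the spacing \<open>2 * pi / L\<close>.\<close>
  have a: "0 \<le> a w i \<and> a w i + r \<le> 2 * pi" if "w = 0 \<or> w = 1" "i < L" for w i
  proof -
    have "2 * pi * w * real i \<le> 2 * pi * 1 * (real L - 1)"
      using that by (intro mult_mono) auto
    then have "2 * pi * w * real i + 1 \<le> 2 * pi * real L" using pi_ge_two by (simp add: algebra_simps)
    then have "(2 * pi * w * real i + 1) / real L \<le> 2 * pi" using L0 by (simp add: divide_le_eq)
    then show ?thesis using that L0 by (auto simp: a_def r_def add_divide_distrib)
  qed
  have \<kappa>8: "8 \<le> \<kappa>" using \<beta> by (simp add: \<kappa>_def)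
  have box: "\<bar>f S - 2 * pi * w\<bar> \<le> 1 / 2" "hamiltonian L S \<le> - (real L - 41 / real L)"
    if "S \<in> angle_box L (a w) r" "w = 0 \<or> w = 1" for S w
  proof -
    have "w \<in> \<int>" "0 \<le> w" "w \<le> 1" using that by auto
    from winding_box[OF this(2,3,1) L \<kappa>8, of S] that(1)
    show "\<bar>f S - 2 * pi * w\<bar> \<le> 1 / 2" "hamiltonian L S \<le> - (real L - 41 / real L)"
      by (simp_all add: a_def[abs_def] r_def f_def)
  qed
  have smooth: "smooth_on_configs L f" unfolding f_def by (rule smooth_winding[of D, OF D(1) refl L0(1)])
  have nc: "\<not> f constant_on configs L"
  proof
    assume "f constant_on configs L"
    then obtain k where k: "\<And>S. S \<in> configs L \<Longrightarrow> f S = k" by (auto simp: constant_on_def)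
    have "angle_box L (a w) r \<noteq> {}" if w: "w = 0 \<or> w = 1" for w
      by (rule angle_box_nonempty[OF r]) (rule a[OF w])
    then obtain S0 S1 where S: "S0 \<in> angle_box L (a 0) r" "S1 \<in> angle_box L (a 1) r" by blast
    then have "f S0 = k" "f S1 = k" using k by (auto simp: angle_box_def)
    then show False using box(1)[OF S(1)] box(1)[OF S(2)] pi_ge_two by (simp add: abs_le_iff)
  qed
  let ?Z = "partition_function L \<beta>" and ?G = "\<lambda>S. exp (- \<beta> * hamiltonian L S)"
  have Z: "0 < ?Z" by (rule partition_function_pos)
  note fm[measurable] = smooth_on_configs_measurable[OF smooth]
  define q where "q S = (\<Sum>j<L. (spin_deriv j f S)\<^sup>2)" for S
  have qm[measurable]: "q \<in> borel_measurable (config_measure L)" unfolding q_def by measurable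
  define m where "m = gibbs.expectation L \<beta> f"
  obtain B where B: "\<And>S. S \<in> configs L \<Longrightarrow> \<bar>(f S - m)\<^sup>2\<bar> \<le> B" "\<And>S. S \<in> configs L \<Longrightarrow> \<bar>q S\<bar> \<le> B"
    using smooth_square_bounds[OF smooth, of m] unfolding q_def by metis
  define U where "U = real L ^ 3 * (pi\<^sup>2 * (real L)\<^sup>2 * exp (\<kappa> / real L)) * exp (\<beta> * (real L - 2))"
  have "(\<integral>S. ?G S * q S \<partial>config_measure L) \<le> (\<integral>S. U \<partial>config_measure L)"
  proof (rule integral_mono[OF integrable_boltzmann[OF qm B(2)]])
    fix S assume "S \<in> space (config_measure L)"
    then have S: "S \<in> configs L" by (simp add: space_config_measure)
    have "?G S * q S \<le> real L ^ 3 * (c\<^sup>2 * exp (2 * \<kappa>)) * exp (\<beta> * (real L - 2))"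
      unfolding q_def f_def using \<beta> by (intro winding_energy_le[of D, OF D(1) refl S L0(1)]) (auto simp: \<kappa>_def)
    also have "\<dots> \<le> U"
      unfolding U_def by (intro mult_right_mono mult_left_mono c_square_le L0) auto
    finally show "?G S * q S \<le> U" .
  qed simp_all
  also have "\<dots> = U * (2 * pi) ^ L"
    by (simp add: measure_def space_config_measure emeasure_config_measure)
  finally have Dle: "dirichlet_form L \<beta> f \<le> 1 / \<beta> * (U * (2 * pi) ^ L / ?Z)"
    unfolding dirichlet_form_eq[OF smooth] q_def[symmetric] integral_gibbs[OF qm]
    using \<beta> Z by (intro mult_left_mono divide_right_mono) auto
  define V where "V = exp (\<beta> * (real L - 41 / real L)) / 4"
  have "V * r ^ L \<le> (\<integral>S. ?G S * (f S - m)\<^sup>2 \<partial>config_measure L)"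
  proof -
    \<comment> \<open>The mean \<open>m\<close> is unknown. Values cluster near 0 on one box and
      near \<open>2 * pi\<close> on the other; comparing \<open>m\<close> with 1 selects the box on
      which \<open>f\<close> is at distance at least 1/2 from \<open>m\<close>.\<close>
    define w :: real where "w = (if m \<ge> 1 then 0 else 1)"
    have w: "w = 0 \<or> w = 1" by (simp add: w_def)
    show ?thesis
    proof (rule integral_ge_on_angle_box[where a = "a w"])
      show "integrable (config_measure L) (\<lambda>S. ?G S * (f S - m)\<^sup>2)"
        by (rule integrable_boltzmann[OF _ B(1)]) measurable
      show "V \<le> ?G S * (f S - m)\<^sup>2" if S: "S \<in> angle_box L (a w) r" for S
      proof -
        have "1 / 2 \<le> \<bar>f S - m\<bar>"
        proof (cases "1 \<le> m")
          case True
          then have "\<bar>f S\<bar> \<le> 1 / 2" using box(1)[OF S w] by (simp add: w_def)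
          with True show ?thesis by linarith
        next
          case False
          then have "\<bar>f S - 2 * pi\<bar> \<le> 1 / 2" using box(1)[OF S w] by (simp add: w_def)
          with False pi_ge_two show ?thesis by linarith
        qed
        from power_mono[OF this, of 2] have "1 / 4 \<le> (f S - m)\<^sup>2" by (simp add: power2_eq_square)
        moreover have "\<beta> * (real L - 41 / real L) \<le> \<beta> * - hamiltonian L S"
          using box(2)[OF S w] \<beta> by (intro mult_left_mono) auto
        ultimately have "exp (\<beta> * (real L - 41 / real L)) * (1 / 4) \<le> ?G S * (f S - m)\<^sup>2"
          by (intro mult_mono) auto
        then show ?thesis by (simp add: V_def)
      qed
    qed (use a[OF w] r in auto)
  qed
  then have Vge: "V * r ^ L / ?Z \<le> gibbs.variance L \<beta> f"
    unfolding m_def[symmetric] using Z by (subst integral_gibbs) (auto intro: divide_right_mono)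
  define Q where "Q = M / \<beta> * exp (- ((2 - 49 / real L) * \<beta>))"
  have M: "0 < M" using L0 by (simp add: M_def)
  then have Q: "0 < Q" using \<beta> by (simp add: Q_def)
  have UV: "U * (2 * pi) ^ L = M * exp (- ((2 - 49 / real L) * \<beta>)) * (V * r ^ L)"
  proof -
    \<comment> \<open>Here 49 arises as \<open>41 + 8\<close>: the energy of the boxes and the cost
      of the smoothing.\<close>
    have "\<kappa> / real L + \<beta> * (real L - 2) = - ((2 - 49 / real L) * \<beta>) + \<beta> * (real L - 41 / real L)"
      by (simp add: \<kappa>_def algebra_simps)
    then have e: "exp (\<kappa> / real L) * exp (\<beta> * (real L - 2)) = exp (- ((2 - 49 / real L) * \<beta>)) * (4 * V)"
      by (simp add: V_def exp_add[symmetric])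
    have rL: "real L ^ L * r ^ L = 1" using L0 by (simp add: r_def power_mult_distrib[symmetric])
    have "U * (2 * pi) ^ L = real L ^ 5 * pi\<^sup>2 * (2 * pi) ^ L * (exp (\<kappa> / real L) * exp (\<beta> * (real L - 2)))"
      by (simp add: U_def power_add[symmetric] mult_ac flip: power_add)
    also have "\<dots> = real L ^ 5 * pi\<^sup>2 * (2 * pi) ^ L * (exp (- ((2 - 49 / real L) * \<beta>)) * (4 * V)) * (real L ^ L * r ^ L)"
      unfolding e rL by simp
    finally show ?thesis by (simp add: M_def mult_ac)
  qed
  have "dirichlet_form L \<beta> f \<le> Q * (V * r ^ L / ?Z)"
    using Dle unfolding UV by (simp add: Q_def)
  also have "\<dots> \<le> Q * gibbs.variance L \<beta> f" using Vge Q by (intro mult_left_mono) auto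
  finally have "ereal (1 / Q) \<le> relaxation_time L \<beta>"
    using \<beta> Q by (intro relaxation_time_lower[OF smooth nc]) auto
  moreover have "1 / Q = 1 / M * \<beta> * exp ((2 - 49 / real L) * \<beta>)"
    unfolding Q_def exp_minus by (simp add: divide_inverse mult_ac)
  ultimately show ?thesis by simp
qed

text \<open>The split at 9 is imposed by \<open>winding_box\<close>; below it the exponent
  \<open>2 - 49 / L\<close> is negative, so that the exponential is at most 1.\<close>

lemma relaxation_time_lower_bound:
  assumes L: "2 \<le> L"
  shows "\<exists>c>0. \<forall>\<beta>\<ge>1. ereal (c * \<beta> * exp ((2 - 49 / real L) * \<beta>)) \<le> relaxation_time L \<beta>"
proof (cases "9 \<le> L")
  case True
  then show ?thesis
    using relaxation_time_winding[OF True]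
    by (intro exI[of _ "1 / (4 * (2 * pi) ^ L * real L ^ 5 * pi\<^sup>2 * real L ^ L)"]) auto
next
  case False
  have "ereal (1 / 2 * \<beta> * exp ((2 - 49 / real L) * \<beta>)) \<le> relaxation_time L \<beta>" if \<beta>: "1 \<le> \<beta>" for \<beta> :: real
  proof -
    have "2 \<le> 49 / real L" using False L by (simp add: le_divide_eq)
    then have "(2 - 49 / real L) * \<beta> \<le> 0" using \<beta> by (intro mult_nonpos_nonneg) auto
    then have "1 / 2 * \<beta> * exp ((2 - 49 / real L) * \<beta>) \<le> 1 / 2 * \<beta> * 1"
      using \<beta> by (intro mult_left_mono) auto
    then have "ereal (1 / 2 * \<beta> * exp ((2 - 49 / real L) * \<beta>)) \<le> ereal (\<beta> / 2)" by simp
    also have "\<dots> \<le> relaxation_time L \<beta>"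
      using L \<beta> by (intro relaxation_time_rotation) auto
    finally show ?thesis .
  qed
  then show ?thesis by (intro exI[of _ "1 / 2"]) auto
qed

theorem theorem1p2:
  "(\<exists>C::real. \<forall>L::nat. \<forall>\<beta>::real. L \<ge> 2 \<longrightarrow> \<beta> \<ge> 1 \<longrightarrow>
      relaxation_time L \<beta> \<le> ereal (C * \<beta> powr (3/2) * exp (2 * \<beta>) * (real L)\<^sup>2)) \<and>
   (\<exists>C0::real. \<forall>L::nat. L \<ge> 2 \<longrightarrow>
      (\<exists>c::real. c > 0 \<and> (\<forall>\<beta>::real. \<beta> \<ge> 1 \<longrightarrow>
         relaxation_time L \<beta> \<ge> ereal (c * \<beta> * exp ((2 - C0 / real L) * \<beta>)))))"
proof (intro conjI)
  show "\<exists>C::real. \<forall>L::nat. \<forall>\<beta>::real. L \<ge> 2 \<longrightarrow> \<beta> \<ge> 1 \<longrightarrow>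
      relaxation_time L \<beta> \<le> ereal (C * \<beta> powr (3/2) * exp (2 * \<beta>) * (real L)\<^sup>2)"
    using relaxation_time_upper by (intro exI[of _ "pi\<^sup>2"]) auto
  show "\<exists>C0::real. \<forall>L::nat. L \<ge> 2 \<longrightarrow>
      (\<exists>c::real. c > 0 \<and> (\<forall>\<beta>::real. \<beta> \<ge> 1 \<longrightarrow>
         relaxation_time L \<beta> \<ge> ereal (c * \<beta> * exp ((2 - C0 / real L) * \<beta>))))"
    using relaxation_time_lower_bound by (intro exI[of _ 49]) auto
qed

end
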